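(* There exist constants $\delta>0$ and $C>0$ such that, if $E\subset\mathbb{R}^2$ is a nonempty bounded, open, convex set with $\mathcal{D}(E)\le\delta$, then $$C\,\mathcal{A}_{\mathcal H}(E)^{\frac52}\le\mathcal{D}(E).$$ Moreover, the exponent $\frac52$ is sharp: for every $\beta<\frac52$ there are no constants $\delta'>0$, $C'>0$ such that $C'\mathcal{A}_{\mathcal H}(E)^{\beta}\le\mathcal{D}(E)$ for all nonempty bounded, open, convex sets $E\subset\mathbb{R}^2$ with $\mathcal{D}(E)\le\delta'$.
   Context: In the plane, $V$ is Lebesgue measure (area), $P$ the perimeter ($P(E)=\mathcal{H}^{1}(\partial E)$ for convex $E$), and $W(E)=\int_{\partial E}|x|^2\,d\mathcal{H}^{1}$ the boundary momentum. Define $I(E)=\dfrac{W(E)}{V(E)P(E)}$ and $\mathcal{D}(E)=I(E)-I(B)=I(E)-\dfrac1\pi$, where $B$ is the unit disc centered at the origin. The Hausdorff distance is $d_{\mathcal H}(E,F)=\inf\{\varepsilon>0: E\subset F+B_\varepsilon,\ F\subset E+B_\varepsilon\}$ ($B_\varepsilon$ the disc of radius $\varepsilon$ centered at the origin), $B_R(x)$ is the disc of radius $R$ centered at $x$, and $$\mathcal{A}_{\mathcal H}(E)=\min_{x\in\mathbb{R}^2}\left\{\frac{d_{\mathcal H}(E,B_R(x))}{R}\;:\; P(B_R(x))=P(E)\right\}.$$ *)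

theory Defs
  imports "HOL-Analysis.Analysis"
begin

text \<open>
  One-dimensional Hausdorff measure. With the usual normalising factor
  \<open>\<omega>\<^sub>1 / 2 = 1\<close>, a set contributes exactly its diameter, so that \<open>hausdorff1\<close> is
  arc length on rectifiable curves. The boundedness condition on the covering sets
  is needed because \<^const>\<open>diameter\<close> is unspecified on unbounded sets.
\<close>

definition hausdorff1_pre :: "real \<Rightarrow> 'a::metric_space set \<Rightarrow> ennreal" where
  "hausdorff1_pre \<delta> A =
     (INF U \<in> {U :: nat \<Rightarrow> 'a set. A \<subseteq> (\<Union>n. U n) \<and> (\<forall>n. bounded (U n) \<and> diameter (U n) \<le> \<delta>)}.
        (\<Sum>n. ennreal (diameter (U n))))"

definition hausdorff1_outer :: "'a::metric_space set \<Rightarrow> ennreal" where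
  "hausdorff1_outer A = (SUP \<delta> \<in> {0<..}. hausdorff1_pre \<delta> A)"

text \<open>
  \<^const>\<open>hausdorff1_outer\<close> is a metric outer measure, hence countably additive on the
  Borel sets (Caratheodory's criterion), so \<^const>\<open>measure_of\<close> yields its restriction
  to the Borel sets here.
\<close>

definition hausdorff1 :: "'a::metric_space measure" where
  "hausdorff1 = measure_of UNIV (sets borel) hausdorff1_outer"

definition area :: "(real^2) set \<Rightarrow> real" where
  "area E = measure lebesgue E"

text \<open>The perimeter is only meant for convex sets, where it is the length of the boundary.\<close>

definition perimeter :: "(real^2) set \<Rightarrow> real" where
  "perimeter E = measure hausdorff1 (frontier E)"

definition boundary_momentum :: "(real^2) set \<Rightarrow> real" where
  "boundary_momentum E = (LINT x:frontier E|hausdorff1. (norm x)\<^sup>2)"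

definition weinstock_ratio :: "(real^2) set \<Rightarrow> real" where
  "weinstock_ratio E = boundary_momentum E / (area E * perimeter E)"

text \<open>The ratio of the unit disc equals \<open>1 / \<pi>\<close>.\<close>

definition deficit :: "(real^2) set \<Rightarrow> real" where
  "deficit E = weinstock_ratio E - weinstock_ratio (ball 0 1)"

text \<open>\<open>F + ball 0 \<epsilon>\<close> is the Minkowski sum.\<close>

definition hausdorff_distance :: "(real^2) set \<Rightarrow> (real^2) set \<Rightarrow> real" where
  "hausdorff_distance E F = Inf {\<epsilon>. 0 < \<epsilon> \<and> E \<subseteq> F + ball 0 \<epsilon> \<and> F \<subseteq> E + ball 0 \<epsilon>}"

text \<open>
  For nonempty bounded open convex \<open>E\<close> the perimeter constraint fixes the radius
  \<open>R\<close>, and the infimum is attained: \<open>x \<mapsto> hausdorff_distance E (ball x R)\<close> is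
  continuous and tends to infinity with \<open>x\<close>. Hence \<^const>\<open>Inf\<close> is the minimum.
\<close>

definition hausdorff_asymmetry :: "(real^2) set \<Rightarrow> real" where
  "hausdorff_asymmetry E =
     Inf {hausdorff_distance E (ball x R) / R | x R. 0 < R \<and> perimeter (ball x R) = perimeter E}"

end

theory Submission
  imports Defs "HOL-Real_Asymp.Real_Asymp"
begin

text \<open>
  Let \<open>h\<close> be the support function of \<open>E\<close> about the centroid \<open>c\<close> of its boundary, \<open>ds\<close> arc length
  and \<open>d\<theta>\<close> the angle of the outer normal. With \<open>q = h'\<close> one has \<open>dh = q d\<theta>\<close> and \<open>dq = ds - h d\<theta>\<close>
  along the boundary, so integrating exact differentials gives \<open>P = \<integral> h d\<theta>\<close>, \<open>2 V = \<integral> h ds\<close> and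
  \<open>\<integral> |x - c|\<^sup>2 ds = (\<integral> h\<^sup>2 ds + \<integral> h\<^sup>3 d\<theta>) / 2\<close>. For \<open>m = P / (2 \<pi>)\<close> this means
  \<open>\<integral> |x - c|\<^sup>2 ds - V P / \<pi> = (\<integral> (h - m)\<^sup>2 ds + \<integral> (h - m)\<^sup>2 (h + 2 m) d\<theta>) / 2\<close>.
  Since \<open>E\<close> is convex, a deviation \<open>t = max |h - m|\<close> persists up to a factor on a set of
  \<open>d\<theta>\<close>- or \<open>ds\<close>-measure of order \<open>sqrt t\<close>, whence the power \<open>t\<^sup>2 sqrt t\<close>. The convex hull of the
  unit disc and a point at distance \<open>1 + t\<close> from its centre shows that nothing better holds:
  there \<open>h = 1\<close> along the boundary away from the corner, and the corner has no length.

  The identities are obtained without differentiability of the boundary: all the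
  integrals in \<open>ds\<close> are limits of sums over points at equally spaced polar angles, with any
  choice of normals \<open>\<theta>\<close>, and the errors are of second order in the increments of \<open>x\<close> and
  \<open>\<theta>\<close>, except for pure rotations of the normal, which are integrated exactly.
\<close>

section \<open>One-dimensional Hausdorff measure\<close>

text \<open>Why \<open>sqrt t\<close>: where \<open>supp\<close> is largest, the farthest point of
  \<open>E\<close> forces a cosine below \<open>supp\<close>, so a drop by \<open>t / 2\<close>
  takes an angle of order \<open>sqrt (t / mrad)\<close>. A minimum has no such barrier, and
  \<open>supp\<close> may recover fast. But the slope of \<open>supp\<close> is the tangential
  coordinate of the contact point, so a rise by \<open>t / 2\<close> within that angle moves the
  contact point by a length of order \<open>mrad * sqrt (t / mrad)\<close>, with \<open>supp\<close>
  low all the way. This is why the identity must keep both measures.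

  The centroid serves as pole because passing to it subtracts \<open>perim * (norm c)^2\<close> from
  the momentum, and the disc around it is the competitor in the asymmetry. It can be a pole only if
  it lies in \<open>E\<close>, which takes its own argument.

  The obstacle in the sums is that the normal jumps at corners: the turn of a cell need not shrink
  with the partition. Admissible errors are therefore a small chord times a turn or times a length,
  since the turns add up to 2 pi and the lengths to about the perimeter.\<close>

lemma hausdorff1_pre_le:
  assumes "A \<subseteq> (\<Union>n. U n)" "\<And>n. bounded (U n)" "\<And>n. diameter (U n) \<le> \<delta>"
  shows "hausdorff1_pre \<delta> A \<le> (\<Sum>n. ennreal (diameter (U n)))"
  unfolding hausdorff1_pre_def using assms by (intro INF_lower) auto

lemma hausdorff1_pre_mono: "A \<subseteq> B \<Longrightarrow> hausdorff1_pre \<delta> A \<le> hausdorff1_pre \<delta> B"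
  unfolding hausdorff1_pre_def by (intro INF_superset_mono) auto

lemma hausdorff1_pre_antimono: "\<delta> \<le> \<delta>' \<Longrightarrow> hausdorff1_pre \<delta>' A \<le> hausdorff1_pre \<delta> A"
  unfolding hausdorff1_pre_def by (intro INF_superset_mono) (auto intro: order_trans)

lemma hausdorff1_pre_le_outer: "\<delta> > 0 \<Longrightarrow> hausdorff1_pre \<delta> A \<le> hausdorff1_outer A"
  unfolding hausdorff1_outer_def by (intro SUP_upper) auto

lemma hausdorff1_outer_leI:
  "(\<And>\<delta>. \<delta> > 0 \<Longrightarrow> hausdorff1_pre \<delta> A \<le> c) \<Longrightarrow> hausdorff1_outer A \<le> c"
  unfolding hausdorff1_outer_def by (intro SUP_least) auto

lemma hausdorff1_outer_mono: "A \<subseteq> B \<Longrightarrow> hausdorff1_outer A \<le> hausdorff1_outer B"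
  by (intro hausdorff1_outer_leI) (meson hausdorff1_pre_le_outer hausdorff1_pre_mono order_trans)

lemma hausdorff1_outer_empty [simp]: "hausdorff1_outer {} = 0"
proof -
  have "hausdorff1_outer ({}::'a set) \<le> 0"
  proof (rule hausdorff1_outer_leI)
    fix \<delta> :: real assume "\<delta> > 0"
    then show "hausdorff1_pre \<delta> ({}::'a set) \<le> 0"
      using hausdorff1_pre_le[of "{}" "\<lambda>_. {}" \<delta>] by simp
  qed
  then show ?thesis by simp
qed

lemma hausdorff1_pre_cover:
  assumes "hausdorff1_pre \<delta> A < c"
  obtains U where "A \<subseteq> (\<Union>n. U n)" "\<And>n. bounded (U n)" "\<And>n. diameter (U n) \<le> \<delta>"
    "(\<Sum>n. ennreal (diameter (U n))) < c"
proof -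
  obtain U where "A \<subseteq> (\<Union>n. U n) \<and> (\<forall>n. bounded (U n) \<and> diameter (U n) \<le> \<delta>)"
    "(\<Sum>n. ennreal (diameter (U n))) < c"
    using assms unfolding hausdorff1_pre_def INF_less_iff by auto
  then show thesis using that[of U] by blast
qed

lemma hausdorff1_pre_UN_le:
  fixes A :: "nat \<Rightarrow> 'a::metric_space set"
  shows "hausdorff1_pre \<delta> (\<Union>n. A n) \<le> (\<Sum>n. hausdorff1_pre \<delta> (A n))"
\<comment> \<open>Only a finite value leaves room for a cover whose sum stays strictly below value
  plus error, so infinite terms are set apart.\<close>
proof (cases "\<exists>n. hausdorff1_pre \<delta> (A n) = top")
  case True
  then obtain n where n: "hausdorff1_pre \<delta> (A n) = top" by blast
  have "hausdorff1_pre \<delta> (A n) \<le> (\<Sum>n. hausdorff1_pre \<delta> (A n))"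
    using sum_le_suminf[of "\<lambda>n. hausdorff1_pre \<delta> (A n)" "{n}"] by simp
  then show ?thesis using n by (metis top.extremum top.extremum_unique)
next
  case False
  show ?thesis
  proof (rule ennreal_le_epsilon)
    fix e :: real assume e: "0 < e"
    define c where "c n = hausdorff1_pre \<delta> (A n) + ennreal (e * (1/2) ^ Suc n)" for n
    have lt: "hausdorff1_pre \<delta> (A n) < c n" for n
    proof -
      have "0 < ennreal (e * (1/2) ^ Suc n)" using e by (intro ennreal_less_zero_iff[THEN iffD2]) simp
      then show ?thesis unfolding c_def using False
        by (metis ennreal_add_left_cancel_less add.right_neutral infinity_ennreal_def)
    qed
    have "\<exists>U. A n \<subseteq> (\<Union>m. U m) \<and> (\<forall>m. bounded (U m) \<and> diameter (U m) \<le> \<delta>) \<and>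
        (\<Sum>m. ennreal (diameter (U m))) < c n" for n
      using hausdorff1_pre_cover[OF lt[of n]] by metis
    then obtain U where U: "\<And>n. A n \<subseteq> (\<Union>m. U n m)" "\<And>n m. bounded (U n m)"
       "\<And>n m. diameter (U n m) \<le> \<delta>" "\<And>n. (\<Sum>m. ennreal (diameter (U n m))) < c n"
      by metis
    define V where "V k = (case prod_decode k of (n, m) \<Rightarrow> U n m)" for k
    have "(\<Union>n. A n) \<subseteq> (\<Union>k. V k)"
    proof
      fix x assume "x \<in> (\<Union>n. A n)"
      then obtain n m where "x \<in> U n m" using U(1) by blast
      then have "x \<in> V (prod_encode (n, m))" by (simp add: V_def)
      then show "x \<in> (\<Union>k. V k)" by blast
    qed
    then have "hausdorff1_pre \<delta> (\<Union>n. A n) \<le> (\<Sum>k. ennreal (diameter (V k)))"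
      by (rule hausdorff1_pre_le) (auto simp: V_def U split: prod.split)
    also have "\<dots> = (\<Sum>n. \<Sum>m. ennreal (diameter (U n m)))"
      using suminf_ennreal_2dimen[of "\<lambda>n. \<Sum>m. ennreal (diameter (U n m))" "\<lambda>(n,m). ennreal (diameter (U n m))"]
      by (simp add: V_def case_prod_unfold)
    also have "\<dots> \<le> (\<Sum>n. c n)"
      by (intro suminf_le) (auto intro: less_imp_le U)
    also have "\<dots> = (\<Sum>n. hausdorff1_pre \<delta> (A n)) + (\<Sum>n. ennreal (e * (1/2) ^ Suc n))"
      unfolding c_def by (intro suminf_add[symmetric]) auto
    also have "(\<Sum>n. ennreal (e * (1/2) ^ Suc n)) = ennreal e"
      using e sums_mult[OF power_half_series, of e] by (intro suminf_ennreal_eq) auto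
    finally show "hausdorff1_pre \<delta> (\<Union>n. A n) \<le> (\<Sum>n. hausdorff1_pre \<delta> (A n)) + ennreal e" .
  qed
qed

lemma hausdorff1_outer_UN_le:
  fixes A :: "nat \<Rightarrow> 'a::metric_space set"
  shows "hausdorff1_outer (\<Union>n. A n) \<le> (\<Sum>n. hausdorff1_outer (A n))"
proof (rule hausdorff1_outer_leI)
  fix \<delta> :: real assume "\<delta> > 0"
  then have "(\<Sum>n. hausdorff1_pre \<delta> (A n)) \<le> (\<Sum>n. hausdorff1_outer (A n))"
    by (intro suminf_le hausdorff1_pre_le_outer) auto
  then show "hausdorff1_pre \<delta> (\<Union>n. A n) \<le> (\<Sum>n. hausdorff1_outer (A n))"
    using hausdorff1_pre_UN_le order_trans by blast
qed

lemma hausdorff1_outer_Un_le: "hausdorff1_outer (A \<union> B) \<le> hausdorff1_outer A + hausdorff1_outer B"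
proof -
  have "hausdorff1_outer (A \<union> B) = hausdorff1_outer (\<Union>n. binaryset A B n)"
    by (simp add: UN_binaryset_eq)
  also have "\<dots> \<le> (\<Sum>n. hausdorff1_outer (binaryset A B n))" by (rule hausdorff1_outer_UN_le)
  also have "\<dots> = hausdorff1_outer A + hausdorff1_outer B"
    by (rule suminf_binaryset_eq) simp
  finally show ?thesis .
qed

section \<open>Additivity on separated sets\<close>

text \<open>A covering set of diameter at most \<delta> cannot meet both parts, so each cover of the
  union splits into two covers without loss.\<close>

lemma hausdorff1_pre_separated:
  assumes "\<And>x y. x \<in> A \<Longrightarrow> y \<in> B \<Longrightarrow> dist x y > \<delta>"
  shows "hausdorff1_pre \<delta> A + hausdorff1_pre \<delta> B \<le> hausdorff1_pre \<delta> (A \<union> B)"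
  unfolding hausdorff1_pre_def[of \<delta> "A \<union> B"]
proof (rule INF_greatest)
  fix U assume "U \<in> {U :: nat \<Rightarrow> 'a set. A \<union> B \<subseteq> (\<Union>n. U n) \<and> (\<forall>n. bounded (U n) \<and> diameter (U n) \<le> \<delta>)}"
  then have U: "A \<union> B \<subseteq> (\<Union>n. U n)" "\<And>n. bounded (U n)" "\<And>n. diameter (U n) \<le> \<delta>" by auto
  define V where "V S n = (if U n \<inter> S = {} then {} else U n)" for S n
  \<comment> \<open>Discarded sets are replaced by the empty set of diameter 0, which must still be
    admissible at scale \<delta>.\<close>
  have \<delta>: "0 \<le> \<delta>" using U(3)[of 0] diameter_ge_0[OF U(2)[of 0]] by linarith
  have *: "hausdorff1_pre \<delta> S \<le> (\<Sum>n. ennreal (diameter (V S n)))" if "S \<subseteq> A \<union> B" for S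
  proof (rule hausdorff1_pre_le)
    show "S \<subseteq> (\<Union>n. V S n)"
    proof
      fix x assume x: "x \<in> S"
      with that have "x \<in> (\<Union>n. U n)" using U(1) by blast
      then obtain n where "x \<in> U n" by blast
      then show "x \<in> (\<Union>n. V S n)" using x by (auto simp: V_def intro!: exI[of _ n])
    qed
  qed (auto simp: V_def U \<delta>)
  have disj: "U n \<inter> A = {} \<or> U n \<inter> B = {}" for n
  proof (rule ccontr)
    assume "\<not> ?thesis"
    then obtain x y where xy: "x \<in> U n" "x \<in> A" "y \<in> U n" "y \<in> B" by blast
    then have "dist x y \<le> diameter (U n)" by (intro diameter_bounded_bound U)
    then show False using assms[OF xy(2,4)] U(3)[of n] by linarith
  qed
  have "hausdorff1_pre \<delta> A + hausdorff1_pre \<delta> B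
      \<le> (\<Sum>n. ennreal (diameter (V A n))) + (\<Sum>n. ennreal (diameter (V B n)))"
    by (intro add_mono *) auto
  also have "\<dots> = (\<Sum>n. ennreal (diameter (V A n)) + ennreal (diameter (V B n)))"
    by (intro suminf_add) auto
  also have "\<dots> \<le> (\<Sum>n. ennreal (diameter (U n)))"
    using disj by (intro suminf_le) (auto simp: V_def)
  finally show "hausdorff1_pre \<delta> A + hausdorff1_pre \<delta> B \<le> (\<Sum>n. ennreal (diameter (U n)))" .
qed

lemma hausdorff1_outer_separated:
  assumes "\<delta> > 0" "\<And>x y. x \<in> A \<Longrightarrow> y \<in> B \<Longrightarrow> dist x y \<ge> \<delta>"
  shows "hausdorff1_outer (A \<union> B) = hausdorff1_outer A + hausdorff1_outer B"
proof (rule antisym[OF hausdorff1_outer_Un_le])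
  have *: "hausdorff1_pre d A + hausdorff1_pre d' B \<le> hausdorff1_outer (A \<union> B)"
    if "d > 0" "d' > 0" for d d'
  proof -
    \<comment> \<open>Half of \<delta>, because the statement at a fixed scale asks for strict
      separation.\<close>
    define m where "m = min (min d d') (\<delta>/2)"
    have m: "m > 0" "m \<le> d" "m \<le> d'" "m < \<delta>" using that assms(1) by (auto simp: m_def)
    have "hausdorff1_pre d A + hausdorff1_pre d' B \<le> hausdorff1_pre m A + hausdorff1_pre m B"
      by (intro add_mono hausdorff1_pre_antimono m)
    also have "\<dots> \<le> hausdorff1_pre m (A \<union> B)"
      using m(4) assms(2) by (intro hausdorff1_pre_separated) force
    also have "\<dots> \<le> hausdorff1_outer (A \<union> B)" by (intro hausdorff1_pre_le_outer m)
    finally show ?thesis .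
  qed
  have "hausdorff1_outer A + hausdorff1_outer B
     = (SUP d\<in>{0<..}. hausdorff1_pre d A + hausdorff1_outer B)"
    unfolding hausdorff1_outer_def[of A] by (subst ennreal_SUP_add_left) auto
  also have "\<dots> = (SUP d\<in>{0<..}. SUP d'\<in>{0<..}. hausdorff1_pre d A + hausdorff1_pre d' B)"
    unfolding hausdorff1_outer_def[of B] by (subst ennreal_SUP_add_right) auto
  also have "\<dots> \<le> hausdorff1_outer (A \<union> B)" by (intro SUP_least *) auto
  finally show "hausdorff1_outer A + hausdorff1_outer B \<le> hausdorff1_outer (A \<union> B)" .
qed

lemma hausdorff1_outer_separated_sum:
  fixes R :: "nat \<Rightarrow> 'a::metric_space set"
  assumes "\<And>i j. i < j \<Longrightarrow> \<exists>\<delta>>0. \<forall>x\<in>R i. \<forall>y\<in>R j. dist x y \<ge> \<delta>"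
  shows "hausdorff1_outer (\<Union>i<n. R i) = (\<Sum>i<n. hausdorff1_outer (R i))"
proof (induction n)
  case (Suc n)
  have "\<forall>i\<in>{..<n}. \<exists>\<delta>>0. \<forall>x\<in>R i. \<forall>y\<in>R n. dist x y \<ge> \<delta>" using assms by auto
  then obtain d where d: "\<And>i. i < n \<Longrightarrow> d i > 0 \<and> (\<forall>x\<in>R i. \<forall>y\<in>R n. dist x y \<ge> d i)"
    by (metis lessThan_iff)
  \<comment> \<open>The inserted 1 keeps the minimum defined when there are no earlier sets.\<close>
  define m where "m = Min (insert 1 (d ` {..<n}))"
  have "m > 0" using d by (auto simp: m_def)
  moreover have "dist x y \<ge> m" if xy: "x \<in> (\<Union>i<n. R i)" "y \<in> R n" for x y
  proof -
    obtain i where i: "i < n" "x \<in> R i" using xy by blast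
    have "m \<le> d i" unfolding m_def using i by (intro Min_le) auto
    then show ?thesis using d[OF i(1)] i xy by force
  qed
  ultimately have "hausdorff1_outer ((\<Union>i<n. R i) \<union> R n) = hausdorff1_outer (\<Union>i<n. R i) + hausdorff1_outer (R n)"
    by (rule hausdorff1_outer_separated)
  moreover have "(\<Union>i<Suc n. R i) = (\<Union>i<n. R i) \<union> R n" by (auto simp: less_Suc_eq)
  ultimately show ?case using Suc by simp
qed auto

text \<open>Caratheodory's criterion for a metric outer measure: the part of \<open>A\<close> outside the closed set
  \<open>F\<close> is exhausted by sets at positive distance from \<open>F\<close>, and alternate annuli
  around \<open>F\<close> are separated from each other.\<close>

lemma hausdorff1_outer_closed_split:
  fixes A F :: "'a::metric_space set"
  assumes F: "closed F"
  shows "hausdorff1_outer (A \<inter> F) + hausdorff1_outer (A - F) \<le> hausdorff1_outer A"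
proof (cases "F = {} \<or> hausdorff1_outer A = top")
  case True
  then show ?thesis by auto
next
  case False
  then have Fne: "F \<noteq> {}" and fin: "hausdorff1_outer A \<noteq> top" by auto
  let ?\<mu> = "hausdorff1_outer :: 'a set \<Rightarrow> ennreal"
  define B where "B n = {x\<in>A. infdist x F \<ge> 1 / real (Suc n)}" for n
  define R where "R n = {x\<in>A. 1 / real (Suc (Suc n)) \<le> infdist x F \<and> infdist x F < 1 / real (Suc n)}" for n
  have Rsep: "\<exists>\<delta>>0. \<forall>x\<in>R i. \<forall>y\<in>R j. dist x y \<ge> \<delta>" if "Suc i < j" for i j
  proof (intro exI conjI ballI)
    have le: "1 / real (Suc j) < 1 / real (Suc (Suc i))"
      using that by (intro divide_strict_left_mono) auto
    then show "0 < 1 / real (Suc (Suc i)) - 1 / real (Suc j)" by linarith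
    fix x y assume "x \<in> R i" "y \<in> R j"
    then have "infdist x F \<ge> 1 / real (Suc (Suc i))" "infdist y F < 1 / real (Suc j)"
      by (auto simp: R_def)
    moreover have "infdist x F \<le> infdist y F + dist x y" by (rule infdist_triangle)
    ultimately show "1 / real (Suc (Suc i)) - 1 / real (Suc j) \<le> dist x y" by linarith
  qed
  have RA: "R i \<subseteq> A" for i by (auto simp: R_def)
  have even: "(\<Sum>i. ?\<mu> (R (2*i))) \<le> ?\<mu> A"
  proof (rule suminf_le_const)
    fix n
    have "(\<Sum>i<n. ?\<mu> (R (2*i))) = ?\<mu> (\<Union>i<n. R (2*i))"
      by (rule hausdorff1_outer_separated_sum[symmetric], rule Rsep) auto
    also have "\<dots> \<le> ?\<mu> A" using RA by (intro hausdorff1_outer_mono) auto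
    finally show "(\<Sum>i<n. ?\<mu> (R (2*i))) \<le> ?\<mu> A" .
  qed auto
  have odd: "(\<Sum>i. ?\<mu> (R (2*i+1))) \<le> ?\<mu> A"
  proof (rule suminf_le_const)
    fix n
    have "(\<Sum>i<n. ?\<mu> (R (2*i+1))) = ?\<mu> (\<Union>i<n. R (2*i+1))"
      by (rule hausdorff1_outer_separated_sum[symmetric], rule Rsep) auto
    also have "\<dots> \<le> ?\<mu> A" using RA by (intro hausdorff1_outer_mono) auto
    finally show "(\<Sum>i<n. ?\<mu> (R (2*i+1))) \<le> ?\<mu> A" .
  qed auto
  have "(\<Sum>i. ?\<mu> (R i)) \<le> 2 * ?\<mu> A"
  proof (rule suminf_le_const)
    fix n
    have "(\<Sum>i<n. ?\<mu> (R i)) \<le> (\<Sum>i<n. ?\<mu> (R (2*i))) + (\<Sum>i<n. ?\<mu> (R (2*i+1)))"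
    proof -
      have "(\<Sum>i<n. ?\<mu> (R i)) \<le> (\<Sum>i<2*n. ?\<mu> (R i))" by (intro sum_mono2) auto
      also have "\<dots> = (\<Sum>i<n. ?\<mu> (R (2*i)) + ?\<mu> (R (2*i+1)))"
        by (induction n) (auto simp: algebra_simps)
      finally show ?thesis by (simp add: sum.distrib)
    qed
    also have "\<dots> \<le> (\<Sum>i. ?\<mu> (R (2*i))) + (\<Sum>i. ?\<mu> (R (2*i+1)))"
      by (intro add_mono sum_le_suminf) auto
    also have "\<dots> \<le> ?\<mu> A + ?\<mu> A" by (intro add_mono even odd)
    finally show "(\<Sum>i<n. ?\<mu> (R i)) \<le> 2 * ?\<mu> A" by (simp add: mult_2)
  qed auto
  moreover have "2 * ?\<mu> A < top" using fin by (auto simp: ennreal_mult_less_top top.not_eq_extremum)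
  ultimately have Rfin: "(\<Sum>i. ?\<mu> (R i)) \<noteq> top" by auto
  have cover: "A - F \<subseteq> B n \<union> (\<Union>i. R (i + n))" for n
  proof
    fix x assume x: "x \<in> A - F"
    then have pos: "infdist x F > 0"
      using F Fne by (metis DiffD2 in_closed_iff_infdist_zero infdist_nonneg order_le_less)
    show "x \<in> B n \<union> (\<Union>i. R (i + n))"
    proof (cases "x \<in> B n")
      case False
      then have lt: "infdist x F < 1 / real (Suc n)" using x by (auto simp: B_def)
      obtain k where k: "1 / real (Suc k) < infdist x F" using nat_approx_posE[OF pos] by metis
      \<comment> \<open>The least index whose threshold lies below the distance places
        \<open>x\<close> in the annulus just before it; \<open>n < k0\<close> makes that index at
        least \<open>n\<close>.\<close>
      define k0 where "k0 = (LEAST k. 1 / real (Suc k) \<le> infdist x F)"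
      have k0: "1 / real (Suc k0) \<le> infdist x F"
        unfolding k0_def by (rule LeastI[of _ k]) (use k in auto)
      have "n < k0"
      proof (rule ccontr)
        assume "\<not> n < k0"
        then have "1 / real (Suc n) \<le> 1 / real (Suc k0)" by (intro divide_left_mono) auto
        then show False using k0 lt by linarith
      qed
      then obtain l where l: "k0 = Suc l" "n \<le> l" by (cases k0) auto
      have "\<not> 1 / real (Suc l) \<le> infdist x F"
        using not_less_Least[of l "\<lambda>k. 1 / real (Suc k) \<le> infdist x F"] l(1) unfolding k0_def by simp
      then have "x \<in> R (l - n + n)" using k0 l x by (auto simp: R_def)
      then show ?thesis by blast
    qed auto
  qed
  \<comment> \<open>These tails bound what \<open>B n\<close> misses of \<open>A - F\<close>. The
    total is finite, so the claim reduces to tails of a convergent real series.\<close>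
  have tail: "(\<lambda>n. \<Sum>i. ?\<mu> (R (i + n))) \<longlonglongrightarrow> 0"
  proof -
    define f where "f i = enn2real (?\<mu> (R i))" for i
    have fi: "?\<mu> (R i) = ennreal (f i)" for i
    proof -
      have "?\<mu> (R i) \<le> ?\<mu> A" by (intro hausdorff1_outer_mono RA)
      then show ?thesis using fin unfolding f_def
        by (metis ennreal_enn2real_if top.extremum_unique)
    qed
    have sf: "summable f"
      using Rfin unfolding fi by (rule summable_suminf_not_top[rotated]) (auto simp: f_def)
    have "(\<lambda>n. suminf f - sum f {..<n}) \<longlonglongrightarrow> suminf f - suminf f"
      by (intro tendsto_diff tendsto_const summable_LIMSEQ sf)
    then have "(\<lambda>n. \<Sum>i. f (i + n)) \<longlonglongrightarrow> 0"
      using suminf_minus_initial_segment[OF sf] by simp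
    then have "(\<lambda>n. ennreal (\<Sum>i. f (i + n))) \<longlonglongrightarrow> ennreal 0" by (rule tendsto_ennrealI)
    moreover have "(\<Sum>i. ?\<mu> (R (i + n))) = ennreal (\<Sum>i. f (i + n))" for n
      unfolding fi using summable_ignore_initial_segment[OF sf, of n]
      by (intro suminf_ennreal2) (auto simp: f_def)
    ultimately show ?thesis by simp
  qed
  have Bsep: "?\<mu> (A \<inter> F) + ?\<mu> (B n) \<le> ?\<mu> A" for n
  proof -
    have "?\<mu> (A \<inter> F \<union> B n) = ?\<mu> (A \<inter> F) + ?\<mu> (B n)"
    proof (rule hausdorff1_outer_separated)
      show "0 < 1 / real (Suc n)" by simp
      fix x y assume "x \<in> A \<inter> F" "y \<in> B n"
      then show "1 / real (Suc n) \<le> dist x y"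
        using infdist_le[of x F y] by (auto simp: B_def dist_commute)
    qed
    then show ?thesis
      by (metis (no_types, lifting) B_def Int_lower1 Un_least hausdorff1_outer_mono mem_Collect_eq subsetI)
  qed
  have "?\<mu> (A \<inter> F) + ?\<mu> (A - F) \<le> ?\<mu> A + (\<Sum>i. ?\<mu> (R (i + n)))" for n
  proof -
    have "?\<mu> (A - F) \<le> ?\<mu> (B n) + ?\<mu> (\<Union>i. R (i + n))"
      using hausdorff1_outer_mono[OF cover[of n]] hausdorff1_outer_Un_le order_trans by blast
    also have "\<dots> \<le> ?\<mu> (B n) + (\<Sum>i. ?\<mu> (R (i + n)))"
      by (intro add_left_mono hausdorff1_outer_UN_le)
    finally have "?\<mu> (A \<inter> F) + ?\<mu> (A - F) \<le> ?\<mu> (A \<inter> F) + (?\<mu> (B n) + (\<Sum>i. ?\<mu> (R (i + n))))"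
      by (rule add_left_mono)
    also have "\<dots> = (?\<mu> (A \<inter> F) + ?\<mu> (B n)) + (\<Sum>i. ?\<mu> (R (i + n)))" by (simp add: add.assoc)
    also have "\<dots> \<le> ?\<mu> A + (\<Sum>i. ?\<mu> (R (i + n)))" by (intro add_right_mono Bsep)
    finally show ?thesis .
  qed
  moreover have "(\<lambda>n. ?\<mu> A + (\<Sum>i. ?\<mu> (R (i + n)))) \<longlonglongrightarrow> ?\<mu> A + 0"
    by (intro tendsto_add tail tendsto_const)
  ultimately show ?thesis using LIMSEQ_le_const by fastforce
qed

text \<open>\<open>measure_of\<close> returns the given set function only where it is countably
  additive. The Caratheodory-measurable sets contain the closed sets by the splitting above, hence
  all Borel sets.\<close>

lemma emeasure_hausdorff1:
  assumes "A \<in> sets borel"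
  shows "emeasure hausdorff1 A = hausdorff1_outer (A :: 'a::metric_space set)"
proof -
  let ?\<mu> = "hausdorff1_outer :: 'a set \<Rightarrow> ennreal"
  define L where "L = lambda_system UNIV (Pow UNIV) ?\<mu>"
  have oms: "outer_measure_space (Pow UNIV) ?\<mu>"
    unfolding outer_measure_space_def
  proof (intro conjI)
    show "positive (Pow UNIV) ?\<mu>" by (simp add: positive_def)
    show "increasing (Pow UNIV) ?\<mu>" by (simp add: increasing_def hausdorff1_outer_mono)
    show "countably_subadditive (Pow UNIV) ?\<mu>"
      by (simp add: countably_subadditive_def hausdorff1_outer_UN_le)
  qed
  have ms: "measure_space UNIV L ?\<mu>"
    unfolding L_def using sigma_algebra.caratheodory_lemma[OF sigma_algebra_Pow oms] by simp
  then have sa: "sigma_algebra UNIV L" and ca: "countably_additive L ?\<mu>"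
    by (auto simp: measure_space_def)
  have closed: "F \<in> L" if "closed F" for F :: "'a set"
  proof -
    have "?\<mu> (X \<inter> F) + ?\<mu> (X - F) = ?\<mu> X" for X
    proof (rule antisym)
      show "?\<mu> X \<le> ?\<mu> (X \<inter> F) + ?\<mu> (X - F)"
        using hausdorff1_outer_Un_le[of "X \<inter> F" "X - F"] by (simp add: Int_Diff_Un)
    qed (rule hausdorff1_outer_closed_split[OF that])
    moreover have "algebra UNIV (Pow (UNIV :: 'a set))" by (rule algebra_Pow)
    ultimately show ?thesis unfolding L_def by (subst algebra.lambda_system_eq) auto
  qed
  have sub: "sets borel \<subseteq> L"
  proof -
    have "sets borel = sigma_sets (UNIV::'a set) (Collect closed)"
      by (simp add: borel_eq_closed)
    also have "\<dots> \<subseteq> L"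
      using closed sigma_algebra.sigma_sets_subset[OF sa, of "Collect closed"] by auto
    finally show ?thesis .
  qed
  have "countably_additive (sets borel) ?\<mu>"
    using ca sub unfolding countably_additive_def by (metis (no_types) order_trans subsetD)
  then show ?thesis unfolding hausdorff1_def
    using assms sets.sigma_algebra_axioms[of "borel :: 'a measure"]
    by (intro emeasure_measure_of_sigma) (auto simp: positive_def)
qed

lemma sets_hausdorff1 [simp, measurable_cong]: "sets hausdorff1 = sets borel"
  unfolding hausdorff1_def using sets.sigma_sets_eq[of "borel :: 'a measure"] by simp

lemma space_hausdorff1 [simp]: "space hausdorff1 = UNIV"
  unfolding hausdorff1_def by simp

text \<open>The distance from \<open>a\<close> maps \<open>S\<close> onto a set containing an interval, without increasing
  diameters.\<close>

lemma hausdorff1_outer_connected_ge: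
  fixes S :: "'a::metric_space set"
  assumes "connected S" "a \<in> S" "b \<in> S"
  shows "ennreal (dist a b) \<le> hausdorff1_outer S"
proof -
  \<comment> \<open>The scale 1 is arbitrary: the bound holds for all covers, and each scale bounds
    the outer measure from below.\<close>
  have "ennreal (dist a b) \<le> hausdorff1_pre 1 S"
    unfolding hausdorff1_pre_def
  proof (rule INF_greatest)
    fix U assume "U \<in> {U. S \<subseteq> (\<Union>n::nat. U n) \<and> (\<forall>n. bounded (U n) \<and> diameter (U n) \<le> 1)}"
    then have U: "S \<subseteq> (\<Union>n. U n)" "\<And>n. bounded (U n)" by auto
    define f where "f = dist a"
    have fl: "\<bar>f x - f y\<bar> \<le> dist x y" for x y
      unfolding f_def using abs_dist_diff_le[of x a y] by (simp add: dist_commute)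
    have "connected (f ` S)" unfolding f_def
      by (intro connected_continuous_image continuous_intros assms)
    then have "{f a..f b} \<subseteq> f ` S" using assms by (intro connected_contains_Icc) auto
    then have sub: "{0..dist a b} \<subseteq> f ` S" by (simp add: f_def)
    define I where "I n = (if U n = {} then {} else {Inf (f ` U n)..Inf (f ` U n) + diameter (U n)})" for n
    have fU: "f ` U n \<subseteq> I n" for n
    proof
      fix y assume "y \<in> f ` U n"
      then obtain x where x: "x \<in> U n" "y = f x" by blast
      have d: "\<bar>f x - f z\<bar> \<le> diameter (U n)" if "z \<in> U n" for z
        using fl[of x z] diameter_bounded_bound[OF U(2)[of n] x(1) that] by linarith
      have bd: "bdd_below (f ` U n)" by (intro bdd_belowI[of _ 0]) (auto simp: f_def)
      have "Inf (f ` U n) \<le> f x" using x bd by (intro cInf_lower) auto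
      moreover have "f x - diameter (U n) \<le> Inf (f ` U n)"
        using x d by (intro cInf_greatest) (force simp: abs_le_iff)+
      ultimately show "y \<in> I n" using x by (auto simp: I_def)
    qed
    have "ennreal (dist a b) = emeasure lborel {0..dist a b}" by simp
    also have "\<dots> \<le> emeasure lborel (\<Union>n. I n)"
    proof (rule emeasure_mono)
      have "f ` S \<subseteq> (\<Union>n. f ` U n)" using U(1) by blast
      also have "\<dots> \<subseteq> (\<Union>n. I n)" using fU by (intro UN_mono) auto
      finally show "{0..dist a b} \<subseteq> (\<Union>n. I n)" using sub by (rule order_trans[rotated])
      show "(\<Union>n. I n) \<in> sets lborel" by (intro sets.countable_UN) (auto simp: I_def)
    qed
    also have "\<dots> \<le> (\<Sum>n. emeasure lborel (I n))"
      by (intro emeasure_subadditive_countably) (auto simp: I_def)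
    also have "\<dots> \<le> (\<Sum>n. ennreal (diameter (U n)))"
      using U(2) by (intro suminf_le) (auto simp: I_def diameter_ge_0)
    finally show "ennreal (dist a b) \<le> (\<Sum>n. ennreal (diameter (U n)))" .
  qed
  then show ?thesis using hausdorff1_pre_le_outer[of 1 S] by (simp add: order_trans)
qed

text \<open>One \<epsilon> bounds both the diameters and the surplus of their sum; the finite cover
  is padded with empty sets to a sequence.\<close>

lemma hausdorff1_outer_finite_cover_le:
  fixes S :: "'a::metric_space set"
  assumes "\<And>\<epsilon>. \<epsilon> > 0 \<Longrightarrow> \<exists>U (n::nat). S \<subseteq> (\<Union>i<n. U i) \<and> (\<forall>i<n. bounded (U i) \<and> diameter (U i) \<le> \<epsilon>)
     \<and> (\<Sum>i<n. diameter (U i)) \<le> L + \<epsilon>"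
  shows "hausdorff1_outer S \<le> ennreal L"
proof (rule hausdorff1_outer_leI)
  fix \<delta> :: real assume \<delta>: "\<delta> > 0"
  show "hausdorff1_pre \<delta> S \<le> ennreal L"
  proof (rule ennreal_le_epsilon)
    fix e :: real assume e: "e > 0"
    define \<epsilon> where "\<epsilon> = min \<delta> e"
    have \<epsilon>: "\<epsilon> > 0" "\<epsilon> \<le> \<delta>" "\<epsilon> \<le> e" using \<delta> e by (auto simp: \<epsilon>_def)
    obtain U and n :: nat where "S \<subseteq> (\<Union>i<n. U i) \<and> (\<forall>i<n. bounded (U i) \<and> diameter (U i) \<le> \<epsilon>)
       \<and> (\<Sum>i<n. diameter (U i)) \<le> L + \<epsilon>"
      using assms[OF \<epsilon>(1)] by (elim exE)
    then have U: "S \<subseteq> (\<Union>i<n. U i)" "\<And>i. i < n \<Longrightarrow> bounded (U i)"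
       "\<And>i. i < n \<Longrightarrow> diameter (U i) \<le> \<epsilon>" "(\<Sum>i<n. diameter (U i)) \<le> L + \<epsilon>"
      by blast+
    define V where "V i = (if i < n then U i else {})" for i :: nat
    have "hausdorff1_pre \<delta> S \<le> (\<Sum>i. ennreal (diameter (V i)))"
    proof (rule hausdorff1_pre_le)
      show "S \<subseteq> (\<Union>i. V i)" using U(1) by (fastforce simp: V_def)
    qed (use U(2) order_trans[OF U(3) \<epsilon>(2)] \<delta> in \<open>auto simp: V_def\<close>)
    also have "\<dots> = (\<Sum>i<n. ennreal (diameter (V i)))"
      by (intro suminf_finite) (auto simp: V_def)
    also have "\<dots> = ennreal (\<Sum>i<n. diameter (U i))"
      using U(2) by (subst sum_ennreal[symmetric]) (auto simp: V_def diameter_ge_0)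
    also have "\<dots> \<le> ennreal (L + e)" using U(4) \<epsilon> by (intro ennreal_leI) auto
    \<comment> \<open>For negative \<open>L\<close> the term \<open>ennreal L\<close> is 0, and
      monotonicity suffices.\<close>
    also have "\<dots> \<le> ennreal L + ennreal e"
      using e by (cases "L \<ge> 0") (auto simp: ennreal_plus ennreal_neg intro: ennreal_leI)
    finally show "hausdorff1_pre \<delta> S \<le> ennreal L + ennreal e" .
  qed
qed

section \<open>Polar and support descriptions of a planar convex domain\<close>

definition dir :: "real \<Rightarrow> real^2" where
  "dir t = vector [cos t, sin t]"

lemma inner_real2: "(x::real^2) \<bullet> y = x$1 * y$1 + x$2 * y$2"
  by (simp add: inner_vec_def sum_2)

lemma dir_nth [simp]: "dir t $ 1 = cos t" "dir t $ 2 = sin t"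
  by (simp_all add: dir_def)

lemma inner_dir_dir: "dir a \<bullet> dir b = cos (a - b)"
  by (simp add: inner_real2 cos_diff)

lemma norm_dir [simp]: "norm (dir t) = 1"
  by (simp add: norm_eq_sqrt_inner inner_dir_dir)

lemma dir_nonzero [simp]: "dir t \<noteq> 0"
  using norm_dir[of t] by (metis norm_zero zero_neq_one)

lemma dir_add_2pi [simp]: "dir (t + 2 * pi) = dir t" "dir (2 * pi + t) = dir t"
  by (simp_all add: dir_def add.commute)

lemma dir_add_pi: "dir (t + pi) = - dir t"
  by (simp add: vec_eq_iff forall_2)

lemma dir_add: "dir (a + b) = cos b *\<^sub>R dir a + sin b *\<^sub>R dir (a + pi/2)"
  by (simp add: vec_eq_iff forall_2 cos_add sin_add)

lemma continuous_dir [continuous_intros]: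
  fixes f :: "'a::t2_space \<Rightarrow> real"
  assumes f: "continuous_on S f" shows "continuous_on S (\<lambda>x. dir (f x))"
proof -
  have "dir = (\<lambda>t. cos t *\<^sub>R axis 1 1 + sin t *\<^sub>R axis 2 1)"
    by (auto simp: fun_eq_iff vec_eq_iff forall_2 axis_def)
  then have eq: "(\<lambda>x. dir (f x)) = (\<lambda>x. cos (f x) *\<^sub>R axis 1 1 + sin (f x) *\<^sub>R axis 2 1)" by metis
  show ?thesis unfolding eq by (intro continuous_intros continuous_on_cos continuous_on_sin f)
qed

lemma dir_decomp: "(v::real^2) = (v \<bullet> dir s) *\<^sub>R dir s + (v \<bullet> dir (s + pi/2)) *\<^sub>R dir (s + pi/2)"
proof -
  have "cos s * (cos s * x) + sin s * (sin s * x) = (sin s * sin s + cos s * cos s) * x" for x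
    by (simp only: distrib_right mult.assoc add.commute)
  then have *: "cos s * (cos s * x) + sin s * (sin s * x) = x" for x
    using sin_cos_squared_add[of s, unfolded power2_eq_square] by simp
  show ?thesis using *[of "v$1"] *[of "v$2"]
    by (simp add: vec_eq_iff forall_2 inner_real2 cos_add sin_add algebra_simps)
qed

lemma norm_dir_decomp: "(norm (v::real^2))\<^sup>2 = (v \<bullet> dir s)\<^sup>2 + (v \<bullet> dir (s + pi/2))\<^sup>2"
proof -
  have "(norm v)\<^sup>2 = v \<bullet> ((v \<bullet> dir s) *\<^sub>R dir s + (v \<bullet> dir (s + pi/2)) *\<^sub>R dir (s + pi/2))"
    using dir_decomp[of v s] by (simp add: power2_norm_eq_inner)
  then show ?thesis by (simp add: inner_right_distrib power2_eq_square)
qed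

lemma inner_dir_le_norm: "\<bar>v \<bullet> dir s\<bar> \<le> norm v"
  using Cauchy_Schwarz_ineq2[of v "dir s"] by simp

text \<open>The window of angles starts at a free \<open>a\<close>, since partitions of the boundary
  will begin at whichever angle is convenient.\<close>

lemma dir_polar:
  obtains t where "a \<le> t" "t < a + 2*pi" "(v::real^2) = norm v *\<^sub>R dir t"
proof (cases "v = 0")
  case True then show ?thesis using that[of a] by simp
next
  case False
  have "(v \<bullet> dir a / norm v)\<^sup>2 + (v \<bullet> dir (a + pi/2) / norm v)\<^sup>2 = 1"
    using False by (simp add: power_divide flip: add_divide_distrib norm_dir_decomp)
  then obtain t where t: "0 \<le> t" "t < 2*pi" "v \<bullet> dir a / norm v = cos t" "v \<bullet> dir (a + pi/2) / norm v = sin t"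
    by (rule sincos_total_2pi)
  have "norm v *\<^sub>R dir (a + t) = (norm v * cos t) *\<^sub>R dir a + (norm v * sin t) *\<^sub>R dir (a + pi/2)"
    by (simp add: dir_add[of a t] scaleR_add_right)
  also have "\<dots> = v"
    using False dir_decomp[of v a] by (simp flip: t(3,4))
  finally show ?thesis using that[of "a + t"] t by auto
qed

lemma dir_inj:
  assumes "dir a = dir b" "\<bar>a - b\<bar> < 2*pi" shows "a = b"
proof -
  have "cos (a - b) = 1" using assms(1) inner_dir_dir[of a b] inner_dir_dir[of b b] by simp
  then obtain n::int where n: "a - b = n * 2 * pi" unfolding cos_one_2pi_int by auto
  then have "\<bar>real_of_int n\<bar> * (2*pi) < 1 * (2*pi)" using assms(2) by (simp add: abs_mult)
  then have "\<bar>real_of_int n\<bar> < 1" by (subst (asm) mult_less_cancel_right) auto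
  then have "n = 0" by linarith
  then show ?thesis using n by simp
qed

lemma has_derivative_inner_dir:
  "((\<lambda>s. v \<bullet> dir s) has_real_derivative v \<bullet> dir (s + pi/2)) (at s within A)"
proof -
  have "((\<lambda>s. v $ 1 * cos s + v $ 2 * sin s) has_real_derivative v $ 1 * (- sin s) + v $ 2 * cos s) (at s within A)"
    by (auto intro!: derivative_eq_intros)
  then show ?thesis by (simp add: inner_real2 cos_add sin_add)
qed

lemma dist_dir_le: "norm (dir a - dir b) \<le> \<bar>a - b\<bar>"
proof -
  define d where "d = (a - b) / 2"
  have ab: "a - b = 2 * d" by (simp add: d_def)
  have "(norm (dir a - dir b))\<^sup>2 = 2 - 2 * cos (a - b)"
    by (simp add: power2_norm_eq_inner inner_diff inner_dir_dir cos_diff algebra_simps)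
  also have "\<dots> = (2 * sin d)\<^sup>2"
    unfolding ab cos_double_sin by (simp add: power_mult_distrib)
  also have "\<dots> \<le> (a - b)\<^sup>2"
    unfolding ab using abs_sin_x_le_abs_x[of d] by (intro abs_le_square_iff[THEN iffD1]) (auto simp: abs_mult)
  finally show ?thesis using abs_le_square_iff[of "norm (dir a - dir b)" "a - b"] by simp
qed

text \<open>The pole \<open>c\<close> is a parameter because the same set is described from two of
  them: from an arbitrary point to find the boundary centroid, and then from the centroid.\<close>

locale convex_domain =
  fixes E :: "(real^2) set" and c :: "real^2"
  assumes openE: "open E" and convexE: "convex E" and boundedE: "bounded E" and cE: "c \<in> E"
begin

section \<open>The boundary in polar coordinates\<close>

definition radial :: "real \<Rightarrow> real" where
  "radial \<phi> = (SOME d. 0 < d \<and> c + d *\<^sub>R dir \<phi> \<in> frontier E)"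

definition bdry :: "real \<Rightarrow> real^2" where
  "bdry \<phi> = c + radial \<phi> *\<^sub>R dir \<phi>"

lemma intE: "interior E = E" using openE by (rule interior_open)

lemma radial_frontier: "0 < radial \<phi>" "bdry \<phi> \<in> frontier E"
proof -
  obtain d where "0 < d" "c + d *\<^sub>R dir \<phi> \<in> frontier E"
    using ray_to_frontier[OF boundedE, of c "dir \<phi>"] cE intE by (metis dir_nonzero)
  then have "\<exists>d. 0 < d \<and> c + d *\<^sub>R dir \<phi> \<in> frontier E" by blast
  from someI_ex[OF this] show "0 < radial \<phi>" "bdry \<phi> \<in> frontier E"
    by (auto simp: radial_def bdry_def)
qed

lemma bdry_closure: "bdry \<phi> \<in> closure E"
  using radial_frontier(2) by (simp add: frontier_def)

lemma segment_in_E: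
  assumes "y \<in> closure E" "0 \<le> s" "s < 1" shows "c + s *\<^sub>R (y - c) \<in> E"
proof -
  have "y - (1 - s) *\<^sub>R (y - c) \<in> interior E"
    using mem_interior_closure_convex_shrink[OF convexE _ assms(1), of c "1 - s"] assms cE intE by auto
  then show ?thesis unfolding intE by (simp add: algebra_simps)
qed

lemma radial_mem:
  assumes "0 \<le> \<rho>" "\<rho> < radial \<phi>" shows "c + \<rho> *\<^sub>R dir \<phi> \<in> E"
proof -
  have "c + (\<rho> / radial \<phi>) *\<^sub>R (bdry \<phi> - c) \<in> E"
    using assms radial_frontier(1)[of \<phi>] by (intro segment_in_E bdry_closure) auto
  then show ?thesis using radial_frontier(1)[of \<phi>] by (simp add: bdry_def)
qed

lemma radial_ge:
  assumes "c + \<rho> *\<^sub>R dir \<phi> \<in> closure E" shows "\<rho> \<le> radial \<phi>"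
proof (rule ccontr)
  assume "\<not> \<rho> \<le> radial \<phi>"
  then have lt: "radial \<phi> < \<rho>" by simp
  have "c + (radial \<phi> / \<rho>) *\<^sub>R (c + \<rho> *\<^sub>R dir \<phi> - c) \<in> E"
    using lt radial_frontier(1)[of \<phi>] by (intro segment_in_E assms) auto
  then have "bdry \<phi> \<in> E" using lt radial_frontier(1)[of \<phi>] by (simp add: bdry_def)
  then show False using radial_frontier(2)[of \<phi>] intE by (simp add: frontier_def)
qed

lemma radial_unique:
  assumes "0 \<le> \<rho>" "c + \<rho> *\<^sub>R dir \<phi> \<in> frontier E" shows "\<rho> = radial \<phi>"
proof (rule antisym)
  show "\<rho> \<le> radial \<phi>" using assms by (intro radial_ge) (simp add: frontier_def)
  show "radial \<phi> \<le> \<rho>"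
    using radial_mem[OF assms(1), of \<phi>] assms(2) intE by (force simp: frontier_def)
qed

lemma radial_periodic [simp]: "radial (\<phi> + 2*pi) = radial \<phi>" "bdry (\<phi> + 2*pi) = bdry \<phi>"
  by (simp_all add: radial_def bdry_def)

lemma polar_closure:
  assumes "y \<in> closure E"
  obtains \<phi> \<rho> where "a \<le> \<phi>" "\<phi> < a + 2*pi" "0 \<le> \<rho>" "\<rho> \<le> radial \<phi>" "y = c + \<rho> *\<^sub>R dir \<phi>"
proof -
  obtain \<phi> where p: "a \<le> \<phi>" "\<phi> < a + 2*pi" "y - c = norm (y - c) *\<^sub>R dir \<phi>" using dir_polar[of a "y - c"] by blast
  then have y: "y = c + norm (y - c) *\<^sub>R dir \<phi>" by (simp add: algebra_simps)
  then have "norm (y - c) \<le> radial \<phi>" using assms radial_ge[of "norm (y - c)" \<phi>] by simp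
  then show ?thesis using that[of \<phi> "norm (y - c)"] p(1,2) y by simp
qed

lemma frontier_bdry:
  assumes "y \<in> frontier E"
  obtains \<phi> where "a \<le> \<phi>" "\<phi> < a + 2*pi" "y = bdry \<phi>"
proof -
  have "y \<in> closure E" using assms by (simp add: frontier_def)
  then obtain \<phi> \<rho> where p: "a \<le> \<phi>" "\<phi> < a + 2*pi" "0 \<le> \<rho>" "y = c + \<rho> *\<^sub>R dir \<phi>"
    using polar_closure[of y a] by blast
  then have "\<rho> = radial \<phi>" using assms by (intro radial_unique) auto
  then show ?thesis using that p by (auto simp: bdry_def)
qed

lemma frontier_eq: "frontier E = bdry ` {a..<a + 2*pi}"
proof
  show "frontier E \<subseteq> bdry ` {a..<a + 2*pi}"
  proof
    fix y assume "y \<in> frontier E"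
    then obtain \<phi> where "a \<le> \<phi>" "\<phi> < a + 2*pi" "y = bdry \<phi>" by (rule frontier_bdry)
    then show "y \<in> bdry ` {a..<a + 2*pi}" by auto
  qed
qed (use radial_frontier(2) in auto)

lemma bdry_inj:
  assumes "bdry a = bdry b" "\<bar>a - b\<bar> < 2*pi" shows "a = b"
proof -
  have "radial a *\<^sub>R dir a = radial b *\<^sub>R dir b" using assms(1) by (simp add: bdry_def)
  moreover have "norm (radial a *\<^sub>R dir a) = radial a" "norm (radial b *\<^sub>R dir b) = radial b"
    using radial_frontier(1) by (simp_all add: order_less_imp_le)
  ultimately have "dir a = dir b" using radial_frontier(1)[of a]
    by (metis order_less_irrefl real_vector.scale_cancel_left)
  then show ?thesis using assms(2) by (rule dir_inj)
qed

text \<open>A crude bound: it enters continuity arguments and errors that vanish in the limit, never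
  a final constant.\<close>

definition Rmax :: real where "Rmax = (SOME R. R > 0 \<and> closure E \<subseteq> cball c R)"

lemma Rmax: "Rmax > 0" "closure E \<subseteq> cball c Rmax"
proof -
  obtain R where R: "R > 0" "closure E \<subseteq> cball c R"
    using bounded_subset_ballD[OF bounded_closure[OF boundedE], of c] ball_subset_cball by (metis subset_trans)
  then have "\<exists>R. R > 0 \<and> closure E \<subseteq> cball c R" by blast
  from someI_ex[OF this] show "Rmax > 0" "closure E \<subseteq> cball c Rmax" by (auto simp: Rmax_def)
qed

lemma norm_le_Rmax: "y \<in> closure E \<Longrightarrow> norm (y - c) \<le> Rmax"
  using Rmax(2) by (auto simp: dist_norm norm_minus_commute)

lemma radial_le_Rmax: "radial \<phi> \<le> Rmax"
  using norm_le_Rmax[OF bdry_closure[of \<phi>]] radial_frontier(1)[of \<phi>] by (simp add: bdry_def)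

text \<open>Closed graph: by uniqueness of the boundary point on a ray, the graph is the preimage of
  the closed frontier under the polar map, cut to nonnegative radii, and the values stay in a
  compact interval.\<close>

lemma continuous_radial: "continuous_on UNIV radial"
proof (rule continuous_from_closed_graph[of "{0..Rmax}"])
  show "radial \<in> UNIV \<rightarrow> {0..Rmax}"
    using radial_le_Rmax radial_frontier(1) by (auto simp: less_imp_le)
  have "(\<lambda>x. (x, radial x)) ` UNIV = (\<lambda>p. c + snd p *\<^sub>R dir (fst p)) -` frontier E \<inter> snd -` {0..}"
  proof (intro set_eqI iffI)
    fix p :: "real \<times> real" assume "p \<in> (\<lambda>p. c + snd p *\<^sub>R dir (fst p)) -` frontier E \<inter> snd -` {0..}"
    then have "snd p = radial (fst p)" by (intro radial_unique) auto
    then have "p = (fst p, radial (fst p))" by (metis prod.collapse)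
    then show "p \<in> (\<lambda>x. (x, radial x)) ` UNIV" by blast
  qed (use radial_frontier in \<open>auto simp: bdry_def less_imp_le\<close>)
  moreover have "closed ((\<lambda>p::real\<times>real. c + snd p *\<^sub>R dir (fst p)) -` frontier E \<inter> snd -` {0..})"
    by (intro closed_Int closed_vimage continuous_intros frontier_closed)
  ultimately show "closed ((\<lambda>x. (x, radial x)) ` UNIV)" by simp
qed simp

lemma continuous_bdry: "continuous_on S bdry"
  unfolding bdry_def
  by (intro continuous_intros continuous_on_subset[OF continuous_radial]) auto

section \<open>Support function and outer normals\<close>

definition supp :: "real \<Rightarrow> real" where
  "supp \<theta> = (SUP y\<in>closure E. (y - c) \<bullet> dir \<theta>)"

text \<open>\<theta> is the angle of an outer normal at \<open>bdry \<phi>\<close>: the supporting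
  line in direction \<theta> touches there. The first conjunct fixes the angle among its translates
  by 2 pi; a normal always makes an acute angle with the ray because \<open>c\<close> is
  interior.\<close>

definition normal :: "real \<Rightarrow> real \<Rightarrow> bool" where
  "normal \<phi> \<theta> \<longleftrightarrow> \<bar>\<theta> - \<phi>\<bar> < pi/2 \<and> supp \<theta> = radial \<phi> * cos (\<phi> - \<theta>)"

lemma compactE: "compact (closure E)"
  using boundedE by (simp add: compact_closure)

lemma supp_ge: "y \<in> closure E \<Longrightarrow> (y - c) \<bullet> dir \<theta> \<le> supp \<theta>"
  unfolding supp_def
proof (intro cSUP_upper bdd_aboveI2[of _ _ Rmax])
  fix y assume "y \<in> closure E"
  then show "(y - c) \<bullet> dir \<theta> \<le> Rmax"
    using inner_dir_le_norm[of "y - c" \<theta>] norm_le_Rmax[of y] by linarith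
qed

lemma supp_le:
  assumes "\<And>y. y \<in> closure E \<Longrightarrow> (y - c) \<bullet> dir \<theta> \<le> k" shows "supp \<theta> \<le> k"
  unfolding supp_def using assms cE closure_subset by (intro cSUP_least) auto

lemma supp_attained: obtains y where "y \<in> closure E" "(y - c) \<bullet> dir \<theta> = supp \<theta>"
proof -
  have "\<exists>y\<in>closure E. \<forall>z\<in>closure E. (z - c) \<bullet> dir \<theta> \<le> (y - c) \<bullet> dir \<theta>"
    using cE closure_subset by (intro continuous_attains_sup compactE continuous_intros) auto
  then obtain y where "y \<in> closure E" "\<And>z. z \<in> closure E \<Longrightarrow> (z - c) \<bullet> dir \<theta> \<le> (y - c) \<bullet> dir \<theta>" by blast
  then show ?thesis using that[of y] supp_ge[of y \<theta>] supp_le[of \<theta>] by (simp add: order_antisym)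
qed

lemma bdry_inner: "(bdry \<phi> - c) \<bullet> dir \<theta> = radial \<phi> * cos (\<phi> - \<theta>)"
  by (simp add: bdry_def inner_dir_dir)

lemma radial_cos_le_supp: "radial \<phi> * cos (\<phi> - \<theta>) \<le> supp \<theta>"
  using supp_ge[OF bdry_closure[of \<phi>], of \<theta>] by (simp add: bdry_inner)

lemma radial_le_supp: "radial \<theta> \<le> supp \<theta>"
  using radial_cos_le_supp[of \<theta> \<theta>] by simp

lemma supp_pos: "0 < supp \<theta>"
  using radial_le_supp[of \<theta>] radial_frontier(1)[of \<theta>] by linarith

lemma supp_le_Rmax: "supp \<theta> \<le> Rmax"
proof (rule supp_le)
  fix y assume "y \<in> closure E"
  then show "(y - c) \<bullet> dir \<theta> \<le> Rmax"
    using inner_dir_le_norm[of "y - c" \<theta>] norm_le_Rmax[of y] by linarith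
qed

lemma supp_periodic [simp]: "supp (\<theta> + 2*pi) = supp \<theta>"
  by (simp add: supp_def)

lemma supp_lipschitz: "\<bar>supp a - supp b\<bar> \<le> Rmax * \<bar>a - b\<bar>"
proof -
  have *: "supp a \<le> supp b + Rmax * \<bar>a - b\<bar>" for a b
  proof (rule supp_le)
    fix y assume y: "y \<in> closure E"
    have "(y - c) \<bullet> dir a = (y - c) \<bullet> dir b + (y - c) \<bullet> (dir a - dir b)" by (simp add: inner_diff_right)
    also have "(y - c) \<bullet> (dir a - dir b) \<le> norm (y - c) * norm (dir a - dir b)" by (rule norm_cauchy_schwarz)
    also have "\<dots> \<le> Rmax * \<bar>a - b\<bar>" using norm_le_Rmax[OF y] dist_dir_le Rmax(1) by (intro mult_mono) auto
    finally show "(y - c) \<bullet> dir a \<le> supp b + Rmax * \<bar>a - b\<bar>" using supp_ge[OF y, of b] by linarith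
  qed
  show ?thesis using *[of a b] *[of b a] by (simp add: abs_minus_commute abs_le_iff)
qed

lemma continuous_supp: "continuous_on S supp"
proof (rule lipschitz_on_continuous_on)
  show "Rmax-lipschitz_on S supp"
    using supp_lipschitz Rmax(1) by (auto simp: lipschitz_on_def dist_real_def)
qed

text \<open>A maximiser of the height in direction \<theta>, pushed out along its ray to the
  boundary, keeps maximal height. Positivity of \<open>supp\<close> forces a positive cosine, which
  in the window starting at \<open>\<theta> - pi\<close> means less than a quarter turn.\<close>

lemma normal_of_angle: obtains \<phi> where "normal \<phi> \<theta>"
proof -
  obtain y where y: "y \<in> closure E" "(y - c) \<bullet> dir \<theta> = supp \<theta>" by (rule supp_attained)
  obtain \<phi> \<rho> where p: "\<theta> - pi \<le> \<phi>" "\<phi> < \<theta> - pi + 2*pi" "0 \<le> \<rho>" "\<rho> \<le> radial \<phi>" "y = c + \<rho> *\<^sub>R dir \<phi>"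
    using polar_closure[OF y(1)] by blast
  have s: "supp \<theta> = \<rho> * cos (\<phi> - \<theta>)" using y(2) p(5) by (simp add: inner_dir_dir)
  then have cpos: "cos (\<phi> - \<theta>) > 0" using supp_pos[of \<theta>] p(3) by (simp add: zero_less_mult_iff)
  have "\<bar>\<phi> - \<theta>\<bar> < pi/2"
  proof (rule ccontr)
    assume "\<not> ?thesis"
    then have "cos (pi/2) \<ge> cos \<bar>\<phi> - \<theta>\<bar>" using p(1,2) by (intro cos_monotone_0_pi_le) auto
    then show False using cpos by simp
  qed
  moreover have "supp \<theta> \<le> radial \<phi> * cos (\<phi> - \<theta>)"
    unfolding s using p(4) cpos by (intro mult_right_mono) auto
  ultimately show ?thesis
    using that[of \<phi>] radial_cos_le_supp[of \<phi> \<theta>] by (simp add: normal_def abs_minus_commute order_antisym)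
qed

text \<open>A hyperplane separating the boundary point from \<open>E\<close> has a normal with
  positive radial component, again because \<open>c\<close> is interior. The offset is the
  arctangent of the ratio of its two components, so its range comes for free.\<close>

lemma normal_exists: "\<exists>\<psi>. normal \<phi> (\<phi> + \<psi>)"
proof -
  have "bdry \<phi> \<notin> E" using radial_frontier(2)[of \<phi>] intE by (simp add: frontier_def)
  then obtain a b where ab: "a \<noteq> 0" "\<And>x. x \<in> E \<Longrightarrow> a \<bullet> x \<le> b" "b \<le> a \<bullet> bdry \<phi>"
    using separating_hyperplane_sets[of E "{bdry \<phi>}"] convexE cE by auto
  have cl: "a \<bullet> x \<le> a \<bullet> bdry \<phi>" if "x \<in> closure E" for x
  proof -
    have "closure E \<subseteq> {x. a \<bullet> x \<le> b}" using ab(2) by (intro closure_minimal closed_halfspace_le) auto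
    then show ?thesis using that ab(3) by auto
  qed
  obtain e where e: "e > 0" "ball c e \<subseteq> E" using openE cE by (meson open_contains_ball)
  have "c + (e / 2 / norm a) *\<^sub>R a \<in> ball c e" using e ab(1) by (simp add: dist_norm)
  then have "a \<bullet> (c + (e / 2 / norm a) *\<^sub>R a) \<le> a \<bullet> bdry \<phi>" using e cl closure_subset by blast
  moreover have "(e / 2 / norm a) * (a \<bullet> a) > 0" using e ab(1) by simp
  ultimately have "a \<bullet> c < a \<bullet> bdry \<phi>" by (simp add: inner_add_right)
  then have "0 < radial \<phi> * (a \<bullet> dir \<phi>)" by (simp add: bdry_def inner_add_right)
  define \<alpha> \<beta> where "\<alpha> = a \<bullet> dir \<phi>" and "\<beta> = a \<bullet> dir (\<phi> + pi/2)"
  have \<alpha>: "\<alpha> > 0" using \<open>0 < radial \<phi> * (a \<bullet> dir \<phi>)\<close> radial_frontier(1)[of \<phi>]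
    by (simp add: \<alpha>_def zero_less_mult_iff)
  define \<psi> where "\<psi> = arctan (\<beta> / \<alpha>)"
  have \<psi>: "-(pi/2) < \<psi>" "\<psi> < pi/2" using arctan_bounded[of "\<beta>/\<alpha>"] by (auto simp: \<psi>_def)
  then have cpos: "cos \<psi> > 0" by (intro cos_gt_zero_pi) auto
  have "tan \<psi> = \<beta> / \<alpha>" by (simp add: \<psi>_def tan_arctan)
  then have sin: "sin \<psi> = (\<beta> / \<alpha>) * cos \<psi>" using cpos by (simp add: tan_def field_simps)
  have "dir (\<phi> + \<psi>) = (cos \<psi> / \<alpha>) *\<^sub>R (\<alpha> *\<^sub>R dir \<phi> + \<beta> *\<^sub>R dir (\<phi> + pi/2))"
    unfolding dir_add[of \<phi> \<psi>] using \<alpha> by (simp add: sin scaleR_add_right)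
  also have "\<dots> = (cos \<psi> / \<alpha>) *\<^sub>R a" using dir_decomp[of a \<phi>] by (simp add: \<alpha>_def \<beta>_def)
  finally have d: "dir (\<phi> + \<psi>) = (cos \<psi> / \<alpha>) *\<^sub>R a" .
  have "supp (\<phi> + \<psi>) \<le> (bdry \<phi> - c) \<bullet> dir (\<phi> + \<psi>)"
  proof (rule supp_le)
    fix y assume "y \<in> closure E"
    then have "(y - c) \<bullet> a \<le> (bdry \<phi> - c) \<bullet> a" using cl[of y] by (simp add: inner_diff_right inner_commute)
    then show "(y - c) \<bullet> dir (\<phi> + \<psi>) \<le> (bdry \<phi> - c) \<bullet> dir (\<phi> + \<psi>)"
      unfolding d using \<alpha> cpos by (simp add: divide_right_mono mult_left_mono)
  qed
  then have "normal \<phi> (\<phi> + \<psi>)"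
    using \<psi> radial_cos_le_supp[of \<phi> "\<phi> + \<psi>"] by (simp add: normal_def bdry_inner abs_less_iff)
  then show ?thesis by blast
qed

text \<open>Choosing the offset rather than the angle makes the choice periodic: the predicate on
  \<psi> is the same at \<open>\<phi>\<close> and \<open>\<phi> + 2*pi\<close>, so \<open>nu\<close>
  gains exactly 2 pi per turn.\<close>

definition nu :: "real \<Rightarrow> real" where
  "nu \<phi> = \<phi> + (SOME \<psi>. normal \<phi> (\<phi> + \<psi>))"

lemma normal_nu: "normal \<phi> (nu \<phi>)"
  unfolding nu_def using someI_ex[OF normal_exists] .

lemma normal_add_2pi [simp]: "normal (\<phi> + 2*pi) (\<theta> + 2*pi) = normal \<phi> \<theta>"
  by (simp add: normal_def)

lemma nu_periodic [simp]: "nu (\<phi> + 2*pi) = nu \<phi> + 2*pi"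
proof -
  have "normal (\<phi> + 2*pi) (\<phi> + 2*pi + \<psi>) = normal \<phi> (\<phi> + \<psi>)" for \<psi>
    using normal_add_2pi[of \<phi> "\<phi> + \<psi>"] by (simp add: ac_simps)
  then show ?thesis by (simp add: nu_def)
qed

text \<open>Each support value dominates the height of the other boundary point. Multiplying the two
  inequalities cancels the radii and leaves a difference of cosine products equal to
  \<open>- (sin (\<phi>' - \<phi>) * sin (\<theta> - \<theta>'))\<close>, which must be
  nonnegative.\<close>

lemma normal_mono:
  assumes "normal \<phi> \<theta>" "normal \<phi>' \<theta>'" "\<phi> < \<phi>'" "\<phi>' < \<phi> + pi"
  shows "\<theta> \<le> \<theta>'"
proof (rule ccontr)
  assume "\<not> \<theta> \<le> \<theta>'"
  then have lt: "\<theta>' < \<theta>" by simp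
  have n: "\<bar>\<theta> - \<phi>\<bar> < pi/2" "\<bar>\<theta>' - \<phi>'\<bar> < pi/2" "supp \<theta> = radial \<phi> * cos (\<phi> - \<theta>)"
    "supp \<theta>' = radial \<phi>' * cos (\<phi>' - \<theta>')" using assms(1,2) by (auto simp: normal_def)
  have c1: "cos (\<phi>' - \<theta>) > 0" "cos (\<phi> - \<theta>') > 0"
    using n(1,2) lt assms(3) by (intro cos_gt_zero_pi; linarith)+
  have "radial \<phi>' * cos (\<phi>' - \<theta>) * (radial \<phi> * cos (\<phi> - \<theta>')) \<le> supp \<theta> * supp \<theta>'"
    using c1 radial_frontier(1) radial_cos_le_supp supp_pos
    by (intro mult_mono) (auto simp: less_imp_le)
  then have "radial \<phi> * radial \<phi>' * (cos (\<phi>' - \<theta>) * cos (\<phi> - \<theta>'))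
     \<le> radial \<phi> * radial \<phi>' * (cos (\<phi> - \<theta>) * cos (\<phi>' - \<theta>'))"
    by (simp add: n(3,4) ac_simps)
  then have "cos (\<phi>' - \<theta>) * cos (\<phi> - \<theta>') \<le> cos (\<phi> - \<theta>) * cos (\<phi>' - \<theta>')"
    using radial_frontier(1) by (subst (asm) mult_le_cancel_left_pos) auto
  moreover have "cos (\<phi> - \<theta>) * cos (\<phi>' - \<theta>') - cos (\<phi>' - \<theta>) * cos (\<phi> - \<theta>') = - (sin (\<phi>' - \<phi>) * sin (\<theta> - \<theta>'))"
    by (simp add: cos_diff sin_diff algebra_simps)
  moreover have "sin (\<phi>' - \<phi>) > 0" "sin (\<theta> - \<theta>') > 0"
    using assms(3,4) lt n(1,2) by (intro sin_gt_zero; linarith)+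
  ultimately show False by (smt (verit) mult_pos_pos)
qed

lemma nu_mono:
  assumes "\<phi> \<le> \<phi>'" "\<phi>' < \<phi> + pi" shows "nu \<phi> \<le> nu \<phi>'"
  using normal_mono[OF normal_nu normal_nu, of \<phi> \<phi>'] assms by (cases "\<phi> = \<phi>'") auto

text \<open>A mean value theorem without differentiability: the component of the chord along
  \<open>dir s\<close> is nonpositive at one normal and nonnegative at the other, so the chord is
  tangential for some angle between. Counterclockwise order of the points fixes its sign.\<close>

lemma chord_direction:
  assumes "normal \<phi> \<theta>" "normal \<phi>' \<theta>'" "\<phi> \<le> \<phi>'" "\<phi>' < \<phi> + pi" "\<theta> \<le> \<theta>'"
  obtains \<zeta> where "\<theta> \<le> \<zeta>" "\<zeta> \<le> \<theta>'" "bdry \<phi>' - bdry \<phi> = norm (bdry \<phi>' - bdry \<phi>) *\<^sub>R dir (\<zeta> + pi/2)"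
proof -
  define v where "v = bdry \<phi>' - bdry \<phi>"
  have n: "\<bar>\<theta> - \<phi>\<bar> < pi/2" "\<bar>\<theta>' - \<phi>'\<bar> < pi/2" "supp \<theta> = radial \<phi> * cos (\<phi> - \<theta>)"
    "supp \<theta>' = radial \<phi>' * cos (\<phi>' - \<theta>')" using assms(1,2) by (auto simp: normal_def)
  have vd: "v \<bullet> dir s = radial \<phi>' * cos (\<phi>' - s) - radial \<phi> * cos (\<phi> - s)" for s
    using bdry_inner[of \<phi> s] bdry_inner[of \<phi>' s] by (simp add: v_def inner_diff_left)
  have "v \<bullet> dir \<theta> \<le> 0" "0 \<le> v \<bullet> dir \<theta>'"
    using radial_cos_le_supp[of \<phi>' \<theta>] radial_cos_le_supp[of \<phi> \<theta>'] by (simp_all add: vd n)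
  moreover have "continuous_on {\<theta>..\<theta>'} (\<lambda>s. v \<bullet> dir s)" by (intro continuous_intros)
  ultimately obtain \<zeta> where z: "\<theta> \<le> \<zeta>" "\<zeta> \<le> \<theta>'" "v \<bullet> dir \<zeta> = 0"
    using IVT'[of "\<lambda>s. v \<bullet> dir s" \<theta> 0 \<theta>'] assms(5) by blast
  define w where "w = v \<bullet> dir (\<zeta> + pi/2)"
  have v: "v = w *\<^sub>R dir (\<zeta> + pi/2)" using dir_decomp[of v \<zeta>] z(3) by (simp add: w_def)
  have k: "radial \<phi>' * cos (\<phi>' - \<zeta>) = radial \<phi> * cos (\<phi> - \<zeta>)" using z(3) by (simp add: vd)
  \<comment> \<open>If \<zeta> is a quarter turn or more beyond \<phi>, it is within a quarter turn
    of \<phi>', because the step is below pi; then \<open>k\<close> transfers the sign.\<close>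
  have cpos: "cos (\<phi> - \<zeta>) > 0"
  proof (cases "\<zeta> < \<phi> + pi/2")
    case True
    then show ?thesis using z n(1) by (intro cos_gt_zero_pi; linarith)
  next
    case False
    have "cos (\<phi>' - \<zeta>) > 0" using False z(1,2) n(2) assms(4) by (intro cos_gt_zero_pi; linarith)
    then have "radial \<phi> * cos (\<phi> - \<zeta>) > 0" using radial_frontier(1)[of \<phi>'] by (simp flip: k)
    then show ?thesis using radial_frontier(1)[of \<phi>] by (simp add: zero_less_mult_iff)
  qed
  have w': "w = radial \<phi>' * sin (\<phi>' - \<zeta>) - radial \<phi> * sin (\<phi> - \<zeta>)"
    unfolding w_def vd by (simp add: cos_diff sin_diff sin_add cos_add algebra_simps)
  have "w * cos (\<phi> - \<zeta>) = radial \<phi>' * sin (\<phi>' - \<zeta>) * cos (\<phi> - \<zeta>) - sin (\<phi> - \<zeta>) * (radial \<phi> * cos (\<phi> - \<zeta>))"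
    unfolding w' by (simp add: algebra_simps)
  also have "\<dots> = radial \<phi>' * (sin (\<phi>' - \<zeta>) * cos (\<phi> - \<zeta>) - cos (\<phi>' - \<zeta>) * sin (\<phi> - \<zeta>))"
    by (simp flip: k add: algebra_simps)
  also have "\<dots> = radial \<phi>' * sin (\<phi>' - \<phi>)"
    using sin_diff[of "\<phi>' - \<zeta>" "\<phi> - \<zeta>"] by simp
  also have "\<dots> \<ge> 0" using radial_frontier(1)[of \<phi>'] assms(3,4) by (intro mult_nonneg_nonneg sin_ge_zero) auto
  finally have "w \<ge> 0" using cpos by (simp add: zero_le_mult_iff)
  then have "norm v = w" by (simp add: v)
  then show ?thesis using that[OF z(1,2)] v by (simp add: v_def)
qed

end

section \<open>Sums along the boundary\<close>

text \<open>\<omega> will be the largest diameter of a boundary cell. The cap at 1 lets quadratic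
  terms in \<omega> be absorbed into linear ones.\<close>

lemma LIMSEQ_linear_bound:
  fixes f :: "nat \<Rightarrow> real"
  assumes "\<And>\<omega>. 0 < \<omega> \<Longrightarrow> \<omega> \<le> 1 \<Longrightarrow> \<forall>\<^sub>F M in sequentially. \<bar>f M - L\<bar> \<le> K * \<omega>"
  shows "f \<longlonglongrightarrow> L"
proof (rule tendstoI)
  fix e :: real assume e: "e > 0"
  define \<omega> where "\<omega> = min 1 (e / (2 * (\<bar>K\<bar> + 1)))"
  have w: "0 < \<omega>" "\<omega> \<le> 1" using e by (auto simp: \<omega>_def add_pos_pos)
  have "K * \<omega> \<le> (\<bar>K\<bar> + 1) * \<omega>" using w by (intro mult_right_mono) auto
  also have "\<dots> \<le> (\<bar>K\<bar> + 1) * (e / (2 * (\<bar>K\<bar> + 1)))"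
    by (intro mult_left_mono) (auto simp: \<omega>_def)
  also have "\<dots> = e / 2" by (simp add: add_nonneg_pos field_simps)
  also have "\<dots> < e" using e by simp
  finally have "K * \<omega> < e" .
  then show "\<forall>\<^sub>F M in sequentially. dist (f M) L < e"
    using assms[OF w] by (auto simp: dist_real_def elim!: eventually_mono)
qed

lemma periodic_integral:
  fixes f :: "real \<Rightarrow> real"
  assumes "continuous_on UNIV f" "\<And>x. f (x + p) = f x" "p \<ge> 0"
  shows "integral {a..a + p} f = integral {b..b + p} f"
proof -
  have *: "integral {a..a + p} f = integral {b..b + p} f" if "a \<le> b" for a b
  proof -
    have int: "f integrable_on {x..y}" for x y
      by (intro integrable_continuous_real continuous_on_subset[OF assms(1)]) auto
    have "integral {a..b + p} f = integral {a..a + p} f + integral {a + p..b + p} f"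
      using that assms(3) by (intro Henstock_Kurzweil_Integration.integral_combine[symmetric] int) auto
    moreover have "integral {a..b + p} f = integral {a..b} f + integral {b..b + p} f"
      using that assms(3) by (intro Henstock_Kurzweil_Integration.integral_combine[symmetric] int) auto
    moreover have "integral {a + p..b + p} f = integral {a..b} f"
    proof -
      have "integral {a..b} (\<lambda>x. f (x + p)) = integral {a + p..b + p} f"
        using integral_shift_Icc_real[of a b f p] by (simp add: add.commute o_def)
      then show ?thesis by (simp add: assms(2))
    qed
    ultimately show ?thesis by simp
  qed
  show ?thesis
  proof (cases "a \<le> b")
    case False
    then show ?thesis by (intro *[symmetric]) simp
  qed (rule *)
qed

lemma integral_close:
  fixes f g :: "real \<Rightarrow> real"
  assumes "continuous_on {a..b} f" "continuous_on {a..b} g" "a \<le> b"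
    and "\<And>x. a \<le> x \<Longrightarrow> x \<le> b \<Longrightarrow> \<bar>f x - g x\<bar> \<le> k"
  shows "\<bar>integral {a..b} f - integral {a..b} g\<bar> \<le> k * (b - a)"
proof -
  have i: "f integrable_on {a..b}" "g integrable_on {a..b}"
    using assms by (auto intro: integrable_continuous_real)
  have "norm (integral {a..b} (\<lambda>x. f x - g x)) \<le> integral {a..b} (\<lambda>x. k)"
    using assms by (intro integral_norm_bound_integral integrable_continuous_real continuous_intros) auto
  then show ?thesis using assms(3) by (simp add: integral_diff[OF i] mult.commute)
qed

lemma has_derivative_inner_dir_perp:
  "((\<lambda>s. v \<bullet> dir (s + pi/2)) has_real_derivative - (v \<bullet> dir s)) (at s within A)"
proof -
  have "((\<lambda>s. v \<bullet> dir (s + pi/2)) has_real_derivative (v \<bullet> dir (s + pi/2 + pi/2)) * 1) (at s within A)"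
    by (rule DERIV_chain2[of "\<lambda>s. v \<bullet> dir s", OF has_derivative_inner_dir]) (auto intro!: derivative_eq_intros)
  moreover have "dir (s + pi/2 + pi/2) = - dir s" using dir_add_pi[of s] by (simp add: add.assoc)
  ultimately show ?thesis by simp
qed

lemma integral_inner_dir:
  assumes "a \<le> b"
  shows "integral {a..b} (\<lambda>s. v \<bullet> dir s) = v \<bullet> dir (a + pi/2) - v \<bullet> dir (b + pi/2)"
proof -
  have "((\<lambda>s. v \<bullet> dir s) has_integral (- (v \<bullet> dir (b + pi/2)) - (- (v \<bullet> dir (a + pi/2))))) {a..b}"
    using assms has_derivative_inner_dir_perp[THEN DERIV_minus, of v]
    by (intro fundamental_theorem_of_calculus) (auto simp: has_real_derivative_iff_has_vector_derivative[symmetric])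
  then show ?thesis by (simp add: integral_unique)
qed

lemma sum_integral_telescope:
  fixes f :: "real \<Rightarrow> real"
  assumes "continuous_on UNIV f" "\<And>j. \<theta> j \<le> \<theta> (Suc j)"
  shows "(\<Sum>j<n. integral {\<theta> j..\<theta> (Suc j)} f) = integral {\<theta> 0..\<theta> n} f"
proof (induction n)
  case (Suc n)
  have "\<theta> 0 \<le> \<theta> n" by (rule lift_Suc_mono_le[of \<theta>]) (use assms in auto)
  then have "integral {\<theta> 0..\<theta> n} f + integral {\<theta> n..\<theta> (Suc n)} f = integral {\<theta> 0..\<theta> (Suc n)} f"
    by (intro Henstock_Kurzweil_Integration.integral_combine integrable_continuous_real
        continuous_on_subset[OF assms(1)]) (use assms in auto)
  then show ?case using Suc by simp
qed simp

lemma cos_lipschitz: "\<bar>cos a - cos b\<bar> \<le> \<bar>a - b\<bar>" for a b :: real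
proof -
  have "cos a - cos b = (dir a - dir b) \<bullet> dir 0" by (simp add: inner_diff_left inner_dir_dir)
  then show ?thesis using inner_dir_le_norm[of "dir a - dir b" 0] dist_dir_le[of a b] by simp
qed

lemma cos_ge_quadratic: "1 - x\<^sup>2 / 2 \<le> cos x" for x :: real
proof -
  have "1 - cos x = 2 * (sin (x/2))\<^sup>2" using cos_double_sin[of "x/2"] by simp
  also have "\<dots> \<le> 2 * (x/2)\<^sup>2" using abs_sin_x_le_abs_x[of "x/2"] by (intro mult_left_mono abs_le_square_iff[THEN iffD1]) auto
  finally show ?thesis by (simp add: power_divide)
qed

text \<open>The cubic potential used to turn the boundary momentum into an integral over the
  normal angle: along the boundary \<open>dh = q d\<theta>\<close> and \<open>dq = ds - h d\<theta>\<close>, so its differential is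
  \<open>(q\<^sup>2 + h\<^sup>2/2) ds - h\<^sup>3/2 d\<theta>\<close>.\<close>

definition pot :: "real \<Rightarrow> real \<Rightarrow> real" where
  "pot h q = q ^ 3 / 3 + h\<^sup>2 * q / 2"

text \<open>The pure rotation: the point is fixed and only the normal moves. Then
  \<open>ds = 0\<close>, and the change of the potential is exactly the integral of
  \<open>- h^3 / 2\<close>.\<close>

lemma integral_pot:
  assumes "a \<le> b"
  shows "pot (v \<bullet> dir b) (v \<bullet> dir (b + pi/2)) - pot (v \<bullet> dir a) (v \<bullet> dir (a + pi/2))
     = - integral {a..b} (\<lambda>s. (v \<bullet> dir s) ^ 3) / 2"
proof -
  have "((\<lambda>s. pot (v \<bullet> dir s) (v \<bullet> dir (s + pi/2))) has_real_derivative - ((v \<bullet> dir s) ^ 3 / 2)) (at s within A)" for s A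
  proof -
    note H = has_derivative_inner_dir[of v s A] and Q = has_derivative_inner_dir_perp[of v s A]
    show ?thesis unfolding pot_def
      by (rule DERIV_cong[OF DERIV_add[OF DERIV_cdivide[OF DERIV_power[OF Q, of 3], of 3]
              DERIV_cdivide[OF DERIV_mult[OF DERIV_power[OF H, of 2] Q], of 2]]])
         (simp add: power2_eq_square power3_eq_cube field_simps)
  qed
  then have "((\<lambda>s. - ((v \<bullet> dir s) ^ 3 / 2)) has_integral
      (pot (v \<bullet> dir b) (v \<bullet> dir (b + pi/2)) - pot (v \<bullet> dir a) (v \<bullet> dir (a + pi/2)))) {a..b}"
    using assms by (intro fundamental_theorem_of_calculus) (auto simp: has_real_derivative_iff_has_vector_derivative[symmetric])
  from integral_unique[OF this] show ?thesis by simp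
qed

text \<open>The pure translation: the normal is fixed and the point moves by a chord of length
  \<open>d\<close> whose direction is within \<delta> of the tangent. Its normal component
  \<open>u\<close> is then of second order and its tangential component \<open>w\<close> agrees with
  \<open>d\<close> to second order; \<open>eq\<close> is the exact Taylor remainder.\<close>

lemma pot_increment:
  assumes "\<bar>h\<bar> \<le> R" "\<bar>q\<bar> \<le> R" "\<bar>h - u\<bar> \<le> R" "\<bar>q - w\<bar> \<le> R" "0 \<le> d" "0 \<le> \<delta>"
    and "\<bar>u\<bar> \<le> d * \<delta>" "\<bar>w - d\<bar> \<le> d * \<delta>" "\<bar>w\<bar> \<le> d"
  shows "\<bar>pot h q - pot (h - u) (q - w) - (q\<^sup>2 + h\<^sup>2 / 2) * d\<bar> \<le> 5 * R\<^sup>2 * (d * \<delta>) + 3 * R * d\<^sup>2"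
proof -
  have R: "0 \<le> R" using assms(1) by linarith
  have eq: "pot h q - pot (h - u) (q - w) - (q\<^sup>2 + h\<^sup>2 / 2) * d
     = (q\<^sup>2 + h\<^sup>2 / 2) * (w - d) + (w / 3 - q) * w\<^sup>2 + (h + (h - u)) * (q - w) * u / 2"
    by (simp add: pot_def power2_eq_square power3_eq_cube field_simps)
  have sq: "q\<^sup>2 \<le> R\<^sup>2" "h\<^sup>2 \<le> R\<^sup>2" using assms R by (auto intro!: abs_le_square_iff[THEN iffD1])
  have "q\<^sup>2 + h\<^sup>2 / 2 \<le> 2 * R\<^sup>2" using sq zero_le_power2[of R] by linarith
  then have "\<bar>(q\<^sup>2 + h\<^sup>2 / 2) * (w - d)\<bar> \<le> (2 * R\<^sup>2) * (d * \<delta>)"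
    unfolding abs_mult using assms by (intro mult_mono) auto
  moreover have "\<bar>(w / 3 - q) * w\<^sup>2\<bar> \<le> (3 * R) * d\<^sup>2"
  proof -
    have "\<bar>w / 3 - q\<bar> \<le> 3 * R" using assms(1-4) by linarith
    moreover have "w\<^sup>2 \<le> d\<^sup>2" using assms by (auto intro!: abs_le_square_iff[THEN iffD1])
    ultimately show ?thesis unfolding abs_mult using R by (intro mult_mono) auto
  qed
  moreover have "\<bar>(h + (h - u)) * (q - w) * u / 2\<bar> \<le> R\<^sup>2 * (d * \<delta>)"
  proof -
    have "\<bar>h + (h - u)\<bar> * \<bar>q - w\<bar> * \<bar>u\<bar> \<le> (2 * R) * R * (d * \<delta>)"
      using assms R by (intro mult_mono) auto
    then show ?thesis by (simp add: abs_mult power2_eq_square)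
  qed
  ultimately have "\<bar>(q\<^sup>2 + h\<^sup>2 / 2) * (w - d) + (w / 3 - q) * w\<^sup>2 + (h + (h - u)) * (q - w) * u / 2\<bar>
     \<le> (2 * R\<^sup>2) * (d * \<delta>) + (3 * R) * d\<^sup>2 + R\<^sup>2 * (d * \<delta>)" by linarith
  moreover have "0 \<le> R\<^sup>2 * (d * \<delta>)" using assms(5,6) by simp
  ultimately show ?thesis unfolding eq by linarith
qed

section \<open>Partitions of the boundary at equally spaced polar angles\<close>

context convex_domain
begin

definition ang :: "real \<Rightarrow> nat \<Rightarrow> nat \<Rightarrow> real" where
  "ang a M j = a + 2 * pi * real j / real M"

definition len :: "real \<Rightarrow> nat \<Rightarrow> nat \<Rightarrow> real" where
  "len a M j = norm (bdry (ang a M (Suc j)) - bdry (ang a M j))"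

text \<open>At a corner this does not tend to 0 as \<open>M\<close> grows; only the sum over all
  cells is under control.\<close>

definition turn :: "real \<Rightarrow> nat \<Rightarrow> nat \<Rightarrow> real" where
  "turn a M j = nu (ang a M (Suc j)) - nu (ang a M j)"

text \<open>\<omega> bounds the diameter of every cell of the boundary. At least three cells keep
  the step below pi, as the monotonicity of normals requires.\<close>

definition mesh :: "real \<Rightarrow> nat \<Rightarrow> real \<Rightarrow> bool" where
  "mesh a M \<omega> \<longleftrightarrow> 3 \<le> M \<and> (\<forall>\<phi>\<in>{a..a+2*pi}. \<forall>\<phi>'\<in>{a..a+2*pi}. \<bar>\<phi> - \<phi>'\<bar> \<le> 2*pi/real M \<longrightarrow> norm (bdry \<phi> - bdry \<phi>') \<le> \<omega>)"

lemma eventually_mesh: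
  assumes "\<omega> > 0" shows "\<forall>\<^sub>F M in sequentially. mesh a M \<omega>"
proof -
  have "uniformly_continuous_on {a..a+2*pi} bdry"
    by (intro compact_uniformly_continuous continuous_bdry) auto
  then obtain d where d: "d > 0" "\<And>\<phi> \<phi>'. \<phi> \<in> {a..a+2*pi} \<Longrightarrow> \<phi>' \<in> {a..a+2*pi} \<Longrightarrow> dist \<phi>' \<phi> < d \<Longrightarrow> dist (bdry \<phi>') (bdry \<phi>) < \<omega>"
    unfolding uniformly_continuous_on_def using assms by metis
  have "(\<lambda>M. 2*pi/real M) \<longlonglongrightarrow> 0" by (rule lim_const_over_n)
  then have "\<forall>\<^sub>F M in sequentially. 2*pi/real M < d" using d(1) by (rule order_tendstoD)
  then show ?thesis using eventually_ge_at_top[of 3]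
    by eventually_elim (use d(2) in \<open>auto simp: mesh_def dist_norm intro!: less_imp_le\<close>)
qed

lemma ang_0 [simp]: "ang a M 0 = a" by (simp add: ang_def)

lemma ang_M: "M > 0 \<Longrightarrow> ang a M M = a + 2*pi" by (simp add: ang_def)

lemma ang_Suc: "ang a M (Suc j) = ang a M j + 2*pi / real M"
  by (simp add: ang_def add_divide_distrib algebra_simps)

lemma ang_mono: "i \<le> j \<Longrightarrow> ang a M i \<le> ang a M j"
  by (simp add: ang_def divide_right_mono)

lemma sum_turn: "M > 0 \<Longrightarrow> (\<Sum>j<M. turn a M j) = 2*pi"
  unfolding turn_def sum_lessThan_telescope[of "\<lambda>j. nu (ang a M j)" M] by (simp add: ang_M)

context
  fixes a \<omega> :: real and M :: nat
  assumes mesh: "mesh a M \<omega>"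
begin

lemma M3: "M \<ge> 3" "M > 0" using mesh by (auto simp: mesh_def)

lemma step_lt_pi: "2*pi / real M < pi"
proof -
  have "2 * pi < pi * real M" using M3 by simp
  then show ?thesis using M3 by (simp add: divide_less_eq)
qed

lemma ang_range: "j \<le> M \<Longrightarrow> ang a M j \<in> {a..a + 2*pi}"
  using ang_mono[of 0 j a M] ang_mono[of j M a M] M3 by (simp add: ang_M)

lemma ang_lt: "ang a M j < ang a M (Suc j)" "ang a M (Suc j) < ang a M j + pi"
  using M3 step_lt_pi by (auto simp: ang_Suc)

lemma cell_dist:
  assumes "j < M" "\<phi> \<in> {ang a M j..ang a M (Suc j)}" "\<phi>' \<in> {ang a M j..ang a M (Suc j)}"
  shows "norm (bdry \<phi> - bdry \<phi>') \<le> \<omega>"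
proof -
  have "\<phi> \<in> {a..a+2*pi}" "\<phi>' \<in> {a..a+2*pi}"
    using assms ang_range[of j] ang_range[of "Suc j"] by auto
  moreover have "\<bar>\<phi> - \<phi>'\<bar> \<le> 2*pi/real M" using assms ang_Suc[of a M j] by auto
  ultimately show ?thesis using mesh by (auto simp: mesh_def)
qed

lemma omega_nonneg: "\<omega> \<ge> 0"
  using cell_dist[of 0 a a] M3 ang_lt(1)[of 0] by simp

lemma len_le: "j < M \<Longrightarrow> len a M j \<le> \<omega>"
  unfolding len_def using ang_lt(1)[of j] by (intro cell_dist) auto

lemma len_nonneg: "len a M j \<ge> 0" by (simp add: len_def)

lemma turn_nonneg: "turn a M j \<ge> 0"
  unfolding turn_def using nu_mono[of "ang a M j" "ang a M (Suc j)"] ang_lt[of j] by simp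

lemma chord:
  obtains \<zeta> where "nu (ang a M j) \<le> \<zeta>" "\<zeta> \<le> nu (ang a M (Suc j))"
    "bdry (ang a M (Suc j)) - bdry (ang a M j) = len a M j *\<^sub>R dir (\<zeta> + pi/2)"
  using chord_direction[OF normal_nu normal_nu, of "ang a M j" "ang a M (Suc j)"] ang_lt[of j]
    nu_mono[of "ang a M j" "ang a M (Suc j)"] that unfolding len_def by auto

text \<open>By monotonicity, a normal strictly between those of the end points touches the boundary
  inside the same cell, so \<open>supp s\<close> is the height of a point within \<omega> of the
  left end.\<close>

lemma supp_cell:
  assumes "j < M" "nu (ang a M j) \<le> s" "s \<le> nu (ang a M (Suc j))"
  shows "\<bar>supp s - (bdry (ang a M j) - c) \<bullet> dir s\<bar> \<le> \<omega>"
proof -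
  have *: "\<bar>supp s - (bdry (ang a M j) - c) \<bullet> dir s\<bar> \<le> \<omega>"
    if "normal \<phi> s" "\<phi> \<in> {ang a M j..ang a M (Suc j)}" for \<phi>
  proof -
    have "supp s - (bdry (ang a M j) - c) \<bullet> dir s = (bdry \<phi> - bdry (ang a M j)) \<bullet> dir s"
      using that(1) bdry_inner[of \<phi> s] by (simp add: normal_def inner_diff_left)
    then show ?thesis
      using inner_dir_le_norm[of "bdry \<phi> - bdry (ang a M j)" s] cell_dist[OF assms(1) that(2), of "ang a M j"] ang_lt(1)[of j]
      by auto
  qed
  consider "s = nu (ang a M j)" | "s = nu (ang a M (Suc j))" | "nu (ang a M j) < s" "s < nu (ang a M (Suc j))"
    using assms by linarith
  then show ?thesis
  proof cases
    case 1 then show ?thesis using *[of "ang a M j"] normal_nu ang_lt(1)[of j] by simp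
  next
    case 2 then show ?thesis using *[of "ang a M (Suc j)"] normal_nu ang_lt(1)[of j] by simp
  next
    case 3
    obtain \<phi> where p: "normal \<phi> s" by (rule normal_of_angle)
    have n: "\<bar>s - \<phi>\<bar> < pi/2" "\<bar>nu (ang a M j) - ang a M j\<bar> < pi/2" "\<bar>nu (ang a M (Suc j)) - ang a M (Suc j)\<bar> < pi/2"
      using p normal_nu by (auto simp: normal_def)
    have "ang a M j \<le> \<phi>"
    proof (rule ccontr)
      assume "\<not> ?thesis"
      then have "s \<le> nu (ang a M j)" using n 3 by (intro normal_mono[OF p normal_nu]; linarith)
      then show False using 3 by simp
    qed
    moreover have "\<phi> \<le> ang a M (Suc j)"
    proof (rule ccontr)
      assume "\<not> ?thesis"
      then have "nu (ang a M (Suc j)) \<le> s" using n 3 by (intro normal_mono[OF normal_nu p]; linarith)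
      then show False using 3 by simp
    qed
    ultimately show ?thesis using *[OF p] by simp
  qed
qed

text \<open>Bounds the diameter of a whole cell by its chord, as needed for covers. If the turn is
  small, all chords inside the cell project forward onto the tangent at its end, so an inner chord
  costs at most the full one up to the cosine of the turn. If the turn is at least 1, the term
  \<omega> times turn alone suffices.\<close>

lemma cell_dist_turn:
  assumes "j < M" "ang a M j \<le> \<phi>" "\<phi> \<le> \<phi>'" "\<phi>' \<le> ang a M (Suc j)"
  shows "norm (bdry \<phi>' - bdry \<phi>) \<le> len a M j + 2 * \<omega> * turn a M j"
proof (cases "turn a M j \<ge> 1")
  case True
  have "norm (bdry \<phi>' - bdry \<phi>) \<le> \<omega>" using assms by (intro cell_dist) auto
  also have "\<omega> \<le> \<omega> * turn a M j" using True omega_nonneg by (simp add: mult_le_cancel_left1)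
  also have "\<dots> \<le> len a M j + 2 * \<omega> * turn a M j"
    using len_nonneg[of j] mult_nonneg_nonneg[OF omega_nonneg turn_nonneg[of j]] by simp
  finally show ?thesis .
next
  case False
  define \<tau> where "\<tau> = turn a M j"
  have t: "0 \<le> \<tau>" "\<tau> < 1" using False turn_nonneg[of j] by (auto simp: \<tau>_def)
  define \<theta> where "\<theta> = nu (ang a M (Suc j))"
  have proj: "norm (bdry y - bdry x) * cos \<tau> \<le> (bdry y - bdry x) \<bullet> dir (\<theta> + pi/2)"
    if xy: "ang a M j \<le> x" "x \<le> y" "y \<le> ang a M (Suc j)" for x y
  proof -
    have yp: "y < x + pi" using xy ang_lt[of j] by linarith
    obtain \<zeta> where z: "nu x \<le> \<zeta>" "\<zeta> \<le> nu y" "bdry y - bdry x = norm (bdry y - bdry x) *\<^sub>R dir (\<zeta> + pi/2)"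
      using chord_direction[OF normal_nu normal_nu xy(2) yp nu_mono[OF xy(2) yp]] by blast
    have "nu (ang a M j) \<le> nu x" "nu y \<le> \<theta>"
      unfolding \<theta>_def using xy ang_lt[of j] by (intro nu_mono; linarith)+
    then have b: "0 \<le> \<theta> - \<zeta>" "\<theta> - \<zeta> \<le> \<tau>" using z by (auto simp: \<tau>_def turn_def \<theta>_def)
    have "(bdry y - bdry x) \<bullet> dir (\<theta> + pi/2) = norm (bdry y - bdry x) * cos (\<theta> - \<zeta>)"
      by (subst z(3)) (simp add: inner_dir_dir cos_diff)
    moreover have "cos \<tau> \<le> cos (\<theta> - \<zeta>)" using b t pi_gt3 by (intro cos_monotone_0_pi_le) auto
    ultimately show ?thesis by (simp add: mult_left_mono)
  qed
  have cpos: "cos \<tau> > 0" using t pi_gt3 by (intro cos_gt_zero_pi) auto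
  have nn: "0 \<le> (bdry y - bdry x) \<bullet> dir (\<theta> + pi/2)" if "ang a M j \<le> x" "x \<le> y" "y \<le> ang a M (Suc j)" for x y
    by (rule order_trans[OF _ proj[OF that]]) (use cpos in simp)
  have "norm (bdry \<phi>' - bdry \<phi>) * cos \<tau> \<le> (bdry \<phi>' - bdry \<phi>) \<bullet> dir (\<theta> + pi/2)"
    using assms by (intro proj)
  also have "\<dots> \<le> (bdry \<phi>' - bdry \<phi>) \<bullet> dir (\<theta> + pi/2) + (bdry \<phi> - bdry (ang a M j)) \<bullet> dir (\<theta> + pi/2)
      + (bdry (ang a M (Suc j)) - bdry \<phi>') \<bullet> dir (\<theta> + pi/2)"
    using nn[of "ang a M j" \<phi>] nn[of \<phi>' "ang a M (Suc j)"] assms by simp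
  also have "\<dots> = (bdry (ang a M (Suc j)) - bdry (ang a M j)) \<bullet> dir (\<theta> + pi/2)"
    by (simp add: inner_diff_left)
  also have "\<dots> \<le> len a M j"
    using inner_dir_le_norm[of "bdry (ang a M (Suc j)) - bdry (ang a M j)" "\<theta> + pi/2"] by (simp add: len_def)
  finally have 1: "norm (bdry \<phi>' - bdry \<phi>) * cos \<tau> \<le> len a M j" .
  \<comment> \<open>This trades the factor \<open>1 / cos \<tau>\<close> for an additive error of
    order \<omega> times \<tau>, which can be summed over the cells.\<close>
  have "1 - cos \<tau> \<le> 2 * \<tau> * cos \<tau>"
  proof -
    have c: "1 - \<tau>\<^sup>2 / 2 \<le> cos \<tau>" by (rule cos_ge_quadratic)
    have "\<tau>\<^sup>2 \<le> \<tau>" using t mult_left_le[of \<tau> \<tau>] by (simp add: power2_eq_square)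
    then have "cos \<tau> \<ge> 1 - \<tau>/2" "cos \<tau> \<ge> 1/2" using c t by auto
    then show ?thesis using t mult_left_mono[of "1/2" "cos \<tau>" "2 * \<tau>"] by linarith
  qed
  then have "norm (bdry \<phi>' - bdry \<phi>) * (1 - cos \<tau>) \<le> norm (bdry \<phi>' - bdry \<phi>) * (2 * \<tau> * cos \<tau>)"
    by (intro mult_left_mono) auto
  also have "\<dots> = 2 * \<tau> * (norm (bdry \<phi>' - bdry \<phi>) * cos \<tau>)" by simp
  also have "\<dots> \<le> 2 * \<tau> * \<omega>"
    using 1 len_le[OF assms(1)] t by (intro mult_left_mono) auto
  finally show ?thesis using 1 by (simp add: \<tau>_def algebra_simps)
qed

text \<open>The move along a cell is factored into two: first the normal turns from \<theta> to
  \<theta>' at the point \<open>x\<close>, which is integrated exactly with \<open>supp\<close>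
  replaced by the height of \<open>x\<close>, then the point moves from \<open>x\<close> to
  \<open>y\<close> under the fixed normal \<theta>'. The differences of \<open>q\<close> and of
  \<open>pot\<close> are kept, to telescope around the curve.\<close>

lemma step_arc:
  assumes "j < M"
  defines "\<theta> \<equiv> nu (ang a M j)" and "\<theta>' \<equiv> nu (ang a M (Suc j))"
    and "x \<equiv> bdry (ang a M j) - c" and "y \<equiv> bdry (ang a M (Suc j)) - c"
  shows "\<bar>len a M j - (y \<bullet> dir (\<theta>' + pi/2) - x \<bullet> dir (\<theta> + pi/2)) - integral {\<theta>..\<theta>'} supp\<bar> \<le> 2 * \<omega> * turn a M j"
    (is ?th1)
    and "\<bar>((norm y)\<^sup>2 - (supp \<theta>')\<^sup>2 / 2) * len a M j
       - (pot (y \<bullet> dir \<theta>') (y \<bullet> dir (\<theta>' + pi/2)) - pot (x \<bullet> dir \<theta>) (x \<bullet> dir (\<theta> + pi/2)))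
       - integral {\<theta>..\<theta>'} (\<lambda>s. supp s ^ 3) / 2\<bar> \<le> 8 * Rmax\<^sup>2 * \<omega> * turn a M j + 3 * Rmax * \<omega> * len a M j"
    (is ?th2)
proof -
  define d \<delta> where "d = len a M j" and "\<delta> = turn a M j"
  have d: "0 \<le> d" "d \<le> \<omega>" and \<delta>: "0 \<le> \<delta>" "\<theta>' - \<theta> = \<delta>"
    using len_nonneg len_le[OF assms(1)] turn_nonneg[of j] by (auto simp: d_def \<delta>_def turn_def \<theta>_def \<theta>'_def)
  have \<theta>: "\<theta> \<le> \<theta>'" using \<delta> by simp
  have dd: "d * \<delta> \<le> \<omega> * \<delta>" using d \<delta> by (simp add: mult_right_mono)
  obtain \<zeta> where z: "\<theta> \<le> \<zeta>" "\<zeta> \<le> \<theta>'" "y - x = d *\<^sub>R dir (\<zeta> + pi/2)"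
    using chord[of j] unfolding \<theta>_def \<theta>'_def x_def y_def d_def by auto
  define u w where "u = (y - x) \<bullet> dir \<theta>'" and "w = (y - x) \<bullet> dir (\<theta>' + pi/2)"
  have w: "w = d * cos (\<zeta> - \<theta>')" unfolding w_def z(3) by (simp add: inner_dir_dir)
  have u: "u = d * cos (\<zeta> + pi/2 - \<theta>')" unfolding u_def z(3) by (simp add: inner_dir_dir)
  have zt: "\<bar>\<zeta> - \<theta>'\<bar> \<le> \<delta>" using z \<delta> by simp
  have wd: "\<bar>w - d\<bar> \<le> d * \<delta>"
  proof -
    have "w - d = d * (cos (\<zeta> - \<theta>') - cos 0)" unfolding w by (simp add: right_diff_distrib)
    then have "\<bar>w - d\<bar> = d * \<bar>cos (\<zeta> - \<theta>') - cos 0\<bar>" using d(1) by (simp add: abs_mult)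
    also have "\<dots> \<le> d * \<delta>" using cos_lipschitz[of "\<zeta> - \<theta>'" 0] zt d(1) by (intro mult_left_mono) linarith+
    finally show ?thesis .
  qed
  have ud: "\<bar>u\<bar> \<le> d * \<delta>"
  proof -
    have "\<bar>u\<bar> = d * \<bar>cos (\<zeta> + pi/2 - \<theta>') - cos (pi/2)\<bar>" unfolding u using d(1) by (simp add: abs_mult)
    also have "\<dots> \<le> d * \<delta>" using cos_lipschitz[of "\<zeta> + pi/2 - \<theta>'" "pi/2"] zt d(1) by (intro mult_left_mono) linarith+
    finally show ?thesis .
  qed
  have wle: "\<bar>w\<bar> \<le> d" unfolding w using d(1) by (simp add: abs_mult mult_left_le)
  have cont: "continuous_on {\<theta>..\<theta>'} (\<lambda>s. x \<bullet> dir s)" by (intro continuous_intros)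
  have close: "\<bar>supp s - x \<bullet> dir s\<bar> \<le> \<omega>" if "\<theta> \<le> s" "s \<le> \<theta>'" for s
    using supp_cell[OF assms(1)] that unfolding \<theta>_def \<theta>'_def x_def by simp
  have I1: "\<bar>integral {\<theta>..\<theta>'} supp - integral {\<theta>..\<theta>'} (\<lambda>s. x \<bullet> dir s)\<bar> \<le> \<omega> * \<delta>"
    using integral_close[OF continuous_supp cont \<theta> close] \<delta> by simp
  have "len a M j - (y \<bullet> dir (\<theta>' + pi/2) - x \<bullet> dir (\<theta> + pi/2)) - integral {\<theta>..\<theta>'} supp
     = (d - w) - (integral {\<theta>..\<theta>'} supp - integral {\<theta>..\<theta>'} (\<lambda>s. x \<bullet> dir s))"
    unfolding integral_inner_dir[OF \<theta>] by (simp add: w_def d_def inner_diff_left)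
  then show ?th1 using I1 wd dd by (simp add: \<delta>_def[symmetric])
  have ry: "norm y \<le> Rmax" and rx: "norm x \<le> Rmax"
    using norm_le_Rmax[OF bdry_closure] by (simp_all add: x_def y_def)
  have xyd: "\<bar>x \<bullet> dir s\<bar> \<le> Rmax" "\<bar>y \<bullet> dir s\<bar> \<le> Rmax" for s
    using inner_dir_le_norm[of x s] inner_dir_le_norm[of y s] rx ry by linarith+
  have hy: "supp \<theta>' = y \<bullet> dir \<theta>'"
    using normal_nu[of "ang a M (Suc j)"] bdry_inner[of "ang a M (Suc j)" \<theta>'] by (simp add: normal_def \<theta>'_def y_def)
  define h q where "h = y \<bullet> dir \<theta>'" and "q = y \<bullet> dir (\<theta>' + pi/2)"
  have hu: "x \<bullet> dir \<theta>' = h - u" "x \<bullet> dir (\<theta>' + pi/2) = q - w"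
    by (simp_all add: h_def q_def u_def w_def inner_diff_left)
  have inc: "\<bar>pot h q - pot (h - u) (q - w) - (q\<^sup>2 + h\<^sup>2 / 2) * d\<bar> \<le> 5 * Rmax\<^sup>2 * (d * \<delta>) + 3 * Rmax * d\<^sup>2"
    using xyd[of \<theta>'] xyd[of "\<theta>' + pi/2"] d(1) \<delta>(1) ud wd wle unfolding hu h_def[symmetric] q_def[symmetric]
    by (intro pot_increment)
  have I3: "\<bar>integral {\<theta>..\<theta>'} (\<lambda>s. supp s ^ 3) - integral {\<theta>..\<theta>'} (\<lambda>s. (x \<bullet> dir s) ^ 3)\<bar> \<le> 3 * Rmax\<^sup>2 * \<omega> * (\<theta>' - \<theta>)"
  proof (intro integral_close continuous_intros continuous_supp \<theta>)
    fix s assume s: "\<theta> \<le> s" "s \<le> \<theta>'"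
    define A B where "A = supp s" and "B = x \<bullet> dir s"
    have AB: "\<bar>A\<bar> \<le> Rmax" "\<bar>B\<bar> \<le> Rmax" "\<bar>A - B\<bar> \<le> \<omega>"
      using supp_pos[of s] supp_le_Rmax[of s] xyd[of s] close[OF s] by (auto simp: A_def B_def)
    have "A ^ 3 - B ^ 3 = (A * A + A * B + B * B) * (A - B)" by (simp add: power3_eq_cube algebra_simps)
    moreover have "\<bar>A * A + A * B + B * B\<bar> \<le> 3 * Rmax\<^sup>2"
    proof -
      have "\<bar>A * A\<bar> \<le> Rmax * Rmax" "\<bar>A * B\<bar> \<le> Rmax * Rmax" "\<bar>B * B\<bar> \<le> Rmax * Rmax"
        unfolding abs_mult using AB Rmax(1) by (intro mult_mono; simp)+
      then show ?thesis unfolding power2_eq_square by linarith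
    qed
    ultimately show "\<bar>supp s ^ 3 - (x \<bullet> dir s) ^ 3\<bar> \<le> 3 * Rmax\<^sup>2 * \<omega>"
      unfolding A_def[symmetric] B_def[symmetric] using AB by (simp add: abs_mult mult_mono)
  qed
  have P: "pot (x \<bullet> dir \<theta>') (x \<bullet> dir (\<theta>' + pi/2)) - pot (x \<bullet> dir \<theta>) (x \<bullet> dir (\<theta> + pi/2))
     = - integral {\<theta>..\<theta>'} (\<lambda>s. (x \<bullet> dir s) ^ 3) / 2"
    by (rule integral_pot[OF \<theta>])
  \<comment> \<open>Pythagoras in the frame of \<theta>' turns the integrand into the coefficient of
    \<open>ds\<close> in the differential of \<open>pot\<close>.\<close>
  have ny: "(norm y)\<^sup>2 - (supp \<theta>')\<^sup>2 / 2 = q\<^sup>2 + h\<^sup>2 / 2"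
    using norm_dir_decomp[of y \<theta>'] hy by (simp add: h_def q_def)
  define A B where "A = pot h q - pot (h - u) (q - w) - (q\<^sup>2 + h\<^sup>2 / 2) * d"
    and "B = integral {\<theta>..\<theta>'} (\<lambda>s. supp s ^ 3) - integral {\<theta>..\<theta>'} (\<lambda>s. (x \<bullet> dir s) ^ 3)"
  have e: "((norm y)\<^sup>2 - (supp \<theta>')\<^sup>2 / 2) * len a M j
       - (pot h q - pot (x \<bullet> dir \<theta>) (x \<bullet> dir (\<theta> + pi/2)))
       - integral {\<theta>..\<theta>'} (\<lambda>s. supp s ^ 3) / 2 = - A - B / 2"
    using P unfolding A_def B_def hu ny d_def[symmetric] by (simp add: field_simps)
  have "Rmax\<^sup>2 * (d * \<delta>) \<le> Rmax\<^sup>2 * (\<omega> * \<delta>)" using dd by (intro mult_left_mono) auto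
  moreover have "Rmax * d\<^sup>2 \<le> Rmax * (\<omega> * d)"
    using d Rmax(1) by (intro mult_left_mono) (auto simp: power2_eq_square mult_right_mono)
  moreover have "0 \<le> Rmax\<^sup>2 * (\<omega> * \<delta>)" using \<delta> omega_nonneg by simp
  moreover have "\<bar>A\<bar> \<le> 5 * (Rmax\<^sup>2 * (d * \<delta>)) + 3 * (Rmax * d\<^sup>2)" using inc by (simp only: A_def mult.assoc)
  moreover have "\<bar>B\<bar> \<le> 3 * (Rmax\<^sup>2 * (\<omega> * \<delta>))" using I3 by (simp only: B_def \<delta>(2) mult.assoc)
  ultimately have "\<bar>- A - B / 2\<bar> \<le> 8 * (Rmax\<^sup>2 * (\<omega> * \<delta>)) + 3 * (Rmax * (\<omega> * d))" by linarith
  then show ?th2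
    unfolding h_def[symmetric] q_def[symmetric] e by (simp only: d_def \<delta>_def mult.assoc)
qed

text \<open>Both terms are about twice the area of the triangle spanned by \<open>c\<close> and the
  chord: the second is exact and equals chord length times the distance of its line from
  \<open>c\<close>. Replacing the direction of the chord by the normal \<theta>' costs the
  turn.\<close>

lemma step_area:
  assumes "j < M"
  shows "\<bar>supp (nu (ang a M (Suc j))) * len a M j - radial (ang a M j) * radial (ang a M (Suc j)) * sin (2*pi / real M)\<bar>
    \<le> Rmax * \<omega> * turn a M j"
proof -
  define \<phi> \<phi>' \<theta>' d where "\<phi> = ang a M j" and "\<phi>' = ang a M (Suc j)" and "\<theta>' = nu \<phi>'" and "d = len a M j"
  obtain \<zeta> where z: "nu \<phi> \<le> \<zeta>" "\<zeta> \<le> \<theta>'" "bdry \<phi>' - bdry \<phi> = d *\<^sub>R dir (\<zeta> + pi/2)"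
    using chord[of j] unfolding \<phi>_def \<phi>'_def \<theta>'_def d_def by blast
  have "(bdry \<phi>' - bdry \<phi>) \<bullet> dir (\<phi>' + pi/2) = radial \<phi> * sin (\<phi>' - \<phi>)"
    by (simp add: bdry_def inner_diff_left inner_dir_dir inner_add_left cos_add cos_diff sin_diff sin_add algebra_simps)
  then have "radial \<phi> * sin (\<phi>' - \<phi>) = d * cos (\<zeta> - \<phi>')"
    unfolding z(3) by (simp add: inner_dir_dir)
  moreover have "\<phi>' - \<phi> = 2*pi / real M" by (simp add: \<phi>_def \<phi>'_def ang_Suc)
  ultimately have e: "radial \<phi> * radial \<phi>' * sin (2*pi / real M) = radial \<phi>' * (d * cos (\<phi>' - \<zeta>))"
    using cos_minus[of "\<phi>' - \<zeta>"] by (simp add: mult.assoc mult.left_commute[of "radial \<phi>"])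
  have h: "supp \<theta>' = radial \<phi>' * cos (\<phi>' - \<theta>')" using normal_nu[of \<phi>'] by (simp add: normal_def \<theta>'_def)
  have "supp \<theta>' * d - radial \<phi> * radial \<phi>' * sin (2*pi / real M) = radial \<phi>' * (d * (cos (\<phi>' - \<theta>') - cos (\<phi>' - \<zeta>)))"
    unfolding e h by (simp add: algebra_simps)
  also have "\<bar>\<dots>\<bar> \<le> Rmax * (\<omega> * turn a M j)"
  proof -
    have "\<bar>cos (\<phi>' - \<theta>') - cos (\<phi>' - \<zeta>)\<bar> \<le> \<bar>(\<phi>' - \<theta>') - (\<phi>' - \<zeta>)\<bar>" by (rule cos_lipschitz)
    also have "\<dots> \<le> turn a M j" using z(1,2) by (simp add: turn_def \<theta>'_def \<phi>_def \<phi>'_def)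
    finally show ?thesis unfolding abs_mult
      using radial_le_Rmax[of \<phi>'] radial_frontier(1)[of \<phi>'] len_le[OF assms] len_nonneg[of j] omega_nonneg
      by (intro mult_mono) (auto simp: d_def)
  qed
  finally show ?thesis by (simp add: \<phi>_def \<phi>'_def \<theta>'_def d_def mult.assoc)
qed

end

text \<open>Cauchy's formula for the length; \<open>perimeter_eq\<close> identifies it with the
  Hausdorff measure of the frontier.\<close>

definition perim :: real where "perim = integral {0..2*pi} supp"

lemma integral_supp_period:
  assumes "continuous_on UNIV (\<lambda>x. F (supp x))"
  shows "integral {t..t + 2*pi} (\<lambda>s. F (supp s) :: real) = integral {0..2*pi} (\<lambda>s. F (supp s))"
  using periodic_integral[OF assms, of "2*pi" t 0] by simp

text \<open>The increments of \<open>q\<close> cancel around the closed curve and the turns fill one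
  period of \<open>supp\<close>. The rate is kept, since both the covers and the integral estimates
  use it.\<close>

lemma sum_len_bound:
  assumes "mesh a M \<omega>"
  shows "\<bar>(\<Sum>j<M. len a M j) - perim\<bar> \<le> 4 * pi * \<omega>"
proof -
  note M = M3[OF assms]
  define \<theta> where "\<theta> j = nu (ang a M j)" for j
  define q where "q j = (bdry (ang a M j) - c) \<bullet> dir (\<theta> j + pi/2)" for j
  have \<theta>: "\<theta> j \<le> \<theta> (Suc j)" for j using turn_nonneg[OF assms, of j] by (simp add: turn_def \<theta>_def)
  have \<theta>M: "\<theta> M = \<theta> 0 + 2*pi" using M by (simp add: \<theta>_def ang_M)
  have qM: "q M = q 0"
  proof -
    have "\<theta> M + pi/2 = (\<theta> 0 + pi/2) + 2*pi" using \<theta>M by simp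
    then have "dir (\<theta> M + pi/2) = dir (\<theta> 0 + pi/2)" by (simp only: dir_add_2pi)
    then show ?thesis using M by (simp add: q_def ang_M)
  qed
  have S: "(\<Sum>j<M. len a M j - (q (Suc j) - q j) - integral {\<theta> j..\<theta> (Suc j)} supp) = (\<Sum>j<M. len a M j) - perim"
  proof -
    have "(\<Sum>j<M. q (Suc j) - q j) = 0" using qM by (simp add: sum_lessThan_telescope)
    moreover have "(\<Sum>j<M. integral {\<theta> j..\<theta> (Suc j)} supp) = perim"
      using integral_supp_period[of "\<lambda>x. x" "\<theta> 0"]
      by (simp add: sum_integral_telescope[where \<theta>=\<theta>, OF continuous_supp \<theta>] \<theta>M perim_def continuous_supp)
    ultimately show ?thesis by (simp add: sum_subtractf)
  qed
  have "\<bar>\<Sum>j<M. len a M j - (q (Suc j) - q j) - integral {\<theta> j..\<theta> (Suc j)} supp\<bar> \<le> (\<Sum>j<M. 2 * \<omega> * turn a M j)"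
    using step_arc(1)[OF assms] by (intro order_trans[OF sum_abs] sum_mono) (auto simp: q_def \<theta>_def)
  also have "\<dots> = 4 * pi * \<omega>" using sum_turn[of M a] M by (simp flip: sum_distrib_left)
  finally show ?thesis unfolding S .
qed

lemma sum_len_limit: "(\<lambda>M. \<Sum>j<M. len a M j) \<longlonglongrightarrow> perim"
proof (rule LIMSEQ_linear_bound)
  fix \<omega> :: real assume "0 < \<omega>"
  from eventually_mesh[OF this, of a]
  show "\<forall>\<^sub>F M in sequentially. \<bar>(\<Sum>j<M. len a M j) - perim\<bar> \<le> 4 * pi * \<omega>"
    by eventually_elim (rule sum_len_bound)
qed

lemma sum_cubic_limit:
  "(\<lambda>M. \<Sum>j<M. ((norm (bdry (ang a M (Suc j)) - c))\<^sup>2 - (supp (nu (ang a M (Suc j))))\<^sup>2 / 2) * len a M j)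
     \<longlonglongrightarrow> integral {0..2*pi} (\<lambda>s. supp s ^ 3) / 2"
proof (rule LIMSEQ_linear_bound)
  fix \<omega> :: real assume w: "0 < \<omega>" "\<omega> \<le> 1"
  show "\<forall>\<^sub>F M in sequentially. \<bar>(\<Sum>j<M. ((norm (bdry (ang a M (Suc j)) - c))\<^sup>2 - (supp (nu (ang a M (Suc j))))\<^sup>2 / 2) * len a M j)
      - integral {0..2*pi} (\<lambda>s. supp s ^ 3) / 2\<bar> \<le> (16 * pi * Rmax\<^sup>2 + 3 * Rmax * (perim + 4 * pi)) * \<omega>"
    using eventually_mesh[OF w(1), of a]
  proof eventually_elim
    fix M assume f: "mesh a M \<omega>"
    note M = M3[OF f]
    define \<theta> where "\<theta> j = nu (ang a M j)" for j
    define G where "G j = pot ((bdry (ang a M j) - c) \<bullet> dir (\<theta> j)) ((bdry (ang a M j) - c) \<bullet> dir (\<theta> j + pi/2))" for j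
    define T where "T j = ((norm (bdry (ang a M (Suc j)) - c))\<^sup>2 - (supp (\<theta> (Suc j)))\<^sup>2 / 2) * len a M j" for j
    have \<theta>: "\<theta> j \<le> \<theta> (Suc j)" for j using turn_nonneg[OF f, of j] by (simp add: turn_def \<theta>_def)
    have \<theta>M: "\<theta> M = \<theta> 0 + 2*pi" using M by (simp add: \<theta>_def ang_M)
    have GM: "G M = G 0"
    proof -
      have "\<theta> M + pi/2 = (\<theta> 0 + pi/2) + 2*pi" using \<theta>M by simp
      then have "dir (\<theta> M + pi/2) = dir (\<theta> 0 + pi/2)" "dir (\<theta> M) = dir (\<theta> 0)" by (simp_all only: dir_add_2pi \<theta>M)
      then show ?thesis using M by (simp add: G_def ang_M)
    qed
    have c3: "continuous_on UNIV (\<lambda>s. supp s ^ 3)" by (intro continuous_intros continuous_supp)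
    have S: "(\<Sum>j<M. T j - (G (Suc j) - G j) - integral {\<theta> j..\<theta> (Suc j)} (\<lambda>s. supp s ^ 3) / 2)
        = (\<Sum>j<M. T j) - integral {0..2*pi} (\<lambda>s. supp s ^ 3) / 2"
    proof -
      have "(\<Sum>j<M. G (Suc j) - G j) = 0" using GM by (simp add: sum_lessThan_telescope)
      moreover have "(\<Sum>j<M. integral {\<theta> j..\<theta> (Suc j)} (\<lambda>s. supp s ^ 3)) = integral {0..2*pi} (\<lambda>s. supp s ^ 3)"
        using integral_supp_period[of "\<lambda>x. x ^ 3" "\<theta> 0"]
        by (simp add: sum_integral_telescope[where \<theta>=\<theta>, OF c3 \<theta>] \<theta>M c3)
      ultimately show ?thesis by (simp add: sum_subtractf flip: sum_divide_distrib)
    qed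
    have "\<bar>\<Sum>j<M. T j - (G (Suc j) - G j) - integral {\<theta> j..\<theta> (Suc j)} (\<lambda>s. supp s ^ 3) / 2\<bar>
        \<le> (\<Sum>j<M. 8 * Rmax\<^sup>2 * \<omega> * turn a M j + 3 * Rmax * \<omega> * len a M j)"
      using step_arc(2)[OF f] by (intro order_trans[OF sum_abs] sum_mono) (auto simp: G_def T_def \<theta>_def)
    also have "\<dots> = 8 * Rmax\<^sup>2 * \<omega> * (2*pi) + 3 * Rmax * \<omega> * (\<Sum>j<M. len a M j)"
      using sum_turn[of M a] M by (simp add: sum.distrib flip: sum_distrib_left)
    also have "\<dots> \<le> 8 * Rmax\<^sup>2 * \<omega> * (2*pi) + 3 * Rmax * \<omega> * (perim + 4 * pi)"
    proof -
      have "4 * pi * \<omega> \<le> 4 * pi * 1" using w by (intro mult_left_mono) auto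
      then have "(\<Sum>j<M. len a M j) \<le> perim + 4 * pi" using sum_len_bound[OF f] by linarith
      then show ?thesis using w Rmax(1) by (intro add_left_mono mult_left_mono) auto
    qed
    finally show "\<bar>(\<Sum>j<M. ((norm (bdry (ang a M (Suc j)) - c))\<^sup>2 - (supp (nu (ang a M (Suc j))))\<^sup>2 / 2) * len a M j)
      - integral {0..2*pi} (\<lambda>s. supp s ^ 3) / 2\<bar> \<le> (16 * pi * Rmax\<^sup>2 + 3 * Rmax * (perim + 4 * pi)) * \<omega>"
      unfolding S by (simp add: T_def \<theta>_def algebra_simps)
  qed
qed

lemma sum_area_limit:
  "(\<lambda>M. (\<Sum>j<M. supp (nu (ang a M (Suc j))) * len a M j)
      - (\<Sum>j<M. radial (ang a M j) * radial (ang a M (Suc j)) * sin (2*pi / real M))) \<longlonglongrightarrow> 0"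
proof (rule LIMSEQ_linear_bound)
  fix \<omega> :: real assume w: "0 < \<omega>" "\<omega> \<le> 1"
  show "\<forall>\<^sub>F M in sequentially. \<bar>(\<Sum>j<M. supp (nu (ang a M (Suc j))) * len a M j)
      - (\<Sum>j<M. radial (ang a M j) * radial (ang a M (Suc j)) * sin (2*pi / real M)) - 0\<bar> \<le> (2 * pi * Rmax) * \<omega>"
    using eventually_mesh[OF w(1), of a]
  proof eventually_elim
    fix M assume f: "mesh a M \<omega>"
    have "\<bar>\<Sum>j<M. supp (nu (ang a M (Suc j))) * len a M j
      - radial (ang a M j) * radial (ang a M (Suc j)) * sin (2*pi / real M)\<bar> \<le> (\<Sum>j<M. Rmax * \<omega> * turn a M j)"
      using step_area[OF f] by (intro order_trans[OF sum_abs] sum_mono) auto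
    also have "\<dots> = (2 * pi * Rmax) * \<omega>"
      using sum_turn[of M a] M3[OF f] by (simp flip: sum_distrib_left)
    finally show "\<bar>(\<Sum>j<M. supp (nu (ang a M (Suc j))) * len a M j)
      - (\<Sum>j<M. radial (ang a M j) * radial (ang a M (Suc j)) * sin (2*pi / real M)) - 0\<bar> \<le> (2 * pi * Rmax) * \<omega>"
      by (simp add: sum_subtractf)
  qed
qed

end

section \<open>Perimeter, area and boundary momentum\<close>

context convex_domain
begin

definition cell :: "real \<Rightarrow> nat \<Rightarrow> nat \<Rightarrow> (real^2) set" where
  "cell a M j = bdry ` {ang a M j..<ang a M (Suc j)}"

lemma compact_frontier: "compact (frontier E)"
  using boundedE by (rule compact_frontier_bounded)

lemma ang_cover:
  assumes "M > 0"
  shows "(\<Union>j<n. {ang a M j..<ang a M (Suc j)}) = {a..<ang a M n}"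
proof (induction n)
  case (Suc n)
  have "(\<Union>j<Suc n. {ang a M j..<ang a M (Suc j)}) = {a..<ang a M n} \<union> {ang a M n..<ang a M (Suc n)}"
    using Suc by (simp add: lessThan_Suc Un_commute)
  also have "\<dots> = {a..<ang a M (Suc n)}"
    using ang_mono[of 0 n a M] ang_mono[of n "Suc n" a M] by (intro ivl_disj_un_two) auto
  finally show ?case .
qed simp

lemma ang_disjoint: "disjoint_family_on (\<lambda>j. {ang a M j..<ang a M (Suc j)}) S"
proof -
  have *: "{ang a M i..<ang a M (Suc i)} \<inter> {ang a M j..<ang a M (Suc j)} = {}" if "i < j" for i j
    using ang_mono[of "Suc i" j a M] that by auto
  show ?thesis unfolding disjoint_family_on_def
    using * by (metis Int_commute nat_neq_iff)
qed

lemma cell_cover: "M > 0 \<Longrightarrow> (\<Union>j<M. cell a M j) = frontier E"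
  by (simp add: cell_def flip: image_UN frontier_eq ang_M ang_cover) (simp add: ang_cover ang_M frontier_eq[of a])

lemma inj_bdry: "inj_on bdry {a..<a + 2*pi}"
  by (intro inj_onI bdry_inj) auto

lemma cell_disjoint:
  assumes "M > 0" shows "disjoint_family_on (cell a M) {..<M}"
  unfolding disjoint_family_on_def
proof (intro ballI impI)
  fix i j assume ij: "i \<in> {..<M}" "j \<in> {..<M}" "i \<noteq> j"
  have "{ang a M i..<ang a M (Suc i)} \<subseteq> {a..<a + 2*pi}" if "i < M" for i
    using ang_mono[of 0 i a M] ang_mono[of "Suc i" M a M] that by (auto simp: ang_M[OF assms])
  then have "bdry ` ({ang a M i..<ang a M (Suc i)} \<inter> {ang a M j..<ang a M (Suc j)}) = cell a M i \<inter> cell a M j"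
    unfolding cell_def using ij by (intro inj_on_image_Int[OF inj_bdry[of a]]) auto
  moreover have "{ang a M i..<ang a M (Suc i)} \<inter> {ang a M j..<ang a M (Suc j)} = {}"
    using ang_disjoint[of a M "{..<M}"] ij unfolding disjoint_family_on_def by blast
  ultimately show "cell a M i \<inter> cell a M j = {}" by (metis image_empty)
qed

lemma cell_sets [measurable]:
  assumes "mesh a M \<omega>" shows "cell a M j \<in> sets borel"
proof -
  have lt: "ang a M j < ang a M (Suc j)" "ang a M (Suc j) < ang a M j + pi" by (rule ang_lt[OF assms])+
  have "cell a M j = bdry ` {ang a M j..ang a M (Suc j)} - {bdry (ang a M (Suc j))}"
  proof (intro set_eqI iffI)
    fix y assume "y \<in> cell a M j"
    then obtain t where t: "y = bdry t" "ang a M j \<le> t" "t < ang a M (Suc j)" by (auto simp: cell_def)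
    have "bdry t \<noteq> bdry (ang a M (Suc j))" using bdry_inj[of t "ang a M (Suc j)"] t lt by auto
    then show "y \<in> bdry ` {ang a M j..ang a M (Suc j)} - {bdry (ang a M (Suc j))}" using t by auto
  next
    fix y assume "y \<in> bdry ` {ang a M j..ang a M (Suc j)} - {bdry (ang a M (Suc j))}"
    then obtain t where t: "y = bdry t" "ang a M j \<le> t" "t \<le> ang a M (Suc j)" "y \<noteq> bdry (ang a M (Suc j))" by auto
    then have "t \<noteq> ang a M (Suc j)" by blast
    with t show "y \<in> cell a M j" by (auto simp: cell_def)
  qed
  moreover have "compact (bdry ` {ang a M j..ang a M (Suc j)})"
    by (intro compact_continuous_image continuous_bdry) auto
  ultimately show ?thesis using borel_compact by (metis sets.Diff borel_singleton sets.empty_sets)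
qed

text \<open>The half-open cell lacks its right end point, but the parameters whose distance from the
  left end is at most the measure form a closed set, so the end point qualifies too.\<close>

lemma emeasure_cell_ge:
  assumes "mesh a M \<omega>" shows "ennreal (len a M j) \<le> emeasure hausdorff1 (cell a M j)"
proof -
  have lt: "ang a M j < ang a M (Suc j)" by (rule ang_lt[OF assms])
  define S where "S = {t. ennreal (dist (bdry (ang a M j)) (bdry t)) \<le> hausdorff1_outer (cell a M j)}"
  have "continuous_on UNIV (\<lambda>t. ennreal (dist (bdry (ang a M j)) (bdry t)))"
    by (intro continuous_on_ennreal continuous_intros continuous_bdry)
  then have "closed S" unfolding S_def by (intro closed_Collect_le) auto
  have "connected (cell a M j)" unfolding cell_def
    by (intro connected_continuous_image continuous_bdry) auto
  then have "{ang a M j..<ang a M (Suc j)} \<subseteq> S"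
    using lt unfolding S_def by (auto intro!: hausdorff1_outer_connected_ge simp: cell_def)
  then have "closure {ang a M j..<ang a M (Suc j)} \<subseteq> S" using \<open>closed S\<close> by (rule closure_minimal)
  then have "ang a M (Suc j) \<in> S" using lt by auto
  then show ?thesis unfolding emeasure_hausdorff1[OF cell_sets[OF assms]]
    by (simp add: S_def len_def dist_norm norm_minus_commute)
qed

text \<open>From above, the closed cells form a cover with total diameter close to the sum of the
  chords. From below, the half-open cells are disjoint and each measures at least its chord.\<close>

lemma emeasure_frontier: "emeasure hausdorff1 (frontier E) = ennreal perim"
proof (rule antisym)
  have fb: "frontier E \<in> sets borel" using compact_frontier by (rule borel_compact)
  show "emeasure hausdorff1 (frontier E) \<le> ennreal perim"
    unfolding emeasure_hausdorff1[OF fb]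
  proof (rule hausdorff1_outer_finite_cover_le)
    fix \<epsilon> :: real assume e: "\<epsilon> > 0"
    \<comment> \<open>The covering sum has error \<open>4 * pi * \<omega>\<close> from the chords
      and as much again from the turns; the additional 1 makes \<omega> itself at most
      \<epsilon>.\<close>
    define \<omega> where "\<omega> = \<epsilon> / (1 + 8 * pi)"
    have "1 + 8 * pi > 0" using pi_gt_zero by linarith
    then have w: "\<omega> > 0" "\<omega> * (1 + 8 * pi) = \<epsilon>" using e by (simp_all add: \<omega>_def)
    have we: "8 * pi * \<omega> \<le> \<epsilon>" "\<omega> \<le> \<epsilon>"
    proof -
      have "\<epsilon> = \<omega> + 8 * pi * \<omega>" by (simp flip: w(2) add: algebra_simps)
      moreover have "8 * pi * \<omega> > 0" using w(1) by simp
      ultimately show "8 * pi * \<omega> \<le> \<epsilon>" "\<omega> \<le> \<epsilon>" using w(1) by linarith+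
    qed
    obtain M where M: "mesh 0 M \<omega>"
      using eventually_mesh[OF w(1), of 0] by (auto simp: eventually_sequentially)
    note M0 = M3[OF M]
    define U where "U j = bdry ` {ang 0 M j..ang 0 M (Suc j)}" for j
    have ne: "bdry (ang 0 M j) \<in> U j" for j using ang_lt(1)[OF M, of j] by (auto simp: U_def)
    have d1: "diameter (U j) \<le> \<omega>" if "j < M" for j
    proof (rule diameter_le)
      show "U j \<noteq> {} \<or> 0 \<le> \<omega>" using w by simp
      fix x y assume "x \<in> U j" "y \<in> U j"
      then show "norm (x - y) \<le> \<omega>" unfolding U_def using cell_dist[OF M that] by blast
    qed
    have d2: "diameter (U j) \<le> len 0 M j + 2 * \<omega> * turn 0 M j" if j: "j < M" for j
    proof (rule diameter_le)
      show "U j \<noteq> {} \<or> 0 \<le> len 0 M j + 2 * \<omega> * turn 0 M j" using ne by blast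
      fix x y assume "x \<in> U j" "y \<in> U j"
      then obtain s t where st: "x = bdry s" "y = bdry t" "s \<in> {ang 0 M j..ang 0 M (Suc j)}" "t \<in> {ang 0 M j..ang 0 M (Suc j)}"
        unfolding U_def by blast
      show "norm (x - y) \<le> len 0 M j + 2 * \<omega> * turn 0 M j"
        using cell_dist_turn[OF M j, of s t] cell_dist_turn[OF M j, of t s] st
        by (cases "s \<le> t") (auto simp: norm_minus_commute)
    qed
    have "frontier E \<subseteq> (\<Union>j<M. U j)"
      unfolding cell_cover[OF M0(2), of 0, symmetric] cell_def U_def by (intro UN_mono image_mono) auto
    moreover have "bounded (U j)" for j unfolding U_def
      by (intro compact_imp_bounded compact_continuous_image continuous_bdry) auto
    moreover have "(\<Sum>j<M. diameter (U j)) \<le> perim + \<epsilon>"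
    proof -
      have "(\<Sum>j<M. diameter (U j)) \<le> (\<Sum>j<M. len 0 M j + 2 * \<omega> * turn 0 M j)" using d2 by (intro sum_mono) auto
      also have "\<dots> = (\<Sum>j<M. len 0 M j) + 4 * pi * \<omega>" using sum_turn[OF M0(2), of 0]
        by (simp add: sum.distrib flip: sum_distrib_left)
      finally show ?thesis using sum_len_bound[OF M] we(1) by linarith
    qed
    moreover have "\<forall>j<M. diameter (U j) \<le> \<epsilon>" using d1 we(2) order_trans by blast
    ultimately show "\<exists>U (n::nat). frontier E \<subseteq> (\<Union>i<n. U i) \<and> (\<forall>i<n. bounded (U i) \<and> diameter (U i) \<le> \<epsilon>)
        \<and> (\<Sum>i<n. diameter (U i)) \<le> perim + \<epsilon>" by blast
  qed
  have "\<forall>\<^sub>F M in sequentially. ennreal (\<Sum>j<M. len 0 M j) \<le> emeasure hausdorff1 (frontier E)"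
    using eventually_mesh[of 1 0, OF zero_less_one]
  proof eventually_elim
    fix M assume M: "mesh 0 M 1"
    note M0 = M3[OF M]
    have "ennreal (\<Sum>j<M. len 0 M j) = (\<Sum>j<M. ennreal (len 0 M j))"
      by (rule sum_ennreal[symmetric]) (simp add: len_def)
    also have "\<dots> \<le> (\<Sum>j<M. emeasure hausdorff1 (cell 0 M j))" by (intro sum_mono emeasure_cell_ge[OF M])
    also have "\<dots> = emeasure hausdorff1 (\<Union>j<M. cell 0 M j)"
      using cell_sets[OF M] by (intro sum_emeasure cell_disjoint M0) auto
    finally show "ennreal (\<Sum>j<M. len 0 M j) \<le> emeasure hausdorff1 (frontier E)" by (simp add: cell_cover[OF M0(2)])
  qed
  moreover have "(\<lambda>M. ennreal (\<Sum>j<M. len 0 M j)) \<longlonglongrightarrow> ennreal perim"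
    by (intro tendsto_ennrealI sum_len_limit)
  ultimately show "ennreal perim \<le> emeasure hausdorff1 (frontier E)"
    by (intro tendsto_upperbound[of _ _ sequentially]) auto
qed

lemma perim_pos: "perim > 0"
proof -
  have "\<exists>t\<in>{0..2*pi}. \<forall>s\<in>{0..2*pi}. supp t \<le> supp s"
    by (intro continuous_attains_inf continuous_supp) auto
  then obtain t where t: "\<And>s. s \<in> {0..2*pi} \<Longrightarrow> supp t \<le> supp s" by blast
  have "integral {0..2*pi} (\<lambda>_. supp t) \<le> integral {0..2*pi} supp"
    using t by (intro integral_le integrable_continuous_real continuous_supp continuous_intros) auto
  then have "2 * pi * supp t \<le> perim" by (simp add: perim_def mult.commute)
  moreover have "2 * pi * supp t > 0" using supp_pos[of t] by simp
  ultimately show ?thesis by linarith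
qed

lemma perimeter_eq: "perimeter E = perim"
  using emeasure_frontier perim_pos by (simp add: perimeter_def measure_def)

lemma set_integrable_frontier:
  fixes f :: "real^2 \<Rightarrow> real"
  assumes "continuous_on UNIV f"
  shows "set_integrable hausdorff1 (frontier E) f"
proof -
  have fb: "frontier E \<in> sets borel" using compact_frontier by (rule borel_compact)
  have "bounded (f ` frontier E)"
    by (intro compact_imp_bounded compact_continuous_image compact_frontier continuous_on_subset[OF assms]) auto
  then obtain B where B: "\<And>x. x \<in> frontier E \<Longrightarrow> norm (f x) \<le> B" by (auto simp: bounded_iff)
  have m: "f \<in> borel_measurable hausdorff1"
    using borel_measurable_continuous_onI[OF assms] by (simp cong: measurable_cong_sets)
  have "(\<lambda>x. indicat_real (frontier E) x *\<^sub>R f x) \<in> borel_measurable hausdorff1"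
    using fb m by (intro borel_measurable_scaleR borel_measurable_indicator) auto
  then show ?thesis unfolding set_integrable_def
    using fb B emeasure_frontier
    by (intro integrableI_bounded_set[where A = "frontier E" and B = B]) auto
qed

text \<open>Replacing \<open>f\<close> by its value at the end of a cell costs the Lipschitz
  constant times \<omega>. Replacing the measure of a cell by its chord is an error of one sign, so
  in total it costs \<open>B\<close> times the gap between perimeter and chord sum.\<close>

lemma integral_frontier_limit:
  fixes f :: "real^2 \<Rightarrow> real"
  assumes f: "continuous_on UNIV f"
    and lip: "\<And>x y. x \<in> frontier E \<Longrightarrow> y \<in> frontier E \<Longrightarrow> \<bar>f x - f y\<bar> \<le> \<Lambda> * norm (x - y)"
    and bd: "\<And>x. x \<in> frontier E \<Longrightarrow> \<bar>f x\<bar> \<le> B"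
  shows "(\<lambda>M. \<Sum>j<M. f (bdry (ang a M (Suc j))) * len a M j) \<longlonglongrightarrow> (LINT x:frontier E|hausdorff1. f x)"
proof (rule LIMSEQ_linear_bound)
  fix \<omega> :: real assume w: "0 < \<omega>" "\<omega> \<le> 1"
  let ?I = "LINT x:frontier E|hausdorff1. f x"
  show "\<forall>\<^sub>F M in sequentially. \<bar>(\<Sum>j<M. f (bdry (ang a M (Suc j))) * len a M j) - ?I\<bar> \<le> (\<bar>\<Lambda>\<bar> * perim + B * (4 * pi)) * \<omega>"
    using eventually_mesh[OF w(1), of a]
  proof eventually_elim
    fix M assume M: "mesh a M \<omega>"
    note M0 = M3[OF M]
    define k where "k j = f (bdry (ang a M (Suc j)))" for j
    define m where "m j = measure hausdorff1 (cell a M j)" for j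
    have cs: "cell a M j \<in> sets hausdorff1" for j using cell_sets[OF M] by simp
    have csub: "cell a M j \<subseteq> frontier E" if "j < M" for j using cell_cover[OF M0(2), of a] that by blast
    have fin: "emeasure hausdorff1 (cell a M j) < \<infinity>" if "j < M" for j
    proof -
      have "emeasure hausdorff1 (cell a M j) \<le> emeasure hausdorff1 (frontier E)"
        using csub[OF that] compact_frontier by (intro emeasure_mono) (auto intro: borel_compact)
      then show ?thesis unfolding emeasure_frontier by (metis ennreal_less_top infinity_ennreal_def order_le_less_trans)
    qed
    then have fin': "emeasure hausdorff1 (cell a M j) \<noteq> \<infinity>" if "j < M" for j using that by (metis less_irrefl)
    have em: "emeasure hausdorff1 (cell a M j) = ennreal (m j)" if "j < M" for j
      using fin[OF that] unfolding m_def by (intro emeasure_eq_ennreal_measure) auto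
    have m: "len a M j \<le> m j" if "j < M" for j
      using emeasure_cell_ge[OF M, of j] unfolding em[OF that] by (simp add: m_def)
    have int: "set_integrable hausdorff1 (cell a M j) g" if "continuous_on UNIV g" "j < M" for g :: "real^2 \<Rightarrow> real" and j
      using set_integrable_frontier[OF that(1)] cs csub[OF that(2)] by (rule set_integrable_subset)
    have summ: "(\<Sum>j<M. m j) = perim"
    proof -
      have "(\<Sum>j<M. m j) = measure hausdorff1 (\<Union>j<M. cell a M j)" unfolding m_def
        using cs fin' by (intro measure_finite_Union[symmetric] cell_disjoint M0) auto
      then show ?thesis using perimeter_eq by (simp add: cell_cover[OF M0(2)] perimeter_def)
    qed
    have I: "?I = (\<Sum>j<M. LINT x:cell a M j|hausdorff1. f x)"
      unfolding cell_cover[OF M0(2), of a, symmetric]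
      using cs int[OF f] by (intro set_integral_finite_Union cell_disjoint M0) auto
    have cellI: "\<bar>(LINT x:cell a M j|hausdorff1. f x) - k j * m j\<bar> \<le> \<bar>\<Lambda>\<bar> * \<omega> * m j" if j: "j < M" for j
    proof -
      have near: "\<bar>f x - k j\<bar> \<le> \<bar>\<Lambda>\<bar> * \<omega>" if x: "x \<in> cell a M j" for x
      proof -
        obtain t where t: "x = bdry t" "ang a M j \<le> t" "t < ang a M (Suc j)" using x by (auto simp: cell_def)
        have "\<bar>f x - k j\<bar> \<le> \<Lambda> * norm (x - bdry (ang a M (Suc j)))"
          unfolding k_def using csub[OF j] x radial_frontier(2) by (intro lip) auto
        also have "\<dots> \<le> \<bar>\<Lambda>\<bar> * norm (x - bdry (ang a M (Suc j)))" by (intro mult_right_mono) auto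
        also have "\<dots> \<le> \<bar>\<Lambda>\<bar> * \<omega>" using cell_dist[OF M j, of t "ang a M (Suc j)"] t by (intro mult_left_mono) auto
        finally show ?thesis .
      qed
      have c: "(LINT x:cell a M j|hausdorff1. z) = m j * z" for z :: real
        using cs fin[OF j] by (subst set_integral_const) (auto simp: m_def)
      have ic: "set_integrable hausdorff1 (cell a M j) (\<lambda>_. z)" for z :: real using j by (intro int continuous_intros)
      have "(LINT x:cell a M j|hausdorff1. f x) \<le> (LINT x:cell a M j|hausdorff1. k j + \<bar>\<Lambda>\<bar> * \<omega>)"
        using near by (intro set_integral_mono int[OF f j] ic) (force simp: abs_le_iff)
      moreover have "(LINT x:cell a M j|hausdorff1. k j - \<bar>\<Lambda>\<bar> * \<omega>) \<le> (LINT x:cell a M j|hausdorff1. f x)"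
        using near by (intro set_integral_mono int[OF f j] ic) (force simp: abs_le_iff)
      ultimately show ?thesis unfolding c by (simp add: algebra_simps abs_le_iff)
    qed
    have kB: "\<bar>k j\<bar> \<le> B" for j unfolding k_def using radial_frontier(2) by (intro bd)
    then have B0: "0 \<le> B" by (meson abs_ge_zero order_trans)
    have "\<bar>k j * len a M j - (LINT x:cell a M j|hausdorff1. f x)\<bar> \<le> \<bar>\<Lambda>\<bar> * \<omega> * m j + B * (m j - len a M j)" if j: "j < M" for j
    proof -
      have "\<bar>k j * m j - k j * len a M j\<bar> = \<bar>k j\<bar> * (m j - len a M j)"
        using m[OF j] by (simp add: abs_mult flip: right_diff_distrib)
      also have "\<dots> \<le> B * (m j - len a M j)" using kB m[OF j] by (intro mult_right_mono) auto
      finally show ?thesis using cellI[OF j] by linarith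
    qed
    then have "\<bar>\<Sum>j<M. k j * len a M j - (LINT x:cell a M j|hausdorff1. f x)\<bar>
        \<le> (\<Sum>j<M. \<bar>\<Lambda>\<bar> * \<omega> * m j + B * (m j - len a M j))"
      by (intro order_trans[OF sum_abs] sum_mono) auto
    also have "\<dots> = \<bar>\<Lambda>\<bar> * \<omega> * perim + B * (perim - (\<Sum>j<M. len a M j))"
      by (simp add: sum.distrib sum_subtractf summ flip: sum_distrib_left)
    also have "\<dots> \<le> \<bar>\<Lambda>\<bar> * \<omega> * perim + B * (4 * pi * \<omega>)"
      using sum_len_bound[OF M] B0 by (intro add_left_mono mult_left_mono) auto
    finally show "\<bar>(\<Sum>j<M. f (bdry (ang a M (Suc j))) * len a M j) - ?I\<bar> \<le> (\<bar>\<Lambda>\<bar> * perim + B * (4 * pi)) * \<omega>"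
      by (simp add: I k_def sum_subtractf algebra_simps)
  qed
qed

end

section \<open>Area through circular sectors\<close>

definition rot :: "real \<Rightarrow> real^2 \<Rightarrow> real^2" where
  "rot t v = (v \<bullet> dir 0) *\<^sub>R dir t + (v \<bullet> dir (pi/2)) *\<^sub>R dir (t + pi/2)"

lemma rot_dir: "rot t (s *\<^sub>R dir \<phi>) = s *\<^sub>R dir (t + \<phi>)"
proof -
  have "cos (\<phi> - pi/2) = sin \<phi>" by (simp add: cos_diff)
  then show ?thesis by (simp add: rot_def inner_dir_dir dir_add[of t \<phi>] scaleR_add_right)
qed

lemma orthogonal_transformation_rot: "orthogonal_transformation (rot t)"
  unfolding orthogonal_transformation
proof (intro conjI allI)
  show "linear (rot t)"
    by (rule linearI) (simp_all add: rot_def inner_add_left scaleR_add_left scaleR_add_right algebra_simps)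
  fix v
  obtain \<phi> where "v = norm v *\<^sub>R dir \<phi>" using dir_polar[of 0 v] by blast
  then have "rot t v = norm v *\<^sub>R dir (t + \<phi>)" by (metis rot_dir)
  then show "norm (rot t v) = norm v" by simp
qed

text \<open>Without the origin and half-open in the angle, so that the sectors of a partition are
  disjoint.\<close>

definition sector :: "real \<Rightarrow> real \<Rightarrow> real \<Rightarrow> (real^2) set" where
  "sector \<rho> s t = {x *\<^sub>R dir \<phi> | x \<phi>. 0 < x \<and> x \<le> \<rho> \<and> s \<le> \<phi> \<and> \<phi> < t}"

lemma scaleR_dir_eq:
  assumes "x *\<^sub>R dir \<phi> = x' *\<^sub>R dir \<phi>'" "0 < x" "0 \<le> x'" shows "dir \<phi> = dir \<phi>'"
proof -
  have "norm (x *\<^sub>R dir \<phi>) = norm (x' *\<^sub>R dir \<phi>')" using assms(1) by simp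
  then have "x' = x" using assms(2,3) by simp
  then show ?thesis using assms(1,2) by simp
qed

lemma sector_measurable:
  assumes "s < t" "t < s + 2*pi" shows "sector \<rho> s t \<in> lmeasurable"
proof -
  define F where "F = (\<lambda>p. fst p *\<^sub>R dir (snd p))"
  have cF: "continuous_on S F" for S unfolding F_def by (intro continuous_intros)
  have "sector \<rho> s t = F ` ({0..\<rho>} \<times> {s..t}) - F ` ({0..\<rho>} \<times> {t}) - {0}"
  proof (intro set_eqI iffI)
    fix y assume "y \<in> sector \<rho> s t"
    then obtain x \<phi> where y: "y = x *\<^sub>R dir \<phi>" "0 < x" "x \<le> \<rho>" "s \<le> \<phi>" "\<phi> < t" by (auto simp: sector_def)
    have "y \<noteq> x' *\<^sub>R dir t" if "0 \<le> x'" for x'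
    proof
      assume e: "y = x' *\<^sub>R dir t"
      then have "dir \<phi> = dir t" using scaleR_dir_eq[of x \<phi> x' t] y that by simp
      then show False using dir_inj[of \<phi> t] y assms by auto
    qed
    then have "y \<notin> F ` ({0..\<rho>} \<times> {t})" unfolding F_def by fastforce
    moreover have "y \<in> F ` ({0..\<rho>} \<times> {s..t})"
      using y by (intro image_eqI[of _ _ "(x, \<phi>)"]) (auto simp: F_def)
    ultimately show "y \<in> F ` ({0..\<rho>} \<times> {s..t}) - F ` ({0..\<rho>} \<times> {t}) - {0}" using y by simp
  next
    fix y assume y: "y \<in> F ` ({0..\<rho>} \<times> {s..t}) - F ` ({0..\<rho>} \<times> {t}) - {0}"
    then obtain x \<phi> where p: "y = x *\<^sub>R dir \<phi>" "0 \<le> x" "x \<le> \<rho>" "s \<le> \<phi>" "\<phi> \<le> t" by (auto simp: F_def)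
    moreover have "\<phi> \<noteq> t"
    proof
      assume "\<phi> = t"
      then have "y = F (x, t)" "(x, t) \<in> {0..\<rho>} \<times> {t}" using p by (auto simp: F_def)
      then show False using y by blast
    qed
    moreover have "x \<noteq> 0" using y p by auto
    ultimately show "y \<in> sector \<rho> s t" unfolding sector_def by force
  qed
  moreover have "F ` ({0..\<rho>} \<times> {s..t}) \<in> lmeasurable" "F ` ({0..\<rho>} \<times> {t}) \<in> lmeasurable"
    by (intro lmeasurable_compact compact_continuous_image cF compact_Times; simp)+
  ultimately show ?thesis by (simp add: fmeasurable_Diff fmeasurableD lmeasurable_compact)
qed

lemma measure_sector_rot: "measure lebesgue (sector \<rho> (s + d) (t + d)) = measure lebesgue (sector \<rho> s t)"
  if "s < t" "t < s + 2*pi"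
proof -
  have "rot d ` sector \<rho> s t = sector \<rho> (s + d) (t + d)"
  proof (intro set_eqI iffI)
    fix y assume "y \<in> rot d ` sector \<rho> s t"
    then obtain x \<phi> where "y = x *\<^sub>R dir (d + \<phi>)" "0 < x" "x \<le> \<rho>" "s \<le> \<phi>" "\<phi> < t" by (auto simp: sector_def rot_dir)
    then show "y \<in> sector \<rho> (s + d) (t + d)" unfolding sector_def by force
  next
    fix y assume "y \<in> sector \<rho> (s + d) (t + d)"
    then obtain x \<phi> where p: "y = x *\<^sub>R dir \<phi>" "0 < x" "x \<le> \<rho>" "s + d \<le> \<phi>" "\<phi> < t + d" by (auto simp: sector_def)
    then have "y = rot d (x *\<^sub>R dir (\<phi> - d))" by (simp add: rot_dir)
    moreover have "x *\<^sub>R dir (\<phi> - d) \<in> sector \<rho> s t" unfolding sector_def using p by force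
    ultimately show "y \<in> rot d ` sector \<rho> s t" by blast
  qed
  then show ?thesis
    using measure_orthogonal_image[OF orthogonal_transformation_rot sector_measurable[OF that], of d \<rho>] by simp
qed

context convex_domain
begin

lemma sector_ang_disjoint:
  assumes "M > 0"
  shows "disjoint_family_on (\<lambda>j. sector \<rho> (ang a M j) (ang a M (Suc j))) {..<M}"
  unfolding disjoint_family_on_def
proof (intro ballI impI)
  fix i j assume ij: "i \<in> {..<M}" "j \<in> {..<M}" "i \<noteq> j"
  show "sector \<rho> (ang a M i) (ang a M (Suc i)) \<inter> sector \<rho> (ang a M j) (ang a M (Suc j)) = {}"
  proof (rule ccontr)
    assume "\<not> ?thesis"
    then obtain x \<phi> x' \<phi>' where p: "x *\<^sub>R dir \<phi> = x' *\<^sub>R dir \<phi>'" "0 < x" "0 < x'"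
      "\<phi> \<in> {ang a M i..<ang a M (Suc i)}" "\<phi>' \<in> {ang a M j..<ang a M (Suc j)}"
      by (auto simp: sector_def)
    then have "dir \<phi> = dir \<phi>'" using scaleR_dir_eq[OF p(1,2)] by simp
    moreover have "\<phi> \<in> {a..<a + 2*pi}" "\<phi>' \<in> {a..<a + 2*pi}"
      using ang_cover[OF assms, of a M] ij p(4,5) by (auto simp: ang_M[OF assms])
    ultimately have "\<phi> = \<phi>'" by (intro dir_inj) auto
    then show False using p(4,5) ang_disjoint[of a M "{..<M}"] ij unfolding disjoint_family_on_def by blast
  qed
qed

lemma ang_lt': "M \<ge> 3 \<Longrightarrow> ang a M j < ang a M (Suc j)" "M \<ge> 3 \<Longrightarrow> ang a M (Suc j) < ang a M j + 2*pi"
proof -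
  assume M: "M \<ge> 3"
  then have "2*pi / real M < 2*pi / 1" by (intro divide_strict_left_mono) auto
  then show "ang a M (Suc j) < ang a M j + 2*pi" by (simp add: ang_Suc)
qed (simp add: ang_Suc)

text \<open>No change of variables: the \<open>M\<close> sectors are rotations of one another and
  partition the punctured disc, so each has an equal share of its area.\<close>

lemma measure_sector_ang:
  assumes M: "M \<ge> 3" and \<rho>: "0 \<le> \<rho>"
  shows "measure lebesgue (sector \<rho> (ang a M j) (ang a M (Suc j))) = pi / real M * \<rho>\<^sup>2"
proof -
  have M0: "M > 0" using M by simp
  have eq: "measure lebesgue (sector \<rho> (ang a M j) (ang a M (Suc j))) = measure lebesgue (sector \<rho> a (a + 2*pi/real M))" for j
    using measure_sector_rot[of a "a + 2*pi/real M" \<rho> "ang a M j - a"] ang_lt'[OF M, of a 0]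
    by (simp add: ang_Suc add.commute)
  have "(\<Union>j<M. sector \<rho> (ang a M j) (ang a M (Suc j))) = cball 0 \<rho> - {0}"
  proof (intro set_eqI iffI)
    fix y assume "y \<in> (\<Union>j<M. sector \<rho> (ang a M j) (ang a M (Suc j)))"
    then show "y \<in> cball 0 \<rho> - {0}" by (auto simp: sector_def)
  next
    fix y :: "real^2" assume y: "y \<in> cball 0 \<rho> - {0}"
    obtain \<phi> where p: "a \<le> \<phi>" "\<phi> < a + 2*pi" "y = norm y *\<^sub>R dir \<phi>" using dir_polar[of a y] by blast
    then have "\<phi> \<in> (\<Union>j<M. {ang a M j..<ang a M (Suc j)})" unfolding ang_cover[OF M0] ang_M[OF M0] by auto
    then obtain j where "j < M" "\<phi> \<in> {ang a M j..<ang a M (Suc j)}" by auto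
    moreover have "0 < norm y" "norm y \<le> \<rho>" using y by auto
    ultimately have "y \<in> sector \<rho> (ang a M j) (ang a M (Suc j))" unfolding sector_def
      using p(3) by (intro CollectI exI[of _ "norm y"] exI[of _ \<phi>]) auto
    then show "y \<in> (\<Union>j<M. sector \<rho> (ang a M j) (ang a M (Suc j)))" using \<open>j < M\<close> by blast
  qed
  then have "measure lebesgue (cball (0::real^2) \<rho> - {0}) = (\<Sum>j<M. measure lebesgue (sector \<rho> (ang a M j) (ang a M (Suc j))))"
    using sector_measurable[OF ang_lt'[OF M]] fmeasurableD2[OF sector_measurable[OF ang_lt'[OF M]]]
    by (subst measure_finite_Union[symmetric]) (auto intro!: sector_ang_disjoint M0 simp: fmeasurableD)
  moreover have "measure lebesgue (cball (0::real^2) \<rho> - {0}) = pi * \<rho>\<^sup>2"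
  proof -
    have "measure lebesgue (cball (0::real^2) \<rho> - {0}) = measure lebesgue (cball (0::real^2) \<rho>)"
      by (intro measure_Diff_null_set) auto
    then show ?thesis using \<rho> content_cball[of \<rho> "0::real^2"] by (simp add: unit_ball_vol_2)
  qed
  ultimately have "real M * measure lebesgue (sector \<rho> (ang a M j) (ang a M (Suc j))) = pi * \<rho>\<^sup>2" by (simp add: eq)
  then show ?thesis using M0 by (simp add: field_simps)
qed

lemma E_lmeasurable: "E \<in> lmeasurable"
  using openE boundedE by (simp add: bounded_set_imp_lmeasurable lmeasurable_open)

text \<open>The part of \<open>E\<close> over a cell lies between circular sectors whose radii
  differ from \<open>r j\<close> by at most a multiple of \<omega>. Each error carries the weight
  \<open>pi / M\<close>, so the sum is still of order \<omega>.\<close>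

lemma area_sector_bound:
  assumes mesh: "mesh a M \<omega>" and w: "\<omega> \<le> 1"
  shows "\<bar>area E - (\<Sum>j<M. pi / real M * (radial (ang a M j) * radial (ang a M (Suc j))))\<bar> \<le> pi * (5 * Rmax + 1) * \<omega>"
proof -
  note M = M3[OF mesh]
  define r where "r j = radial (ang a M j)" for j
  define S where "S \<rho> j = (+) c ` sector \<rho> (ang a M j) (ang a M (Suc j))" for \<rho> j
  have w0: "0 \<le> \<omega>" by (rule omega_nonneg[OF mesh])
  have r: "0 < r j" "r j \<le> Rmax" for j using radial_frontier(1) radial_le_Rmax by (auto simp: r_def)
  have rdiff: "\<bar>radial \<phi> - r j\<bar> \<le> \<omega>" if "j < M" "\<phi> \<in> {ang a M j..ang a M (Suc j)}" for \<phi> j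
  proof -
    have "\<bar>norm (bdry \<phi> - c) - norm (bdry (ang a M j) - c)\<bar> \<le> norm ((bdry \<phi> - c) - (bdry (ang a M j) - c))"
      by (rule norm_triangle_ineq3)
    also have "\<dots> \<le> \<omega>" using cell_dist[OF mesh that(1), of \<phi> "ang a M j"] that ang_lt(1)[OF mesh, of j] by simp
    finally show ?thesis using radial_frontier(1) by (simp add: bdry_def r_def less_imp_le)
  qed
  have mS: "S \<rho> j \<in> lmeasurable" for \<rho> j
    unfolding S_def by (intro measurable_translation sector_measurable ang_lt' M)
  have valS: "measure lebesgue (S \<rho> j) = pi / real M * \<rho>\<^sup>2" if "0 \<le> \<rho>" for \<rho> j
    unfolding S_def measure_translation using M that by (intro measure_sector_ang)
  have disjS: "disjoint_family_on (S \<rho>) {..<M}" for \<rho>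
    using sector_ang_disjoint[OF M(2), of \<rho> a] unfolding disjoint_family_on_def S_def
    by (metis image_Int image_empty inj_on_add)
  define D where "D j = E \<inter> S Rmax j" for j
  have mD: "D j \<in> lmeasurable" for j unfolding D_def using mS E_lmeasurable by (simp add: fmeasurable.Int)
  have disjD: "disjoint_family_on D {..<M}"
    using disjS[of Rmax] unfolding disjoint_family_on_def D_def by blast
  have cov: "(\<Union>j<M. D j) = E - {c}"
  proof (intro set_eqI iffI)
    fix y assume "y \<in> (\<Union>j<M. D j)"
    then show "y \<in> E - {c}" by (auto simp: D_def S_def sector_def)
  next
    fix y assume y: "y \<in> E - {c}"
    then have yc: "y \<in> closure E" using closure_subset by blast
    obtain \<phi> \<rho> where p: "a \<le> \<phi>" "\<phi> < a + 2*pi" "0 \<le> \<rho>" "\<rho> \<le> radial \<phi>" "y = c + \<rho> *\<^sub>R dir \<phi>"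
      using polar_closure[OF yc] by blast
    have "\<phi> \<in> (\<Union>j<M. {ang a M j..<ang a M (Suc j)})" unfolding ang_cover[OF M(2)] ang_M[OF M(2)] using p by auto
    then obtain j where j: "j < M" "\<phi> \<in> {ang a M j..<ang a M (Suc j)}" by auto
    have "0 < \<rho>" using p y by (cases "\<rho> = 0") auto
    moreover have "\<rho> \<le> Rmax" using p(4) radial_le_Rmax order_trans by blast
    ultimately have "\<rho> *\<^sub>R dir \<phi> \<in> sector Rmax (ang a M j) (ang a M (Suc j))" unfolding sector_def using j by auto
    then have "y \<in> D j" using y p(5) by (auto simp: D_def S_def)
    then show "y \<in> (\<Union>j<M. D j)" using j by blast
  qed
  have "area E = measure lebesgue (E - {c})"
    unfolding area_def using fmeasurableD[OF E_lmeasurable] by (intro measure_Diff_null_set[symmetric]) auto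
  also have "\<dots> = (\<Sum>j<M. measure lebesgue (D j))"
    unfolding cov[symmetric] using mD fmeasurableD2[OF mD]
    by (intro measure_finite_Union disjD) (auto simp: fmeasurableD)
  finally have areaD: "area E = (\<Sum>j<M. measure lebesgue (D j))" .
  have piM: "0 < pi / real M" using M by simp
  have step: "\<bar>measure lebesgue (D j) - pi / real M * (r j * r (Suc j))\<bar> \<le> pi / real M * ((5 * Rmax + 1) * \<omega>)" if j: "j < M" for j
  proof -
    \<comment> \<open>The radius varies by at most \<omega> over the cell; subtracting twice as much
      gives the strict inequality that membership in the open set requires.\<close>
    define lo where "lo = max 0 (r j - 2 * \<omega>)"
    have "D j \<subseteq> S (r j + \<omega>) j"
    proof
      fix y assume "y \<in> D j"
      then obtain x \<phi> where p: "y = c + x *\<^sub>R dir \<phi>" "0 < x" "ang a M j \<le> \<phi>" "\<phi> < ang a M (Suc j)" "y \<in> E"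
        by (auto simp: D_def S_def sector_def)
      have "x \<le> radial \<phi>" using p closure_subset by (intro radial_ge) auto
      also have "\<dots> \<le> r j + \<omega>" using rdiff[OF j, of \<phi>] p by auto
      finally show "y \<in> S (r j + \<omega>) j" using p by (auto simp: S_def sector_def)
    qed
    then have "measure lebesgue (D j) \<le> measure lebesgue (S (r j + \<omega>) j)"
      using mD mS by (intro measure_mono_fmeasurable) (auto simp: fmeasurableD)
    also have "\<dots> = pi / real M * (r j + \<omega>)\<^sup>2" using r[of j] w0 by (intro valS) linarith
    finally have up: "measure lebesgue (D j) \<le> pi / real M * (r j + \<omega>)\<^sup>2" .
    have "S lo j \<subseteq> D j"
    proof
      fix y assume "y \<in> S lo j"
      then obtain x \<phi> where p: "y = c + x *\<^sub>R dir \<phi>" "0 < x" "x \<le> lo" "ang a M j \<le> \<phi>" "\<phi> < ang a M (Suc j)"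
        by (auto simp: S_def sector_def)
      have x: "x \<le> r j - 2 * \<omega>" using p by (auto simp: lo_def)
      have "radial \<phi> \<ge> r j - \<omega>" using rdiff[OF j, of \<phi>] p by auto
      have "y \<in> E"
      \<comment> \<open>With \<omega> equal to 0 consecutive boundary points would coincide, against
        injectivity.\<close>
      proof (cases "\<omega> = 0")
        case True
        have "norm (bdry (ang a M j) - bdry (ang a M (Suc j))) \<le> 0"
          using cell_dist[OF mesh j, of "ang a M j" "ang a M (Suc j)"] ang_lt(1)[OF mesh, of j] True by simp
        then have "bdry (ang a M j) = bdry (ang a M (Suc j))" by simp
        then have "ang a M j = ang a M (Suc j)"
          using ang_lt[OF mesh, of j] by (intro bdry_inj) auto
        then show ?thesis using ang_lt(1)[OF mesh, of j] by simp
      next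
        case False
        then have "x < radial \<phi>" using x \<open>radial \<phi> \<ge> r j - \<omega>\<close> w0 by linarith
        then show ?thesis unfolding p(1) using p(2) by (intro radial_mem) auto
      qed
      moreover have "x \<le> Rmax" using x r(2)[of j] w0 by linarith
      ultimately show "y \<in> D j" using p by (auto simp: D_def S_def sector_def)
    qed
    then have "measure lebesgue (S lo j) \<le> measure lebesgue (D j)"
      using mD mS by (intro measure_mono_fmeasurable) (auto simp: fmeasurableD)
    moreover have "measure lebesgue (S lo j) = pi / real M * lo\<^sup>2" by (intro valS) (simp add: lo_def)
    ultimately have dn: "pi / real M * lo\<^sup>2 \<le> measure lebesgue (D j)" by simp
    have prod: "\<bar>r j * r (Suc j) - (r j)\<^sup>2\<bar> \<le> Rmax * \<omega>"
    proof -
      have "r j * r (Suc j) - (r j)\<^sup>2 = r j * (r (Suc j) - r j)" by (simp add: power2_eq_square algebra_simps)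
      moreover have "\<bar>r (Suc j) - r j\<bar> \<le> \<omega>"
        using rdiff[OF j, of "ang a M (Suc j)"] ang_lt(1)[OF mesh, of j] by (simp add: r_def)
      ultimately show ?thesis using r[of j] by (auto simp: abs_mult intro!: mult_mono)
    qed
    have rw: "r j * \<omega> \<le> Rmax * \<omega>" "0 \<le> r j * \<omega>" using r[of j] w0 by (auto intro: mult_right_mono)
    have ww: "\<omega>\<^sup>2 \<le> \<omega>" "0 \<le> \<omega>\<^sup>2" using w w0 by (auto simp: power2_eq_square mult_left_le)
    have "(r j + \<omega>)\<^sup>2 = (r j)\<^sup>2 + 2 * (r j * \<omega>) + \<omega>\<^sup>2" by (simp add: power2_eq_square algebra_simps)
    then have u: "(r j + \<omega>)\<^sup>2 \<le> r j * r (Suc j) + (5 * Rmax + 1) * \<omega>"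
      using prod rw ww by (simp add: algebra_simps abs_le_iff)
    have "(r j - 2 * \<omega>)\<^sup>2 = (r j)\<^sup>2 - 4 * (r j * \<omega>) + 4 * \<omega>\<^sup>2" by (simp add: power2_eq_square algebra_simps)
    moreover have "(r j)\<^sup>2 - 4 * (r j * \<omega>) = r j * (r j - 4 * \<omega>)" by (simp add: power2_eq_square algebra_simps)
    moreover have "r j * (r j - 4 * \<omega>) \<le> 0" if "r j < 2 * \<omega>" using that r[of j] w0 by (intro mult_nonneg_nonpos) auto
    ultimately have "(r j)\<^sup>2 - 4 * (r j * \<omega>) \<le> lo\<^sup>2" using ww by (auto simp: lo_def max_def)
    then have l: "r j * r (Suc j) - (5 * Rmax + 1) * \<omega> \<le> lo\<^sup>2"
      using prod rw w0 by (simp add: algebra_simps abs_le_iff)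
    have "pi / real M * (r j + \<omega>)\<^sup>2 \<le> pi / real M * (r j * r (Suc j) + (5 * Rmax + 1) * \<omega>)"
      using u piM by (intro mult_left_mono) auto
    moreover have "pi / real M * (r j * r (Suc j) - (5 * Rmax + 1) * \<omega>) \<le> pi / real M * lo\<^sup>2"
      using l piM by (intro mult_left_mono) auto
    ultimately show ?thesis using up dn by (simp only: distrib_left right_diff_distrib abs_le_iff) linarith
  qed
  have "\<bar>\<Sum>j<M. measure lebesgue (D j) - pi / real M * (r j * r (Suc j))\<bar> \<le> (\<Sum>j<M. pi / real M * ((5 * Rmax + 1) * \<omega>))"
    using step by (intro order_trans[OF sum_abs] sum_mono) auto
  also have "\<dots> = pi * (5 * Rmax + 1) * \<omega>" using M by simp
  finally show ?thesis by (simp add: areaD r_def sum_subtractf)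
qed

lemma sum_supp_len_limit: "(\<lambda>M. \<Sum>j<M. supp (nu (ang a M (Suc j))) * len a M j) \<longlonglongrightarrow> 2 * area E"
proof -
  let ?r = "\<lambda>M j. radial (ang a M j) * radial (ang a M (Suc j))"
  have "(\<lambda>M. \<Sum>j<M. pi / real M * ?r M j) \<longlonglongrightarrow> area E"
  proof (rule LIMSEQ_linear_bound)
    fix \<omega> :: real assume w: "0 < \<omega>" "\<omega> \<le> 1"
    show "\<forall>\<^sub>F M in sequentially. \<bar>(\<Sum>j<M. pi / real M * ?r M j) - area E\<bar> \<le> pi * (5 * Rmax + 1) * \<omega>"
      using eventually_mesh[OF w(1), of a]
      by eventually_elim (use area_sector_bound w(2) in \<open>auto simp: abs_minus_commute\<close>)
  qed
  \<comment> \<open>Passes from sectors, with weight \<open>pi / M\<close>, to doubled triangles,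
    with weight \<open>sin (2*pi / M)\<close>.\<close>
  moreover have "(\<lambda>M. sin (2*pi / real M) * real M / pi) \<longlonglongrightarrow> 2" by real_asymp
  ultimately have "(\<lambda>M. (sin (2*pi / real M) * real M / pi) * (\<Sum>j<M. pi / real M * ?r M j)) \<longlonglongrightarrow> 2 * area E"
    by (intro tendsto_mult)
  moreover have "\<forall>\<^sub>F M in sequentially. (sin (2*pi / real M) * real M / pi) * (\<Sum>j<M. pi / real M * ?r M j)
      = (\<Sum>j<M. ?r M j * sin (2*pi / real M))"
    using eventually_gt_at_top[of 0]
    by eventually_elim (simp add: sum_distrib_left mult.commute)
  ultimately have "(\<lambda>M. \<Sum>j<M. ?r M j * sin (2*pi / real M)) \<longlonglongrightarrow> 2 * area E"
    by (rule Lim_transform_eventually)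
  from tendsto_add[OF sum_area_limit this, of a] show ?thesis by simp
qed

section \<open>Momentum about the pole\<close>

definition momentum :: real where
  "momentum = (LINT x:frontier E|hausdorff1. (norm (x - c))\<^sup>2)"

lemma momentum_limit:
  "(\<lambda>M. \<Sum>j<M. (norm (bdry (ang a M (Suc j)) - c))\<^sup>2 * len a M j) \<longlonglongrightarrow> momentum"
  unfolding momentum_def
proof (rule integral_frontier_limit[where \<Lambda> = "2 * Rmax" and B = "Rmax\<^sup>2"])
  have n: "norm (x - c) \<le> Rmax" if "x \<in> frontier E" for x
    using norm_le_Rmax[of x] that by (simp add: frontier_def)
  show "\<bar>(norm (x - c))\<^sup>2\<bar> \<le> Rmax\<^sup>2" if "x \<in> frontier E" for x
    using n[OF that] by (simp add: power_mono)
  fix x y assume xy: "x \<in> frontier E" "y \<in> frontier E"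
  have "(norm (x - c))\<^sup>2 - (norm (y - c))\<^sup>2 = (norm (x - c) + norm (y - c)) * (norm (x - c) - norm (y - c))"
    by (simp add: power2_eq_square algebra_simps)
  moreover have "\<bar>norm (x - c) - norm (y - c)\<bar> \<le> norm (x - y)" using norm_triangle_ineq3[of "x - c" "y - c"] by simp
  ultimately show "\<bar>(norm (x - c))\<^sup>2 - (norm (y - c))\<^sup>2\<bar> \<le> 2 * Rmax * norm (x - y)"
    using n[OF xy(1)] n[OF xy(2)] Rmax(1) by (auto simp: abs_mult intro!: mult_mono)
qed (intro continuous_intros)

text \<open>The mean of the support function, which is also the radius of the disc with the same
  perimeter.\<close>

definition mrad :: real where "mrad = perim / (2 * pi)"

text \<open>The excess of the momentum splits into two nonnegative parts: one along the normal angle, one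
  along arc length. The second is left as a limit of sums.\<close>

lemma momentum_identity:
  "(\<lambda>M. \<Sum>j<M. (supp (nu (ang a M (Suc j))) - mrad)\<^sup>2 * len a M j) \<longlonglongrightarrow>
     2 * (momentum - area E * perim / pi) - integral {0..2*pi} (\<lambda>s. (supp s - mrad)\<^sup>2 * (supp s + 2 * mrad))"
proof -
  let ?H = "\<lambda>M j. supp (nu (ang a M (Suc j)))"
  let ?I3 = "integral {0..2*pi} (\<lambda>s. supp s ^ 3)"
  \<comment> \<open>The two sums in the first bracket differ by half the sum of
    \<open>h^2 ds\<close>; with the sums of \<open>h ds\<close> and \<open>ds\<close> this assembles
    the square of \<open>h - mrad\<close>.\<close>
  have L: "(\<lambda>M. 2 * ((\<Sum>j<M. (norm (bdry (ang a M (Suc j)) - c))\<^sup>2 * len a M j)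
       - (\<Sum>j<M. ((norm (bdry (ang a M (Suc j)) - c))\<^sup>2 - (?H M j)\<^sup>2 / 2) * len a M j))
       - 2 * mrad * (\<Sum>j<M. ?H M j * len a M j) + mrad\<^sup>2 * (\<Sum>j<M. len a M j))
     \<longlonglongrightarrow> 2 * (momentum - ?I3 / 2) - 2 * mrad * (2 * area E) + mrad\<^sup>2 * perim"
    by (intro tendsto_intros momentum_limit sum_cubic_limit sum_supp_len_limit sum_len_limit)
  have S: "2 * ((\<Sum>j<M. (norm (bdry (ang a M (Suc j)) - c))\<^sup>2 * len a M j)
       - (\<Sum>j<M. ((norm (bdry (ang a M (Suc j)) - c))\<^sup>2 - (?H M j)\<^sup>2 / 2) * len a M j))
       - 2 * mrad * (\<Sum>j<M. ?H M j * len a M j) + mrad\<^sup>2 * (\<Sum>j<M. len a M j)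
     = (\<Sum>j<M. (?H M j - mrad)\<^sup>2 * len a M j)" for M
    by (simp add: sum_distrib_left flip: sum_subtractf sum.distrib)
       (intro sum.cong refl, simp add: power2_eq_square algebra_simps)
  have I: "integral {0..2*pi} (\<lambda>s. (supp s - mrad)\<^sup>2 * (supp s + 2 * mrad)) = ?I3 - mrad\<^sup>2 * perim"
  proof -
    have i: "(\<lambda>s. supp s ^ 3) integrable_on {0..2*pi}" "supp integrable_on {0..2*pi}"
      by (intro integrable_continuous_real continuous_intros continuous_supp)+
    \<comment> \<open>The weight \<open>h + 2 * mrad\<close> makes the expansion a cubic without
      quadratic term, so only the integrals of \<open>h^3\<close> and \<open>h\<close>
      occur.\<close>
    have "integral {0..2*pi} (\<lambda>s. (supp s - mrad)\<^sup>2 * (supp s + 2 * mrad))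
        = integral {0..2*pi} (\<lambda>s. (supp s ^ 3 - 3 * mrad\<^sup>2 * supp s) + 2 * mrad ^ 3)"
      by (intro integral_cong) (simp add: power2_eq_square power3_eq_cube algebra_simps)
    also have "\<dots> = (?I3 - 3 * mrad\<^sup>2 * perim) + 2 * pi * (2 * mrad ^ 3)"
      using has_integral_const_real[of "2 * mrad ^ 3" 0 "2*pi"] i[THEN integrable_integral]
      by (intro integral_unique has_integral_add has_integral_diff has_integral_mult_right)
         (simp_all add: perim_def)
    also have "2 * pi * (2 * mrad ^ 3) = 2 * mrad\<^sup>2 * perim"
      by (simp add: mrad_def power2_eq_square power3_eq_cube)
    finally show ?thesis by simp
  qed
  have A: "2 * mrad * (2 * area E) = 2 * (area E * perim / pi)" by (simp add: mrad_def)
  have R: "2 * (momentum - ?I3 / 2) - 2 * mrad * (2 * area E) + mrad\<^sup>2 * perim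
     = 2 * (momentum - area E * perim / pi) - integral {0..2*pi} (\<lambda>s. (supp s - mrad)\<^sup>2 * (supp s + 2 * mrad))"
    unfolding I A right_diff_distrib by linarith
  from L show ?thesis unfolding S R .
qed

end

section \<open>Hausdorff asymmetry and lower bounds for the excess\<close>

text \<open>A lower bound on an infimum of reals needs a nonempty set. Twice the radius of a common
  ball is admissible.\<close>

lemma hausdorff_distance_witness:
  fixes A B :: "(real^2) set"
  assumes "A \<noteq> {}" "B \<noteq> {}" "bounded A" "bounded B"
  shows "{\<epsilon>. 0 < \<epsilon> \<and> A \<subseteq> B + ball 0 \<epsilon> \<and> B \<subseteq> A + ball 0 \<epsilon>} \<noteq> {}"
proof -
  obtain x y where xy: "x \<in> A" "y \<in> B" using assms by blast
  have "bounded (A \<union> B)" using assms by simp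
  then obtain e where e: "A \<union> B \<subseteq> ball x e" using bounded_subset_ballD by blast
  have sub: "S \<subseteq> T + ball 0 (2 * e)" if "S \<subseteq> A \<union> B" "p \<in> T" "p \<in> A \<union> B" for S T p
  proof
    fix z assume "z \<in> S"
    then have "z \<in> ball x e" "p \<in> ball x e" using that e by blast+
    then have "dist z p < 2 * e" using dist_triangle3[of z p x] unfolding mem_ball by linarith
    then have "z - p \<in> ball 0 (2 * e)" by (simp add: dist_norm norm_minus_commute)
    then have "p + (z - p) \<in> T + ball 0 (2 * e)" using that(2) by (intro set_plus_intro)
    then show "z \<in> T + ball 0 (2 * e)" by simp
  qed
  have "x \<in> ball x e" using e xy(1) by blast
  then have "0 < e" by simp
  then show ?thesis using sub[of A y B] sub[of B x A] xy by (auto intro!: exI[of _ "2 * e"])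
qed

lemma hausdorff_distance_nonneg:
  fixes A B :: "(real^2) set"
  assumes "A \<noteq> {}" "B \<noteq> {}" "bounded A" "bounded B"
  shows "0 \<le> hausdorff_distance A B"
  unfolding hausdorff_distance_def using hausdorff_distance_witness[OF assms]
  by (intro cInf_greatest) auto

lemma ball_convex_domain: "R > 0 \<Longrightarrow> convex_domain (ball x R) x"
  by unfold_locales auto

lemma supp_ball:
  assumes "R > 0" shows "convex_domain.supp (ball x R) x \<theta> = R"
proof -
  interpret convex_domain "ball x R" x by (rule ball_convex_domain[OF assms])
  show ?thesis
  proof (rule antisym)
    show "supp \<theta> \<le> R"
    proof (rule supp_le)
      fix y assume "y \<in> closure (ball x R)"
      then have "norm (y - x) \<le> R" using assms by (simp add: dist_norm norm_minus_commute)
      then show "(y - x) \<bullet> dir \<theta> \<le> R" using inner_dir_le_norm[of "y - x" \<theta>] by linarith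
    qed
    have "x + R *\<^sub>R dir \<theta> \<in> closure (ball x R)" using assms by (simp add: dist_norm)
    from supp_ge[OF this, of \<theta>] show "R \<le> supp \<theta>" by (simp add: inner_dir_dir)
  qed
qed

lemma perim_ball:
  assumes "R > 0" shows "convex_domain.perim (ball x R) x = 2 * pi * R"
proof -
  interpret convex_domain "ball x R" x by (rule ball_convex_domain[OF assms])
  have "supp = (\<lambda>_. R)" using supp_ball[OF assms] by (simp add: fun_eq_iff)
  then show ?thesis by (simp add: perim_def)
qed

lemma perimeter_ball: "R > 0 \<Longrightarrow> perimeter (ball x R) = 2 * pi * R"
  by (rule trans[OF convex_domain.perimeter_eq[OF ball_convex_domain] perim_ball])

context convex_domain
begin

lemma area_pos: "area E > 0"
proof -
  have "measure lebesgue E \<noteq> 0"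
    using openE cE E_lmeasurable negligible_iff_measure[of E] open_not_negligible[OF openE] by blast
  then show ?thesis by (simp add: area_def less_le)
qed

lemma boundary_momentum_origin: "c = 0 \<Longrightarrow> boundary_momentum E = momentum"
  unfolding boundary_momentum_def momentum_def by simp

end

text \<open>For the unit disc \<open>supp\<close> and \<open>mrad\<close> are both 1, so both parts
  of the excess vanish; the ratio follows without computing area or momentum.\<close>

lemma weinstock_ratio_ball: "weinstock_ratio (ball 0 1) = 1 / pi"
proof -
  interpret convex_domain "ball 0 1" 0 by (rule ball_convex_domain) simp
  have s: "supp \<theta> = 1" for \<theta> by (rule supp_ball) simp
  have p: "perim = 2 * pi" using perim_ball[of 1 0] by simp
  have m: "mrad = 1" by (simp add: mrad_def p)
  have "(\<lambda>M::nat. 0::real) \<longlonglongrightarrow> 2 * (momentum - area (ball 0 1) * perim / pi)"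
    using momentum_identity[of 0] by (simp add: s m)
  then have "momentum = area (ball 0 1) * perim / pi" using LIMSEQ_unique[OF tendsto_const] by force
  moreover have "boundary_momentum (ball 0 1) = momentum" by (rule boundary_momentum_origin) (rule refl)
  moreover have "perimeter (ball 0 1) = perim" by (rule perimeter_eq)
  ultimately show ?thesis unfolding weinstock_ratio_def using area_pos perim_pos by simp
qed

context convex_domain
begin

text \<open>One inclusion splits \<open>y - c\<close> in the ratio \<open>m\<close> to \<epsilon>.
  For the other, a point of the disc outside the enlarged \<open>E\<close> would be cut off by a
  half-plane, and in its normal direction \<open>supp\<close> would fall below
  \<open>m - t\<close>.\<close>

lemma hausdorff_distance_ball_le:
  assumes "0 < m" "0 \<le> t" "\<And>\<theta>. \<bar>supp \<theta> - m\<bar> \<le> t"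
  shows "hausdorff_distance E (ball c m) \<le> t"
proof (rule dense_ge)
  fix \<epsilon> assume e: "t < \<epsilon>"
  have "E \<subseteq> ball c m + ball 0 \<epsilon>"
  proof
    fix y assume y: "y \<in> E"
    obtain \<phi> where p: "y - c = norm (y - c) *\<^sub>R dir \<phi>" using dir_polar[of 0 "y - c"] by blast
    have "norm (y - c) = (y - c) \<bullet> dir \<phi>" by (subst (2) p) (simp add: inner_dir_dir)
    also have "\<dots> \<le> supp \<phi>" using y closure_subset by (intro supp_ge) auto
    also have "\<dots> < m + \<epsilon>" using assms(3)[of \<phi>] e by (simp add: abs_le_iff)
    finally have n: "norm (y - c) < m + \<epsilon>" .
    have me: "m + \<epsilon> > 0" using assms(1,2) e by simp
    define u where "u = (1 / (m + \<epsilon>)) *\<^sub>R (y - c)"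
    have u: "norm u < 1" unfolding u_def norm_scaleR using n me by simp
    have "c + m *\<^sub>R u \<in> ball c m" "\<epsilon> *\<^sub>R u \<in> ball 0 \<epsilon>"
      using u assms(1,2) e by (simp_all add: dist_norm)
    then have "(c + m *\<^sub>R u) + \<epsilon> *\<^sub>R u \<in> ball c m + ball 0 \<epsilon>" by (intro set_plus_intro)
    moreover have "(c + m *\<^sub>R u) + \<epsilon> *\<^sub>R u = c + (m + \<epsilon>) *\<^sub>R u" by (simp add: scaleR_add_left)
    ultimately show "y \<in> ball c m + ball 0 \<epsilon>" using me by (simp add: u_def)
  qed
  moreover have "ball c m \<subseteq> E + ball 0 \<epsilon>"
  proof (rule ccontr)
    assume "\<not> ?thesis"
    then obtain z where z: "z \<in> ball c m" "z \<notin> E + ball 0 \<epsilon>" by blast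
    have "convex (E + ball 0 \<epsilon>)" using convexE by (intro convex_set_plus) auto
    moreover have "c + 0 \<in> E + ball 0 \<epsilon>" using cE e assms(2) by (intro set_plus_intro) auto
    then have "E + ball 0 \<epsilon> \<noteq> {}" by blast
    ultimately obtain a b where ab: "a \<noteq> 0" "\<And>x. x \<in> E + ball 0 \<epsilon> \<Longrightarrow> a \<bullet> x \<le> b" "b \<le> a \<bullet> z"
      using separating_hyperplane_sets[of "E + ball 0 \<epsilon>" "{z}"] z(2) by auto
    obtain \<theta> where th: "a = norm a *\<^sub>R dir \<theta>" using dir_polar[of 0 a] by blast
    have le: "x \<bullet> dir \<theta> \<le> z \<bullet> dir \<theta>" if "x \<in> E + ball 0 \<epsilon>" for x
    proof -
      have "a \<bullet> x \<le> a \<bullet> z" using ab(2)[OF that] ab(3) by linarith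
      then have "norm a * (dir \<theta> \<bullet> x) \<le> norm a * (dir \<theta> \<bullet> z)" using th by (metis inner_scaleR_left)
      then show ?thesis using ab(1) by (simp add: inner_commute)
    qed
    define w where "w = (t + \<epsilon>) / 2"
    have w: "t < w" "0 < w" "w < \<epsilon>" using e assms(2) by (auto simp: w_def)
    have "closure E \<subseteq> {x. dir \<theta> \<bullet> x \<le> z \<bullet> dir \<theta> - w}"
    proof (intro closure_minimal closed_halfspace_le subsetI CollectI)
      fix x assume "x \<in> E"
      moreover have "w *\<^sub>R dir \<theta> \<in> ball 0 \<epsilon>" using w by simp
      ultimately have "x + w *\<^sub>R dir \<theta> \<in> E + ball 0 \<epsilon>" by (intro set_plus_intro)
      from le[OF this] show "dir \<theta> \<bullet> x \<le> z \<bullet> dir \<theta> - w"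
        by (simp add: inner_add_left inner_dir_dir inner_commute[of "dir \<theta>"])
    qed
    then have "supp \<theta> \<le> (z - c) \<bullet> dir \<theta> - w"
      by (intro supp_le) (auto simp: inner_diff_left inner_commute[of "dir \<theta>"])
    moreover have "(z - c) \<bullet> dir \<theta> < m"
      using inner_dir_le_norm[of "z - c" \<theta>] z(1) by (simp add: dist_norm norm_minus_commute)
    ultimately show False using assms(3)[of \<theta>] w by (simp add: abs_le_iff)
  qed
  ultimately show "hausdorff_distance E (ball c m) \<le> \<epsilon>"
    unfolding hausdorff_distance_def using e assms(2) by (intro cInf_lower bdd_belowI[of _ 0]) auto
qed

lemma mrad_pos: "mrad > 0" using perim_pos by (simp add: mrad_def)

lemma perim_mrad: "perim = 2 * pi * mrad" by (simp add: mrad_def)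

lemma asymmetry_element_nonneg:
  assumes "z \<in> {hausdorff_distance E (ball x R) / R | x R. 0 < R \<and> perimeter (ball x R) = perimeter E}"
  shows "0 \<le> z"
proof -
  obtain x R where z: "z = hausdorff_distance E (ball x R) / R" "0 < R" using assms by blast
  have "0 \<le> hausdorff_distance E (ball x R)" using cE boundedE z(2) by (intro hausdorff_distance_nonneg) auto
  then show ?thesis using z by simp
qed

lemma asymmetry_le:
  assumes "0 \<le> t" "\<And>\<theta>. \<bar>supp \<theta> - mrad\<bar> \<le> t"
  shows "hausdorff_asymmetry E \<le> t / mrad"
proof -
  have "perimeter (ball c mrad) = perimeter E" using mrad_pos by (simp add: perimeter_ball perimeter_eq perim_mrad)
  then have "hausdorff_asymmetry E \<le> hausdorff_distance E (ball c mrad) / mrad"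
    unfolding hausdorff_asymmetry_def using mrad_pos asymmetry_element_nonneg
    by (intro cInf_lower bdd_belowI[of _ 0]) blast+
  also have "\<dots> \<le> t / mrad" using hausdorff_distance_ball_le[OF mrad_pos assms] mrad_pos by (simp add: divide_right_mono)
  finally show ?thesis .
qed

lemma asymmetry_ge:
  assumes "\<And>x \<epsilon>. \<epsilon> > 0 \<Longrightarrow> E \<subseteq> ball x mrad + ball 0 \<epsilon> \<Longrightarrow> ball x mrad \<subseteq> E + ball 0 \<epsilon> \<Longrightarrow> k \<le> \<epsilon>"
  shows "k / mrad \<le> hausdorff_asymmetry E"
  unfolding hausdorff_asymmetry_def
proof (rule cInf_greatest)
  have "perimeter (ball c mrad) = perimeter E" using mrad_pos by (simp add: perimeter_ball perimeter_eq perim_mrad)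
  then show "{hausdorff_distance E (ball x R) / R |x R. 0 < R \<and> perimeter (ball x R) = perimeter E} \<noteq> {}"
    using mrad_pos by blast
  fix z assume "z \<in> {hausdorff_distance E (ball x R) / R |x R. 0 < R \<and> perimeter (ball x R) = perimeter E}"
  then obtain x R where z: "z = hausdorff_distance E (ball x R) / R" "0 < R" "perimeter (ball x R) = perimeter E" by blast
  then have "R = mrad" by (simp add: perimeter_ball perimeter_eq perim_mrad)
  moreover have "k \<le> hausdorff_distance E (ball x mrad)"
    unfolding hausdorff_distance_def using assms hausdorff_distance_witness[of E "ball x mrad"] cE boundedE mrad_pos
    by (intro cInf_greatest) auto
  ultimately show "k / mrad \<le> z" using z mrad_pos by (simp add: divide_right_mono)
qed

lemma asymmetry_nonneg: "0 \<le> hausdorff_asymmetry E"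
proof -
  have "0 / mrad \<le> hausdorff_asymmetry E" by (rule asymmetry_ge) simp
  then show ?thesis by simp
qed

lemma supp_le_of_subset:
  assumes "E \<subseteq> ball x R + ball 0 \<epsilon>" shows "supp \<theta> \<le> (x - c) \<bullet> dir \<theta> + R + \<epsilon>"
proof -
  have "closure E \<subseteq> {y. dir \<theta> \<bullet> y \<le> x \<bullet> dir \<theta> + R + \<epsilon>}"
  proof (intro closure_minimal closed_halfspace_le subsetI CollectI)
    fix y assume "y \<in> E"
    then have "y \<in> ball x R + ball 0 \<epsilon>" using assms by blast
    then obtain b z where "y = b + z" "b \<in> ball x R" "z \<in> ball 0 \<epsilon>" by (rule set_plus_elim)
    then have "y = x + (b - x) + z" "norm (b - x) < R" "norm z < \<epsilon>" by (auto simp: dist_norm norm_minus_commute)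
    then show "dir \<theta> \<bullet> y \<le> x \<bullet> dir \<theta> + R + \<epsilon>"
      using inner_dir_le_norm[of "b - x" \<theta>] inner_dir_le_norm[of z \<theta>]
      by (auto simp: inner_commute[of "dir \<theta>"] inner_add_left inner_diff_left)
  qed
  then show ?thesis by (intro supp_le) (auto simp: inner_diff_left inner_commute[of "dir \<theta>"])
qed

lemma supp_ge_of_superset:
  assumes "ball x R \<subseteq> E + ball 0 \<epsilon>" "R > 0" shows "(x - c) \<bullet> dir \<theta> + R \<le> supp \<theta> + \<epsilon>"
proof -
  have "R \<le> supp \<theta> + \<epsilon> - (x - c) \<bullet> dir \<theta>"
  proof (rule dense_le_bounded[OF assms(2)])
    fix s assume "0 < s" "s < R"
    then have "x + s *\<^sub>R dir \<theta> \<in> ball x R" by (simp add: dist_norm)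
    then obtain y z where yz: "x + s *\<^sub>R dir \<theta> = y + z" "y \<in> E" "z \<in> ball 0 \<epsilon>"
      using assms(1) by (blast elim: set_plus_elim)
    have "(x + s *\<^sub>R dir \<theta> - c) \<bullet> dir \<theta> = (y - c) \<bullet> dir \<theta> + z \<bullet> dir \<theta>"
      unfolding yz(1) by (simp add: algebra_simps inner_add_left inner_diff_left)
    moreover have "(y - c) \<bullet> dir \<theta> \<le> supp \<theta>" using yz(2) closure_subset by (intro supp_ge) auto
    moreover have "z \<bullet> dir \<theta> \<le> \<epsilon>" using inner_dir_le_norm[of z \<theta>] yz(3) by auto
    moreover have "(x + s *\<^sub>R dir \<theta> - c) \<bullet> dir \<theta> = (x - c) \<bullet> dir \<theta> + s"
      by (simp add: inner_add_left inner_diff_left inner_dir_dir)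
    ultimately show "s \<le> supp \<theta> + \<epsilon> - (x - c) \<bullet> dir \<theta>" by linarith
  qed
  then show ?thesis by linarith
qed

section \<open>Lower bounds for the excess\<close>

definition excess :: real where
  "excess = 2 * (momentum - area E * perim / pi)"

definition angular :: real where
  "angular = integral {0..2*pi} (\<lambda>s. (supp s - mrad)\<^sup>2 * (supp s + 2 * mrad))"

text \<open>The slack \<open>K * \<omega>\<close> is for the cells at the ends of an arc, where the
  sampled normal says nothing.\<close>

lemma excess_ge:
  assumes "\<And>\<omega>. \<omega> > 0 \<Longrightarrow> \<forall>\<^sub>F M in sequentially. k - K * \<omega> \<le> (\<Sum>j<M. (supp (nu (ang a M (Suc j))) - mrad)\<^sup>2 * len a M j)"
  shows "k + angular \<le> excess"
proof -
  have "k - K * \<omega> \<le> excess - angular" if "\<omega> > 0" for \<omega>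
    using tendsto_lowerbound[OF momentum_identity[of a] assms[OF that]] by (simp add: excess_def angular_def)
  then have "((\<lambda>\<omega>. k - K * \<omega>) \<longlongrightarrow> k - K * 0) (at_right 0) \<Longrightarrow> k - K * 0 \<le> excess - angular"
    by (intro tendsto_upperbound[of "\<lambda>\<omega>. k - K * \<omega>" _ "at_right 0"]) (auto simp: eventually_at_right_less intro!: eventually_at_rightI[of 0 1])
  moreover have "((\<lambda>\<omega>. k - K * \<omega>) \<longlongrightarrow> k - K * 0) (at_right 0)" by (intro tendsto_intros)
  ultimately show ?thesis by simp
qed

lemma excess_ge_angular: "angular \<le> excess"
proof -
  have "0 + angular \<le> excess"
    by (rule excess_ge[of 0 0 0]) (simp add: sum_nonneg len_def)
  then show ?thesis by simp
qed

lemma angular_ge: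
  assumes "x \<le> y" "y \<le> x + 2*pi" "0 \<le> k" "\<And>s. x \<le> s \<Longrightarrow> s \<le> y \<Longrightarrow> k \<le> \<bar>supp s - mrad\<bar>"
  shows "(y - x) * (k\<^sup>2 * (2 * mrad)) \<le> angular"
proof -
  let ?f = "\<lambda>s. (supp s - mrad)\<^sup>2 * (supp s + 2 * mrad)"
  have cont: "continuous_on S ?f" for S by (intro continuous_intros continuous_supp)
  have int: "?f integrable_on {u..v}" for u v by (rule integrable_continuous_real[OF cont])
  have nn: "0 \<le> ?f s" for s using supp_pos[of s] mrad_pos by simp
  have "(y - x) * (k\<^sup>2 * (2 * mrad)) = integral {x..y} (\<lambda>_. k\<^sup>2 * (2 * mrad))" using assms(1) by simp
  also have "\<dots> \<le> integral {x..y} ?f"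
  proof (intro integral_le int integrable_continuous_real continuous_intros)
    fix s assume "s \<in> {x..y}"
    then have "k\<^sup>2 \<le> (supp s - mrad)\<^sup>2" using assms(3,4) by (intro abs_le_square_iff[THEN iffD1]) auto
    then show "k\<^sup>2 * (2 * mrad) \<le> ?f s" using supp_pos[of s] mrad_pos by (intro mult_mono) auto
  qed
  also have "\<dots> \<le> integral {x..x + 2*pi} ?f"
    using nn assms(1,2) int by (intro integral_subset_le) auto
  also have "\<dots> = angular" unfolding angular_def using integral_supp_period[OF cont, of x] by simp
  finally show ?thesis .
qed

lemma norm_le_supp:
  assumes "\<And>\<theta>. supp \<theta> \<le> k" "y \<in> closure E" shows "norm (y - c) \<le> k"
proof -
  obtain \<phi> where p: "y - c = norm (y - c) *\<^sub>R dir \<phi>" using dir_polar[of 0 "y - c"] by blast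
  have "norm (y - c) = (y - c) \<bullet> dir \<phi>" by (subst (2) p) (simp add: inner_dir_dir)
  also have "\<dots> \<le> k" using supp_ge[OF assms(2), of \<phi>] assms(1)[of \<phi>] by linarith
  finally show ?thesis .
qed

text \<open>\<open>E\<close> lies in the disc of radius \<open>supp \<theta>\<^sub>0\<close> about
  \<open>c\<close>, so a point attaining that height has no tangential component. The cosine is the
  support function of this single point.\<close>

lemma supp_ge_cos_of_max:
  assumes "\<And>\<theta>. supp \<theta> \<le> supp \<theta>\<^sub>0" shows "supp \<theta>\<^sub>0 * cos (\<theta>\<^sub>0 - s) \<le> supp s"
proof -
  obtain y where y: "y \<in> closure E" "(y - c) \<bullet> dir \<theta>\<^sub>0 = supp \<theta>\<^sub>0" by (rule supp_attained)
  have "(norm (y - c))\<^sup>2 \<le> (supp \<theta>\<^sub>0)\<^sup>2" using norm_le_supp[OF assms y(1)] by (simp add: power_mono)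
  then have "((y - c) \<bullet> dir (\<theta>\<^sub>0 + pi/2))\<^sup>2 \<le> 0" using norm_dir_decomp[of "y - c" \<theta>\<^sub>0] y(2) by simp
  then have "(y - c) \<bullet> dir (\<theta>\<^sub>0 + pi/2) = 0" by simp
  then have "y - c = supp \<theta>\<^sub>0 *\<^sub>R dir \<theta>\<^sub>0" using dir_decomp[of "y - c" \<theta>\<^sub>0] y(2) by simp
  then show ?thesis using supp_ge[OF y(1), of s] by (simp add: inner_dir_dir)
qed

text \<open>Integrating the cosine bound over a half turn gives
  \<open>2 * supp \<theta>\<^sub>0 \<le> perim\<close>. It keeps the maximum comparable with
  \<open>mrad\<close>, however large the deviation.\<close>

lemma supp_max_le:
  assumes "\<And>\<theta>. supp \<theta> \<le> supp \<theta>\<^sub>0" shows "supp \<theta>\<^sub>0 \<le> pi * mrad"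
proof -
  let ?v = "supp \<theta>\<^sub>0 *\<^sub>R dir \<theta>\<^sub>0" and ?x = "\<theta>\<^sub>0 - pi/2" and ?y = "\<theta>\<^sub>0 + pi/2"
  have int: "supp integrable_on {u..v}" for u v by (rule integrable_continuous_real[OF continuous_supp])
  have "2 * supp \<theta>\<^sub>0 = integral {?x..?y} (\<lambda>s. ?v \<bullet> dir s)"
    by (subst integral_inner_dir) (simp_all add: inner_dir_dir)
  also have "\<dots> \<le> integral {?x..?y} supp"
    using supp_ge_cos_of_max[OF assms] by (intro integral_le int integrable_continuous_real continuous_intros) (simp add: inner_dir_dir)
  also have "\<dots> \<le> integral {?x..?x + 2*pi} supp"
    using int supp_pos by (intro integral_subset_le) (auto intro: less_imp_le)
  also have "\<dots> = perim" unfolding perim_def using integral_supp_period[of "\<lambda>x. x" ?x] continuous_supp by simp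
  finally show ?thesis by (simp add: perim_mrad)
qed

lemma excess_ge_max:
  assumes "\<And>\<theta>. supp \<theta> \<le> supp \<theta>\<^sub>0" "supp \<theta>\<^sub>0 = mrad + t" "0 < t"
  shows "mrad * t\<^sup>2 * sqrt (t / mrad) / 8 \<le> excess"
proof -
  note m = mrad_pos
  have tm: "mrad + t \<le> 4 * mrad"
  proof -
    have "pi * mrad \<le> 4 * mrad" using m pi_less_4 by (intro mult_right_mono) auto
    then show ?thesis using supp_max_le[OF assms(1)] assms(2) by linarith
  qed
  \<comment> \<open>Over this angle the cosine bound loses at most
    \<open>(mrad + t) * \<delta>^2 / 2\<close>, which is \<open>t / 2\<close>.\<close>
  define \<delta> where "\<delta> = sqrt (t / (mrad + t))"
  have d2: "\<delta>\<^sup>2 = t / (mrad + t)" using assms(3) m by (simp add: \<delta>_def)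
  have d: "0 \<le> \<delta>" "\<delta> \<le> 1" using assms(3) m by (auto simp: \<delta>_def)
  have lower: "sqrt (t / mrad) / 2 \<le> \<delta>"
  proof -
    have "sqrt (t / mrad) / 2 = sqrt (t / mrad / 4)" by (simp only: real_sqrt_divide[of "t / mrad" 4] real_sqrt_four)
    also have "\<dots> \<le> \<delta>" unfolding \<delta>_def using tm m assms(3)
      by (intro real_sqrt_le_mono) (simp add: frac_le)
    finally show ?thesis .
  qed
  have "(\<theta>\<^sub>0 + \<delta> - \<theta>\<^sub>0) * ((t/2)\<^sup>2 * (2 * mrad)) \<le> angular"
  proof (rule angular_ge)
    show "\<theta>\<^sub>0 + \<delta> \<le> \<theta>\<^sub>0 + 2 * pi" using d pi_gt3 by linarith
    fix s assume s: "\<theta>\<^sub>0 \<le> s" "s \<le> \<theta>\<^sub>0 + \<delta>"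
    have "(\<theta>\<^sub>0 - s)\<^sup>2 \<le> \<delta>\<^sup>2" using s by (intro abs_le_square_iff[THEN iffD1]) auto
    then have "(\<theta>\<^sub>0 - s)\<^sup>2 / 2 \<le> (t / (mrad + t)) / 2" unfolding d2 by (rule divide_right_mono) simp
    then have "1 - (t / (mrad + t)) / 2 \<le> cos (\<theta>\<^sub>0 - s)"
      by (rule order_trans[OF diff_left_mono cos_ge_quadratic])
    then have "(mrad + t) * (1 - (t / (mrad + t)) / 2) \<le> (mrad + t) * cos (\<theta>\<^sub>0 - s)"
      using m assms(3) by (intro mult_left_mono) auto
    also have "\<dots> \<le> supp s" using supp_ge_cos_of_max[OF assms(1), of s] assms(2) by simp
    also have "(mrad + t) * (1 - (t / (mrad + t)) / 2) = mrad + t / 2" using m assms(3) by (simp add: field_simps)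
    finally show "t / 2 \<le> \<bar>supp s - mrad\<bar>" by linarith
  qed (use d assms(3) in auto)
  moreover have "sqrt (t / mrad) / 2 * ((t/2)\<^sup>2 * (2 * mrad)) \<le> (\<theta>\<^sub>0 + \<delta> - \<theta>\<^sub>0) * ((t/2)\<^sup>2 * (2 * mrad))"
    using lower m by (intro mult_right_mono) auto
  moreover have "sqrt (t / mrad) / 2 * ((t/2)\<^sup>2 * (2 * mrad)) = mrad * t\<^sup>2 * sqrt (t / mrad) / 4"
    by (simp add: power2_eq_square)
  moreover have "0 \<le> mrad * t\<^sup>2 * sqrt (t / mrad)" using m assms(3) by simp
  ultimately show ?thesis using excess_ge_angular by linarith
qed

text \<open>At a minimum of the support function the excess is detected either by the angular
  part, when the support function stays small on a long interval of normals, or otherwise by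
  a long boundary arc whose normals lie in a short interval.\<close>

lemma excess_ge_min:
  assumes min: "\<And>\<theta>. supp \<theta>\<^sub>0 \<le> supp \<theta>" and t: "supp \<theta>\<^sub>0 = mrad - t" "0 < t"
  shows "mrad * t\<^sup>2 * sqrt (t / mrad) / 8 \<le> excess"
proof -
  note m = mrad_pos
  have tm: "t < mrad" using supp_pos[of \<theta>\<^sub>0] t by linarith
  \<comment> \<open>The angle that balances the two cases: up to constants they yield
    \<open>mrad * t^2 * \<delta>\<close> and \<open>t^3 / \<delta>\<close>.\<close>
  define \<delta> where "\<delta> = sqrt (t / mrad)"
  have d: "0 < \<delta>" "\<delta> < 1" using t m tm by (auto simp: \<delta>_def)
  have d2: "t = mrad * \<delta>\<^sup>2" using t m by (simp add: \<delta>_def)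
  show ?thesis
  proof (cases "\<exists>s\<in>{\<theta>\<^sub>0..\<theta>\<^sub>0 + \<delta>}. supp s \<ge> mrad - t/2")
    case False
    have "(\<theta>\<^sub>0 + \<delta> - \<theta>\<^sub>0) * ((t/2)\<^sup>2 * (2 * mrad)) \<le> angular"
    proof (rule angular_ge)
      show "\<theta>\<^sub>0 + \<delta> \<le> \<theta>\<^sub>0 + 2 * pi" using d pi_gt3 by linarith
      fix s assume "\<theta>\<^sub>0 \<le> s" "s \<le> \<theta>\<^sub>0 + \<delta>"
      then have "\<not> supp s \<ge> mrad - t/2" using False by auto
      then show "t / 2 \<le> \<bar>supp s - mrad\<bar>" by linarith
    qed (use d t in auto)
    moreover have "(\<theta>\<^sub>0 + \<delta> - \<theta>\<^sub>0) * ((t/2)\<^sup>2 * (2 * mrad)) = mrad * t\<^sup>2 * \<delta> / 2" by (simp add: power2_eq_square)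
    moreover have "0 \<le> mrad * t\<^sup>2 * \<delta>" using m d by simp
    ultimately show ?thesis using excess_ge_angular unfolding \<delta>_def by linarith
  next
    case True
    \<comment> \<open>Its least element is the first normal at which half of the loss is recovered;
      \<open>supp\<close> is low up to there.\<close>
    define Z where "Z = {\<theta>\<^sub>0..\<theta>\<^sub>0 + \<delta>} \<inter> {s. supp s \<ge> mrad - t/2}"
    have "closed {s. supp s \<ge> mrad - t/2}" by (intro closed_Collect_le continuous_intros continuous_supp)
    then have "compact Z" unfolding Z_def by (intro compact_Int_closed) auto
    moreover have "Z \<noteq> {}" using True by (auto simp: Z_def)
    ultimately have "\<exists>s\<in>Z. \<forall>u\<in>Z. s \<le> u" by (intro continuous_attains_inf[of Z "\<lambda>s. s", simplified])
    then obtain \<theta>\<^sub>1 where th1: "\<theta>\<^sub>1 \<in> Z" "\<And>u. u \<in> Z \<Longrightarrow> \<theta>\<^sub>1 \<le> u" by blast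
    have r1: "\<theta>\<^sub>0 \<le> \<theta>\<^sub>1" "\<theta>\<^sub>1 \<le> \<theta>\<^sub>0 + \<delta>" "supp \<theta>\<^sub>1 \<ge> mrad - t/2" using th1(1) by (auto simp: Z_def)
    have "\<theta>\<^sub>0 \<noteq> \<theta>\<^sub>1" using r1(3) t by auto
    then have lt01: "\<theta>\<^sub>0 < \<theta>\<^sub>1" using r1 by simp
    have small: "supp s \<le> mrad - t/2" if s: "\<theta>\<^sub>0 \<le> s" "s \<le> \<theta>\<^sub>1" for s
    proof -
      have "closed {s. supp s \<le> mrad - t/2}" by (intro closed_Collect_le continuous_intros continuous_supp)
      moreover have "{\<theta>\<^sub>0..<\<theta>\<^sub>1} \<subseteq> {s. supp s \<le> mrad - t/2}"
      proof
        fix u assume u: "u \<in> {\<theta>\<^sub>0..<\<theta>\<^sub>1}"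
        then have "u \<notin> Z" using th1(2)[of u] by auto
        then show "u \<in> {s. supp s \<le> mrad - t/2}" using u r1 by (auto simp: Z_def)
      qed
      ultimately have "closure {\<theta>\<^sub>0..<\<theta>\<^sub>1} \<subseteq> {s. supp s \<le> mrad - t/2}" by (intro closure_minimal)
      then show ?thesis using s lt01 by auto
    qed
    \<comment> \<open>At a minimum, \<open>supp \<theta>\<^sub>0 \<le> supp (nu \<theta>\<^sub>0)
      \<le> radial \<theta>\<^sub>0 \<le> supp \<theta>\<^sub>0\<close>, so the supporting line
      touches at the foot of the perpendicular from \<open>c\<close>.\<close>
    have n0: "normal \<theta>\<^sub>0 \<theta>\<^sub>0"
    proof -
      have n: "\<bar>nu \<theta>\<^sub>0 - \<theta>\<^sub>0\<bar> < pi/2" "supp (nu \<theta>\<^sub>0) = radial \<theta>\<^sub>0 * cos (\<theta>\<^sub>0 - nu \<theta>\<^sub>0)" using normal_nu[of \<theta>\<^sub>0] by (auto simp: normal_def)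
      have "supp \<theta>\<^sub>0 \<le> radial \<theta>\<^sub>0 * cos (\<theta>\<^sub>0 - nu \<theta>\<^sub>0)" using min[of "nu \<theta>\<^sub>0"] n by simp
      also have "\<dots> \<le> radial \<theta>\<^sub>0 * 1" using radial_frontier(1)[of \<theta>\<^sub>0] by (intro mult_left_mono) auto
      finally show ?thesis using radial_le_supp[of \<theta>\<^sub>0] by (simp add: normal_def)
    qed
    obtain \<phi>\<^sub>1 where n1: "normal \<phi>\<^sub>1 \<theta>\<^sub>1" by (rule normal_of_angle)
    have n1': "\<bar>\<theta>\<^sub>1 - \<phi>\<^sub>1\<bar> < pi/2" "supp \<theta>\<^sub>1 = radial \<phi>\<^sub>1 * cos (\<phi>\<^sub>1 - \<theta>\<^sub>1)" using n1 by (auto simp: normal_def)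
    have p1: "\<theta>\<^sub>0 \<le> \<phi>\<^sub>1" "\<phi>\<^sub>1 < \<theta>\<^sub>0 + pi"
    proof -
      show "\<phi>\<^sub>1 < \<theta>\<^sub>0 + pi" using n1' r1 d pi_gt3 by linarith
      show "\<theta>\<^sub>0 \<le> \<phi>\<^sub>1"
      proof (rule ccontr)
        assume "\<not> ?thesis"
        then have "\<theta>\<^sub>1 \<le> \<theta>\<^sub>0" using n1' lt01 by (intro normal_mono[OF n1 n0]) auto
        then show False using lt01 by simp
      qed
    qed
    define f where "f \<phi> = (bdry \<phi> - c) \<bullet> dir (\<theta>\<^sub>0 + pi/2)" for \<phi>
    define b where "b = f \<phi>\<^sub>1"
    have f0: "f \<theta>\<^sub>0 = 0" by (simp add: f_def bdry_inner)
    \<comment> \<open>In the frame of \<open>\<theta>\<^sub>0\<close> the touching point of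
      \<open>\<theta>\<^sub>1\<close> has height at most \<open>mrad - t\<close>, so the gain of
      \<open>t / 2\<close> must come from its tangential coordinate times the sine of a small
      angle.\<close>
    have b: "t / (2 * \<delta>) \<le> b"
    proof -
      define L where "L = \<theta>\<^sub>1 - \<theta>\<^sub>0"
      have L: "0 < L" "L \<le> \<delta>" using lt01 r1 by (auto simp: L_def)
      have L1: "L < 1" using L d by linarith
      have s: "0 \<le> sin L" "0 \<le> cos L" "sin L \<le> L" using L L1 pi_gt3 by (auto intro!: sin_ge_zero cos_ge_zero sin_x_le_x)
      have "dir \<theta>\<^sub>1 = cos L *\<^sub>R dir \<theta>\<^sub>0 + sin L *\<^sub>R dir (\<theta>\<^sub>0 + pi/2)" using dir_add[of \<theta>\<^sub>0 L] by (simp add: L_def)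
      then have "supp \<theta>\<^sub>1 = cos L * ((bdry \<phi>\<^sub>1 - c) \<bullet> dir \<theta>\<^sub>0) + sin L * b"
        using n1'(2) bdry_inner[of \<phi>\<^sub>1 \<theta>\<^sub>1] by (simp add: inner_add_right b_def f_def)
      moreover have "cos L * ((bdry \<phi>\<^sub>1 - c) \<bullet> dir \<theta>\<^sub>0) \<le> 1 * (mrad - t)"
        using supp_ge[OF bdry_closure[of \<phi>\<^sub>1], of \<theta>\<^sub>0] t tm s
        by (intro order_trans[OF mult_left_mono mult_right_mono]) auto
      ultimately have sb: "t / 2 \<le> sin L * b" using r1(3) by simp
      then have "0 < b" using s(1) t by (smt (verit) mult_nonneg_nonpos half_gt_zero)
      then have "sin L * b \<le> \<delta> * b" using s L by (intro mult_right_mono) auto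
      then show ?thesis using sb d by (simp add: field_simps)
    qed
    have p1': "\<theta>\<^sub>0 < \<phi>\<^sub>1"
    proof -
      have "0 < b" using b t d by (smt (verit) divide_pos_pos)
      then show ?thesis using p1(1) f0 by (cases "\<theta>\<^sub>0 = \<phi>\<^sub>1") (auto simp: b_def)
    qed
    \<comment> \<open>Starting one turn before \<open>\<phi>\<^sub>1\<close> makes it the last
      partition point, so the arc from \<open>\<theta>\<^sub>0\<close> can cut a cell only at its
      beginning.\<close>
    define a where "a = \<phi>\<^sub>1 - 2*pi"
    have "t\<^sup>2 / 4 * b + angular \<le> excess"
    proof (rule excess_ge)
      fix \<omega> :: real assume "\<omega> > 0"
      from eventually_mesh[OF this, of a]
      show "\<forall>\<^sub>F M in sequentially. t\<^sup>2 / 4 * b - (t\<^sup>2 / 4 * (4 * pi + 1)) * \<omega>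
          \<le> (\<Sum>j<M. (supp (nu (ang a M (Suc j))) - mrad)\<^sup>2 * len a M j)"
      proof eventually_elim
        fix M assume M: "mesh a M \<omega>"
        note M0 = M3[OF M]
        \<comment> \<open>Earlier partition points are moved to \<open>\<theta>\<^sub>0\<close>, so
          that the increments of \<open>f\<close> telescope over the arc alone.\<close>
        define \<kappa> where "\<kappa> j = max \<theta>\<^sub>0 (ang a M j)" for j
        \<comment> \<open>The last cell is excluded: its sampled normal
          \<open>nu \<phi>\<^sub>1\<close> may lie beyond \<open>\<theta>\<^sub>1\<close>. It
          contributes at most \<omega> to \<open>b\<close>.\<close>
        define J where "J = {j. j < M - 1 \<and> \<theta>\<^sub>0 < ang a M (Suc j)}"
        have fin: "finite J" "J \<subseteq> {..<M}" by (auto simp: J_def)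
        have aM: "ang a M M = \<phi>\<^sub>1" using ang_M[OF M0(2), of a] by (simp add: a_def)
        have k: "\<kappa> M = \<phi>\<^sub>1" using p1' by (simp add: \<kappa>_def aM)
        have "a \<le> \<theta>\<^sub>0" using p1(2) pi_gt_zero unfolding a_def by linarith
        then have k0: "\<kappa> 0 = \<theta>\<^sub>0" by (simp add: \<kappa>_def)
        have fd: "f y - f x \<le> norm (bdry y - bdry x)" for x y
          using inner_dir_le_norm[of "bdry y - bdry x" "\<theta>\<^sub>0 + pi/2"] by (simp add: f_def inner_diff_left abs_le_iff)
        have terms: "f (\<kappa> (Suc j)) - f (\<kappa> j) \<le> (if j \<in> J then len a M j else 0) + 2 * \<omega> * turn a M j + (if j = M - 1 then \<omega> else 0)"
          if j: "j < M" for j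
        proof (cases "ang a M (Suc j) \<le> \<theta>\<^sub>0")
          case True
          then have "\<kappa> (Suc j) = \<kappa> j" using ang_mono[of j "Suc j" a M] by (simp add: \<kappa>_def)
          then show ?thesis using omega_nonneg[OF M] turn_nonneg[OF M, of j] len_nonneg[OF M, of j] by simp
        next
          case False
          have kk: "ang a M j \<le> \<kappa> j" "\<kappa> j \<le> \<kappa> (Suc j)" "\<kappa> (Suc j) \<le> ang a M (Suc j)"
            using False ang_mono[of j "Suc j" a M] by (auto simp: \<kappa>_def)
          show ?thesis
          proof (cases "j = M - 1")
            case True
            have "f (\<kappa> (Suc j)) - f (\<kappa> j) \<le> \<omega>"
              using fd[of "\<kappa> (Suc j)" "\<kappa> j"] cell_dist[OF M j, of "\<kappa> (Suc j)" "\<kappa> j"] kk by auto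
            moreover have "0 \<le> 2 * \<omega> * turn a M j" using omega_nonneg[OF M] turn_nonneg[OF M, of j] by simp
            moreover have "j \<notin> J" using True by (simp add: J_def)
            ultimately show ?thesis using True by simp
          next
            case nl: False
            then have "j \<in> J" using j False by (auto simp: J_def)
            then show ?thesis using nl fd[of "\<kappa> (Suc j)" "\<kappa> j"] cell_dist_turn[OF M j kk] by simp
          qed
        qed
        have "b = (\<Sum>j<M. f (\<kappa> (Suc j)) - f (\<kappa> j))"
          using k k0 f0 by (simp add: sum_lessThan_telescope[of "\<lambda>j. f (\<kappa> j)"] b_def)
        also have "\<dots> \<le> (\<Sum>j<M. (if j \<in> J then len a M j else 0) + 2 * \<omega> * turn a M j + (if j = M - 1 then \<omega> else 0))"
          using terms by (intro sum_mono) auto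
        also have "\<dots> = (\<Sum>j<M. if j \<in> J then len a M j else 0) + 4 * pi * \<omega> + \<omega>"
          using M0 sum_turn[OF M0(2), of a] by (simp add: sum.distrib flip: sum_distrib_left)
        finally have bl: "b \<le> (\<Sum>j<M. if j \<in> J then len a M j else 0) + (4 * pi + 1) * \<omega>" by (simp add: algebra_simps)
        have "t\<^sup>2 / 4 * b - (t\<^sup>2 / 4 * (4 * pi + 1)) * \<omega> = t\<^sup>2 / 4 * (b - (4 * pi + 1) * \<omega>)" by (simp add: algebra_simps)
        also have "\<dots> \<le> t\<^sup>2 / 4 * (\<Sum>j<M. if j \<in> J then len a M j else 0)" using bl by (intro mult_left_mono) auto
        also have "\<dots> \<le> (\<Sum>j<M. (supp (nu (ang a M (Suc j))) - mrad)\<^sup>2 * len a M j)"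
          unfolding sum_distrib_left
        proof (rule sum_mono)
          fix j assume "j \<in> {..<M}"
          show "t\<^sup>2 / 4 * (if j \<in> J then len a M j else 0) \<le> (supp (nu (ang a M (Suc j))) - mrad)\<^sup>2 * len a M j"
          proof (cases "j \<in> J")
            case True
            define \<phi> where "\<phi> = ang a M (Suc j)"
            have "Suc j < M" using True by (auto simp: J_def)
            then have "\<phi> < \<phi>\<^sub>1" using ang_lt(1)[OF M, of "Suc j"] ang_mono[of "Suc (Suc j)" M a M] aM by (simp add: \<phi>_def)
            moreover have "\<theta>\<^sub>0 < \<phi>" using True by (simp add: J_def \<phi>_def)
            ultimately have "\<theta>\<^sub>0 \<le> nu \<phi>" "nu \<phi> \<le> \<theta>\<^sub>1"
              using p1 by (auto intro: normal_mono[OF n0 normal_nu] normal_mono[OF normal_nu n1])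
            then have "supp (nu \<phi>) \<le> mrad - t / 2" by (rule small)
            then have "(t/2)\<^sup>2 \<le> (supp (nu \<phi>) - mrad)\<^sup>2" using t by (intro abs_le_square_iff[THEN iffD1]) auto
            then have "(t/2)\<^sup>2 * len a M j \<le> (supp (nu \<phi>) - mrad)\<^sup>2 * len a M j"
              by (rule mult_right_mono[OF _ len_nonneg[OF M]])
            then show ?thesis using True by (simp add: \<phi>_def power_divide)
          qed (simp add: len_nonneg[OF M])
        qed
        finally show "t\<^sup>2 / 4 * b - (t\<^sup>2 / 4 * (4 * pi + 1)) * \<omega>
            \<le> (\<Sum>j<M. (supp (nu (ang a M (Suc j))) - mrad)\<^sup>2 * len a M j)" .
      qed
    qed
    moreover have "0 \<le> angular" using angular_ge[of 0 0 0] by simp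
    moreover have "t\<^sup>2 / 4 * (t / (2 * \<delta>)) \<le> t\<^sup>2 / 4 * b" using b by (intro mult_left_mono) auto
    moreover have "t\<^sup>2 / 4 * (t / (2 * \<delta>)) = mrad * t\<^sup>2 * \<delta> / 8"
    proof -
      have "t / (2 * \<delta>) = mrad * \<delta> / 2" using d by (subst d2) (simp add: power2_eq_square)
      then have "t\<^sup>2 / 4 * (t / (2 * \<delta>)) = t\<^sup>2 / 4 * (mrad * \<delta> / 2)" by (simp only:)
      then show ?thesis by (simp only:) simp
    qed
    ultimately show ?thesis unfolding \<delta>_def by linarith
  qed
qed

end

section \<open>Stability and sharpness\<close>

context convex_domain
begin

lemma supp_extremes:
  obtains \<theta>\<^sub>1 \<theta>\<^sub>2 where "\<And>\<theta>. supp \<theta>\<^sub>1 \<le> supp \<theta>" "\<And>\<theta>. supp \<theta> \<le> supp \<theta>\<^sub>2"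
proof -
  have red: "\<exists>\<theta>'\<in>{0..2*pi}. supp \<theta> = supp \<theta>'" for \<theta>
  proof -
    obtain \<theta>' where t: "0 \<le> \<theta>'" "\<theta>' < 0 + 2*pi" "dir \<theta> = norm (dir \<theta>) *\<^sub>R dir \<theta>'" using dir_polar[of 0 "dir \<theta>"] by blast
    then have "supp \<theta> = supp \<theta>'" by (simp add: supp_def)
    then show ?thesis using t by force
  qed
  have "\<exists>t\<in>{0..2*pi}. \<forall>s\<in>{0..2*pi}. supp t \<le> supp s"
    by (intro continuous_attains_inf continuous_supp) auto
  then obtain \<theta>\<^sub>1 where 1: "\<And>s. s \<in> {0..2*pi} \<Longrightarrow> supp \<theta>\<^sub>1 \<le> supp s" by blast
  have "\<exists>t\<in>{0..2*pi}. \<forall>s\<in>{0..2*pi}. supp s \<le> supp t"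
    by (intro continuous_attains_sup continuous_supp) auto
  then obtain \<theta>\<^sub>2 where 2: "\<And>s. s \<in> {0..2*pi} \<Longrightarrow> supp s \<le> supp \<theta>\<^sub>2" by blast
  show ?thesis using 1 2 red by (intro that[of \<theta>\<^sub>1 \<theta>\<^sub>2]) metis+
qed

lemma area_le:
  assumes "\<And>\<theta>. supp \<theta> \<le> k" shows "2 * area E \<le> k * perim"
proof (rule LIMSEQ_le[OF sum_supp_len_limit tendsto_mult_left[OF sum_len_limit]])
  show "\<exists>N. \<forall>n\<ge>N. (\<Sum>j<n. supp (nu (ang 0 n (Suc j))) * len 0 n j) \<le> k * (\<Sum>j<n. len 0 n j)"
    unfolding sum_distrib_left using assms by (intro exI allI impI sum_mono mult_right_mono) (auto simp: len_def)
qed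

lemma area_ge:
  assumes "\<And>\<theta>. k \<le> supp \<theta>" shows "k * perim \<le> 2 * area E"
proof (rule LIMSEQ_le[OF tendsto_mult_left[OF sum_len_limit] sum_supp_len_limit])
  show "\<exists>N. \<forall>n\<ge>N. k * (\<Sum>j<n. len 0 n j) \<le> (\<Sum>j<n. supp (nu (ang 0 n (Suc j))) * len 0 n j)"
    unfolding sum_distrib_left using assms by (intro exI allI impI sum_mono mult_right_mono) (auto simp: len_def)
qed

lemma momentum_stability:
  "hausdorff_asymmetry E powr (5/2) / (200 * pi\<^sup>2) \<le> momentum / (area E * perim) - 1 / pi"
proof -
  obtain \<theta>\<^sub>1 \<theta>\<^sub>2 where th: "\<And>\<theta>. supp \<theta>\<^sub>1 \<le> supp \<theta>" "\<And>\<theta>. supp \<theta> \<le> supp \<theta>\<^sub>2" by (rule supp_extremes) blast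
  note m = mrad_pos
  define t where "t = max (supp \<theta>\<^sub>2 - mrad) (mrad - supp \<theta>\<^sub>1)"
  have bd: "\<bar>supp \<theta> - mrad\<bar> \<le> t" for \<theta> using th[of \<theta>] by (auto simp: t_def abs_le_iff)
  have t0: "0 \<le> t" using bd[of 0] by linarith
  have exc: "mrad * t\<^sup>2 * sqrt (t / mrad) / 8 \<le> excess"
  proof (cases "t = 0")
    case True
    have "0 \<le> excess" using excess_ge_angular angular_ge[of 0 0 0] by simp
    then show ?thesis using True by simp
  next
    case False
    then have tp: "0 < t" using t0 by simp
    have "t = supp \<theta>\<^sub>2 - mrad \<or> t = mrad - supp \<theta>\<^sub>1" unfolding t_def max_def by simp
    then consider "t = supp \<theta>\<^sub>2 - mrad" | "t = mrad - supp \<theta>\<^sub>1" by blast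
    then show ?thesis
    proof cases
      case 1 then show ?thesis using tp by (intro excess_ge_max[OF th(2)]) auto
    next
      case 2 then show ?thesis using tp by (intro excess_ge_min[OF th(1)]) auto
    qed
  qed
  have "supp \<theta> \<le> 4 * mrad" for \<theta>
  proof -
    have "pi * mrad \<le> 4 * mrad" using m pi_less_4 by (intro mult_right_mono) auto
    then show ?thesis using supp_max_le[OF th(2)] th(2)[of \<theta>] by linarith
  qed
  then have "2 * area E \<le> 4 * mrad * perim" by (rule area_le)
  then have "area E \<le> 2 * mrad * perim" by linarith
  then have "area E * perim \<le> (2 * mrad * perim) * perim" using perim_pos by (intro mult_right_mono) auto
  also have "\<dots> = 8 * pi\<^sup>2 * mrad ^ 3" by (simp add: perim_mrad power2_eq_square power3_eq_cube)
  finally have AP: "area E * perim \<le> 8 * pi\<^sup>2 * mrad ^ 3" .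
  have APp: "0 < area E * perim" using area_pos perim_pos by simp
  have q: "0 \<le> t / mrad" using t0 m by simp
  have "hausdorff_asymmetry E powr (5/2) \<le> (t / mrad) powr (5/2)"
    using asymmetry_le[OF t0 bd] asymmetry_nonneg by (intro powr_mono2) auto
  also have "\<dots> = (t / mrad)\<^sup>2 * sqrt (t / mrad)"
  proof (cases "t = 0")
    case False
    then have "0 < t / mrad" using t0 m by simp
    then have "(t / mrad) powr (2 + 1/2) = (t / mrad) powr 2 * (t / mrad) powr (1/2)" by (rule_tac powr_add)
    then show ?thesis using q by (simp add: powr_half_sqrt powr_numeral)
  qed simp
  finally have A: "hausdorff_asymmetry E powr (5/2) \<le> (t / mrad)\<^sup>2 * sqrt (t / mrad)" .
  \<comment> \<open>128 is the product of the 8 in the bound for the excess, the 2 in its definition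
    and the 8 in \<open>AP\<close>; 200 leaves room.\<close>
  have "hausdorff_asymmetry E powr (5/2) / (200 * pi\<^sup>2) \<le> (t / mrad)\<^sup>2 * sqrt (t / mrad) / (128 * pi\<^sup>2)"
    using A q by (intro frac_le) auto
  also have "\<dots> = (mrad * t\<^sup>2 * sqrt (t / mrad) / 8) / (2 * (8 * pi\<^sup>2 * mrad ^ 3))"
    using m by (simp add: power_divide power2_eq_square power3_eq_cube mult_ac)
  also have "\<dots> \<le> (mrad * t\<^sup>2 * sqrt (t / mrad) / 8) / (2 * (area E * perim))"
    using AP APp q m t0 by (intro divide_left_mono) auto
  also have "\<dots> \<le> excess / (2 * (area E * perim))"
    using exc APp by (intro divide_right_mono) auto
  also have "\<dots> = momentum / (area E * perim) - 1 / pi"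
    using area_pos perim_pos by (simp add: excess_def field_simps)
  finally show ?thesis .
qed

section \<open>The boundary centroid\<close>

lemma linear_moment:
  "(LINT x:frontier E|hausdorff1. x \<bullet> v) = (LINT x:frontier E|hausdorff1. x $ 1) * v $ 1 + (LINT x:frontier E|hausdorff1. x $ 2) * v $ 2"
proof -
  have i: "set_integrable hausdorff1 (frontier E) (\<lambda>x. x $ k * v $ k)" for k
    by (intro set_integrable_frontier continuous_intros)
  show ?thesis unfolding inner_real2 using set_integral_add(2)[OF i i] by simp
qed

text \<open>If the centroid were outside \<open>E\<close>, a separating affine function would be
  nonnegative on the frontier with integral 0, yet positive on an arc, and arcs have positive
  length.\<close>

lemma boundary_centroid:
  obtains g where "g \<in> E" "\<And>v. (LINT x:frontier E|hausdorff1. x \<bullet> v) = perim * (g \<bullet> v)"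
proof -
  define I where "I k = (LINT x:frontier E|hausdorff1. x $ k)" for k :: 2
  define g :: "real^2" where "g = vector [I 1 / perim, I 2 / perim]"
  have g: "(LINT x:frontier E|hausdorff1. x \<bullet> v) = perim * (g \<bullet> v)" for v
    unfolding linear_moment using perim_pos by (simp add: g_def inner_real2 I_def distrib_left)
  have fb: "frontier E \<in> sets hausdorff1" using compact_frontier by (simp add: borel_compact)
  have const: "(LINT x:frontier E|hausdorff1. k) = perim * k" for k :: real
    using fb emeasure_frontier perim_pos by (subst set_integral_const) (auto simp: measure_def)
  have "g \<in> E"
  proof (rule ccontr)
    assume "g \<notin> E"
    then obtain a b where ab: "a \<noteq> 0" "\<And>x. x \<in> E \<Longrightarrow> a \<bullet> x \<le> b" "b \<le> a \<bullet> g"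
      using separating_hyperplane_sets[of E "{g}"] convexE cE by auto
    define f where "f x = a \<bullet> g - x \<bullet> a" for x
    have cf: "continuous_on UNIV f" unfolding f_def by (intro continuous_intros)
    have f0: "0 \<le> f x" if "x \<in> frontier E" for x
    proof -
      have "closure E \<subseteq> {x. a \<bullet> x \<le> b}" using ab(2) by (intro closure_minimal closed_halfspace_le) auto
      then have "a \<bullet> x \<le> b" using that by (auto simp: frontier_def)
      then show ?thesis using ab(3) by (simp add: f_def inner_commute)
    qed
    have If: "(LINT x:frontier E|hausdorff1. f x) = 0"
    proof -
      have "(LINT x:frontier E|hausdorff1. f x) = (LINT x:frontier E|hausdorff1. a \<bullet> g) - (LINT x:frontier E|hausdorff1. x \<bullet> a)"
        unfolding f_def by (intro set_integral_diff set_integrable_frontier continuous_intros)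
      then show ?thesis by (simp add: const g inner_commute)
    qed
    \<comment> \<open>Going from \<open>c\<close> against the normal \<open>a\<close> increases
      \<open>f\<close>, which is already nonnegative at \<open>c\<close>.\<close>
    obtain \<phi> where p: "- a = norm (- a) *\<^sub>R dir \<phi>" using dir_polar[of 0 "- a"] by blast
    have "f (bdry \<phi>) = a \<bullet> g - a \<bullet> c + radial \<phi> * (dir \<phi> \<bullet> (- a))"
      by (simp add: f_def bdry_def inner_add_right inner_commute[of _ a])
    also have "dir \<phi> \<bullet> (- a) = norm a" by (subst p) (simp add: inner_dir_dir)
    finally have "f (bdry \<phi>) > 0"
      using ab(1,3) ab(2)[OF cE] radial_frontier(1)[of \<phi>] by (smt (verit) mult_pos_pos zero_less_norm_iff)
    define k where "k = f (bdry \<phi>) / 2"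
    have k: "0 < k" "k < f (bdry \<phi>)" using \<open>f (bdry \<phi>) > 0\<close> by (auto simp: k_def)
    have "continuous_on UNIV (\<lambda>s. f (bdry s))"
      by (rule continuous_on_compose2[OF cf continuous_bdry]) auto
    then have "open ((\<lambda>s. f (bdry s)) -` {k<..})" by (intro open_vimage) auto
    moreover have "\<phi> \<in> (\<lambda>s. f (bdry s)) -` {k<..}" using k by simp
    ultimately obtain e where e: "e > 0" "cball \<phi> e \<subseteq> (\<lambda>s. f (bdry s)) -` {k<..}" by (meson open_contains_cball)
    \<comment> \<open>The cap at 1 keeps the arc within the range where \<open>bdry\<close> is
      injective, so its ends differ.\<close>
    define \<eta> where "\<eta> = min e 1"
    have eta: "0 < \<eta>" "\<eta> \<le> 1" "\<eta> \<le> e" using e by (auto simp: \<eta>_def)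
    define S where "S = bdry ` {\<phi>..\<phi> + \<eta>}"
    have fS: "k \<le> f x" if x: "x \<in> S" for x
    proof -
      obtain s where s: "x = bdry s" "\<phi> \<le> s" "s \<le> \<phi> + \<eta>" using x by (auto simp: S_def)
      then have "s \<in> cball \<phi> e" using eta by (simp add: dist_real_def)
      then show ?thesis using e(2) s(1) by auto
    qed
    have "compact S" "connected S" unfolding S_def
      by (auto intro!: compact_continuous_image connected_continuous_image continuous_bdry)
    then have Sb: "S \<in> sets borel" by (simp add: borel_compact)
    have Sf: "S \<subseteq> frontier E" unfolding S_def using radial_frontier(2) by auto
    have ne: "bdry \<phi> \<noteq> bdry (\<phi> + \<eta>)" using bdry_inj[of \<phi> "\<phi> + \<eta>"] eta pi_gt3 by auto
    have "ennreal (dist (bdry \<phi>) (bdry (\<phi> + \<eta>))) \<le> emeasure hausdorff1 S"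
      unfolding emeasure_hausdorff1[OF Sb] using \<open>connected S\<close> eta
      by (intro hausdorff1_outer_connected_ge) (auto simp: S_def)
    moreover have Sfin: "emeasure hausdorff1 S < \<infinity>"
    proof -
      have "emeasure hausdorff1 S \<le> emeasure hausdorff1 (frontier E)" by (intro emeasure_mono Sf fb)
      then show ?thesis unfolding emeasure_frontier by (metis ennreal_less_top infinity_ennreal_def order_le_less_trans)
    qed
    ultimately have "dist (bdry \<phi>) (bdry (\<phi> + \<eta>)) \<le> measure hausdorff1 S"
      by (simp add: emeasure_eq_ennreal_measure)
    then have mS: "0 < measure hausdorff1 S" using ne by (smt (verit) zero_less_dist_iff)
    have "measure hausdorff1 S * k = (LINT x:S|hausdorff1. k)"
      using Sb Sfin by (subst set_integral_const) auto
    also have "\<dots> \<le> (LINT x:S|hausdorff1. f x)"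
      using fS Sb Sf fb by (intro set_integral_mono set_integrable_subset[OF set_integrable_frontier] continuous_intros cf) auto
    also have "\<dots> \<le> (LINT x:frontier E|hausdorff1. f x)"
      unfolding set_lebesgue_integral_def
    proof (rule integral_mono)
      show "integrable hausdorff1 (\<lambda>x. indicat_real (frontier E) x *\<^sub>R f x)"
        using set_integrable_frontier[OF cf] by (simp add: set_integrable_def)
      show "integrable hausdorff1 (\<lambda>x. indicat_real S x *\<^sub>R f x)"
        using set_integrable_subset[OF set_integrable_frontier[OF cf] _ Sf] Sb by (simp add: set_integrable_def)
      show "indicat_real S x *\<^sub>R f x \<le> indicat_real (frontier E) x *\<^sub>R f x" for x
        using Sf f0[of x] by (auto simp: indicator_def)
    qed
    finally show False using If mS k(1) by (simp add: mult_le_0_iff)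
  qed
  then show ?thesis using that g by blast
qed

text \<open>The parallel axis theorem: when \<open>c\<close> is the centroid, the two momenta differ
  by \<open>perim * (norm c)^2\<close>.\<close>

lemma momentum_le_boundary_momentum:
  assumes "\<And>v. (LINT x:frontier E|hausdorff1. x \<bullet> v) = perim * (c \<bullet> v)"
  shows "momentum \<le> boundary_momentum E"
proof -
  have fb: "frontier E \<in> sets hausdorff1" using compact_frontier by (simp add: borel_compact)
  have const: "(LINT x:frontier E|hausdorff1. k) = perim * k" for k :: real
    using fb emeasure_frontier perim_pos by (subst set_integral_const) (auto simp: measure_def)
  have int: "set_integrable hausdorff1 (frontier E) f" if "continuous_on UNIV f" for f :: "real^2 \<Rightarrow> real"
    by (rule set_integrable_frontier[OF that])
  have e: "(norm (x - c))\<^sup>2 = ((norm x)\<^sup>2 - x \<bullet> (2 *\<^sub>R c)) + (norm c)\<^sup>2" for x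
    by (simp add: power2_norm_eq_inner inner_diff inner_commute algebra_simps)
  have "momentum = (LINT x:frontier E|hausdorff1. ((norm x)\<^sup>2 - x \<bullet> (2 *\<^sub>R c)) + (norm c)\<^sup>2)"
    unfolding momentum_def e ..
  also have "\<dots> = (LINT x:frontier E|hausdorff1. (norm x)\<^sup>2 - x \<bullet> (2 *\<^sub>R c)) + (LINT x:frontier E|hausdorff1. (norm c)\<^sup>2)"
    by (intro set_integral_add int continuous_intros)
  also have "(LINT x:frontier E|hausdorff1. (norm x)\<^sup>2 - x \<bullet> (2 *\<^sub>R c))
      = (LINT x:frontier E|hausdorff1. (norm x)\<^sup>2) - (LINT x:frontier E|hausdorff1. x \<bullet> (2 *\<^sub>R c))"
    by (intro set_integral_diff int continuous_intros)
  finally have "momentum = boundary_momentum E - perim * (norm c)\<^sup>2"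
    unfolding assms const boundary_momentum_def by (simp add: power2_norm_eq_inner)
  then show ?thesis using perim_pos by simp
qed

end

lemma deficit_lower_bound:
  assumes "E \<noteq> {}" "bounded E" "open E" "convex E"
  shows "1 / (200 * pi\<^sup>2) * hausdorff_asymmetry E powr (5/2) \<le> deficit E"
proof -
  obtain c0 where "c0 \<in> E" using assms by blast
  then interpret c0: convex_domain E c0 using assms by unfold_locales
  obtain c where c: "c \<in> E" "\<And>v. (LINT x:frontier E|hausdorff1. x \<bullet> v) = c0.perim * (c \<bullet> v)"
    by (rule c0.boundary_centroid) blast
  interpret convex_domain E c using assms c by unfold_locales
  \<comment> \<open>The two poles give different support functions, but both integrals are the
    perimeter of \<open>E\<close>.\<close>
  have "c0.perim = perim" using perimeter_eq c0.perimeter_eq by simp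
  then have "momentum \<le> boundary_momentum E" using c(2) by (intro momentum_le_boundary_momentum) simp
  then have "momentum / (area E * perim) \<le> weinstock_ratio E"
    unfolding weinstock_ratio_def perimeter_eq using area_pos perim_pos by (intro divide_right_mono) auto
  then show ?thesis using momentum_stability by (simp add: deficit_def weinstock_ratio_ball)
qed

section \<open>Sharpness: a disc with one corner\<close>

definition teardrop :: "real \<Rightarrow> (real^2) set" where
  "teardrop t = interior (convex hull (insert ((1 + t) *\<^sub>R dir 0) (cball 0 1)))"

lemma sin_ge_half: "x / 2 \<le> sin x" if "0 \<le> x" "x \<le> 1" for x :: real
proof (cases "x = 0")
  case False
  then have "0 < x" using that by simp
  then obtain z where z: "0 < z" "z < x" "sin x - sin 0 = (x - 0) * cos z"
    using MVT2[of 0 x sin cos] by (auto intro: DERIV_sin)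
  have "cos (pi/3) \<le> cos z" using z that pi_gt3 by (intro cos_monotone_0_pi_le) auto
  then have "1/2 \<le> cos z" by (simp add: cos_60)
  then have "x * (1/2) \<le> x * cos z" using that by (intro mult_left_mono) auto
  then show ?thesis using z(3) by simp
qed simp

text \<open>The bound 1/4 gives \<open>sqrt t \<le> 1/2\<close>, so the range of normals within
  \<open>4 * sqrt t\<close> of the corner fits into half a turn on either side.\<close>

locale teardrop_domain =
  fixes t :: real assumes t: "0 < t" "t \<le> 1/4"
begin

definition teardrop_hull where "teardrop_hull = convex hull (insert ((1 + t) *\<^sub>R dir 0) (cball (0::real^2) 1))"

lemma teardrop_hull_sub: "cball 0 1 \<subseteq> teardrop_hull" "(1 + t) *\<^sub>R dir 0 \<in> teardrop_hull"
  unfolding teardrop_hull_def by (meson hull_inc insertCI subsetI)+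

lemma compact_teardrop_hull: "compact teardrop_hull"
  unfolding teardrop_hull_def by (intro compact_convex_hull compact_insert compact_cball)

lemma convex_teardrop_hull: "convex teardrop_hull" unfolding teardrop_hull_def by (rule convex_convex_hull)

lemma zero_in: "0 \<in> interior teardrop_hull"
  using interior_mono[OF teardrop_hull_sub(1)] by (auto simp: interior_cball)

sublocale convex_domain "teardrop t" 0
proof
  show "bounded (teardrop t)" unfolding teardrop_def teardrop_hull_def[symmetric]
    using compact_imp_bounded[OF compact_teardrop_hull] interior_subset by (rule bounded_subset)
qed (use zero_in convex_teardrop_hull in \<open>auto simp: teardrop_def convex_interior simp flip: teardrop_hull_def\<close>)

lemma closure_teardrop: "closure (teardrop t) = teardrop_hull"
  unfolding teardrop_def teardrop_hull_def[symmetric]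
  using convex_closure_interior[OF convex_teardrop_hull] zero_in compact_imp_closed[OF compact_teardrop_hull] by auto

lemma teardrop_hull_cases:
  assumes "y \<in> teardrop_hull"
  obtains u v b where "0 \<le> u" "0 \<le> v" "u + v = 1" "norm b \<le> 1" "y = u *\<^sub>R ((1 + t) *\<^sub>R dir 0) + v *\<^sub>R b"
proof -
  have "convex hull (cball (0::real^2) 1) = cball 0 1" by (simp add: convex_hull_eq)
  then have "\<exists>u\<ge>0. \<exists>v\<ge>0. \<exists>b. b \<in> cball 0 1 \<and> u + v = 1 \<and> y = u *\<^sub>R ((1 + t) *\<^sub>R dir 0) + v *\<^sub>R b"
    using assms unfolding teardrop_hull_def by (subst (asm) convex_hull_insert) auto
  then show ?thesis using that by auto
qed

lemma supp_teardrop: "supp \<theta> = max 1 ((1 + t) * cos \<theta>)"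
proof (rule antisym)
  show "supp \<theta> \<le> max 1 ((1 + t) * cos \<theta>)"
  proof (rule supp_le)
    fix y assume "y \<in> closure (teardrop t)"
    then obtain u v b where y: "0 \<le> u" "0 \<le> v" "u + v = 1" "norm b \<le> 1" "y = u *\<^sub>R ((1 + t) *\<^sub>R dir 0) + v *\<^sub>R b"
      unfolding closure_teardrop by (rule teardrop_hull_cases)
    have "b \<bullet> dir \<theta> \<le> 1" using inner_dir_le_norm[of b \<theta>] y(4) by linarith
    then have "u * ((1 + t) * cos \<theta>) + v * (b \<bullet> dir \<theta>) \<le> u * max 1 ((1 + t) * cos \<theta>) + v * max 1 ((1 + t) * cos \<theta>)"
      using y by (intro add_mono mult_left_mono) auto
    also have "\<dots> = max 1 ((1 + t) * cos \<theta>)" using y(3) by (simp flip: distrib_right)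
    finally show "(y - 0) \<bullet> dir \<theta> \<le> max 1 ((1 + t) * cos \<theta>)"
      by (simp add: y(5) inner_add_left inner_dir_dir)
  qed
  have "dir \<theta> \<in> closure (teardrop t)" "(1 + t) *\<^sub>R dir 0 \<in> closure (teardrop t)"
    unfolding closure_teardrop using teardrop_hull_sub by auto
  from this[THEN supp_ge, of \<theta>] show "max 1 ((1 + t) * cos \<theta>) \<le> supp \<theta>"
    by (simp add: inner_dir_dir)
qed

lemma supp_bounds: "1 \<le> supp \<theta>" "supp \<theta> \<le> 1 + t"
proof -
  have "(1 + t) * cos \<theta> \<le> (1 + t) * 1" using t by (intro mult_left_mono) auto
  then show "1 \<le> supp \<theta>" "supp \<theta> \<le> 1 + t" using t by (auto simp: supp_teardrop)
qed

lemma sqrt_le_half: "sqrt t \<le> 1/2"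
  using t real_sqrt_le_mono[of t "1/4"] by (simp add: real_sqrt_divide)

text \<open>The corner is visible only from normals within order \<open>sqrt t\<close> of its own
  direction; beyond, the disc is higher. The factor 4 is generous.\<close>

lemma supp_eq_1_of_far:
  assumes "4 * sqrt t \<le> \<bar>\<theta>\<bar>" "\<bar>\<theta>\<bar> \<le> pi" shows "supp \<theta> = 1"
proof -
  \<comment> \<open>Half the threshold, for the double angle formula:
    \<open>cos (2 * x) \<le> 1 - x^2 / 2\<close>, which is \<open>1 - 2 * t\<close>, and
    \<open>(1 + t) * (1 - 2 * t) \<le> 1\<close>.\<close>
  define x where "x = 2 * sqrt t"
  have x: "0 \<le> x" "x \<le> 1" "x\<^sup>2 = 4 * t" using t sqrt_le_half by (auto simp: x_def power_mult_distrib)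
  have "cos \<bar>\<theta>\<bar> \<le> cos (2 * x)"
    using assms x pi_gt3 by (intro cos_monotone_0_pi_le) (auto simp: x_def)
  also have "\<dots> = 1 - 2 * (sin x)\<^sup>2" by (rule cos_double_sin)
  also have "\<dots> \<le> 1 - 2 * (x / 2)\<^sup>2" using sin_ge_half[OF x(1,2)] x by (simp add: power_mono)
  also have "\<dots> = 1 - 2 * t" using x(3) by (simp add: power_divide)
  finally have "(1 + t) * cos \<theta> \<le> (1 + t) * (1 - 2 * t)" using t by (intro mult_left_mono) auto
  also have "\<dots> \<le> 1" using t by (simp add: algebra_simps)
  finally show ?thesis by (simp add: supp_teardrop)
qed

lemma integral_near_bound:
  assumes "continuous_on UNIV g" "\<And>s. \<bar>s\<bar> \<le> pi \<Longrightarrow> 4 * sqrt t \<le> \<bar>s\<bar> \<Longrightarrow> g s = 0" "\<And>s. g s \<le> k"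
  shows "integral {-pi..pi} g \<le> 8 * sqrt t * k"
proof -
  define d where "d = 4 * sqrt t"
  have d: "0 \<le> d" "d \<le> pi" using t sqrt_le_half pi_gt3 by (auto simp: d_def)
  have int: "g integrable_on {a..b}" for a b
    by (intro integrable_continuous_real continuous_on_subset[OF assms(1)]) auto
  have z: "g s = 0" if "\<bar>s\<bar> \<le> pi" "d \<le> \<bar>s\<bar>" for s using assms(2) that by (simp add: d_def)
  have "integral {-pi..-d} g = integral {-pi..-d} (\<lambda>_. 0)" using d by (intro integral_cong z) auto
  moreover have "integral {d..pi} g = integral {d..pi} (\<lambda>_. 0)" using d by (intro integral_cong z) auto
  moreover have "integral {-d..d} g \<le> integral {-d..d} (\<lambda>_. k)"
    using assms(3) by (intro integral_le int integrable_continuous_real continuous_intros) auto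
  moreover have "integral {-pi..pi} g = integral {-pi..-d} g + integral {-d..pi} g"
    using d by (intro Henstock_Kurzweil_Integration.integral_combine[symmetric] int) auto
  moreover have "integral {-d..pi} g = integral {-d..d} g + integral {d..pi} g"
    using d by (intro Henstock_Kurzweil_Integration.integral_combine[symmetric] int) auto
  ultimately show ?thesis using d by (simp add: d_def)
qed

lemma integral_supp_sym:
  assumes "continuous_on UNIV (\<lambda>x. F (supp x))"
  shows "integral {0..2*pi} (\<lambda>s. F (supp s) :: real) = integral {-pi..pi} (\<lambda>s. F (supp s))"
  using integral_supp_period[OF assms, of "-pi"] by simp

text \<open>The corner raises \<open>supp\<close> by at most \<open>t\<close> over an angle
  \<open>8 * sqrt t\<close>. Hence \<open>mrad - 1\<close> has order \<open>t powr (3/2)\<close>,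
  and its square is small against \<open>t powr (5/2)\<close>.\<close>

lemma mrad_bounds: "1 \<le> mrad" "mrad - 1 \<le> 2 * (t * sqrt t)"
proof -
  have "perim = integral {-pi..pi} supp" unfolding perim_def
    using integral_supp_sym[of "\<lambda>x. x"] continuous_supp by simp
  also have "\<dots> = integral {-pi..pi} (\<lambda>s. supp s - 1) + 2 * pi"
    by (subst integral_diff) (auto intro!: integrable_continuous_real continuous_supp)
  finally have p: "perim = integral {-pi..pi} (\<lambda>s. supp s - 1) + 2 * pi" .
  have "integral {-pi..pi} (\<lambda>s. supp s - 1) \<le> 8 * sqrt t * t"
    using supp_eq_1_of_far supp_bounds
    by (intro integral_near_bound continuous_intros continuous_supp) (auto simp: diff_le_eq add.commute)
  moreover have "0 \<le> integral {-pi..pi} (\<lambda>s. supp s - 1)"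
    using supp_bounds by (intro integral_nonneg integrable_continuous_real continuous_intros continuous_supp) auto
  ultimately have a: "2 * pi * 1 \<le> 2 * pi * mrad" "2 * pi * (mrad - 1) \<le> 8 * sqrt t * t"
    using p by (auto simp: perim_mrad algebra_simps)
  from a(1) show "1 \<le> mrad" using pi_gt_zero by simp
  then have "4 * (mrad - 1) \<le> 2 * pi * (mrad - 1)" using pi_gt3 by (intro mult_right_mono) auto
  then show "mrad - 1 \<le> 2 * (t * sqrt t)" using a(2) by simp
qed

lemma mrad_le: "mrad \<le> 1 + t"
proof -
  have "t * (2 * sqrt t) \<le> t * 1" using t sqrt_le_half by (intro mult_left_mono) auto
  then show ?thesis using mrad_bounds(2) by simp
qed

lemma supp_mrad: "\<bar>supp \<theta> - mrad\<bar> \<le> t"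
  using supp_bounds[of \<theta>] mrad_bounds(1) mrad_le by (auto simp: abs_le_iff)

lemma mrad_sq: "(mrad - 1)\<^sup>2 \<le> 4 * (t\<^sup>2 * t)"
proof -
  have "(mrad - 1)\<^sup>2 \<le> (2 * (t * sqrt t))\<^sup>2" using mrad_bounds by (intro power_mono) auto
  also have "\<dots> = 4 * (t\<^sup>2 * t)" using t by (simp add: power_mult_distrib)
  finally show ?thesis .
qed

lemma cube_le: "t\<^sup>2 * t \<le> t\<^sup>2 * sqrt t / 2"
proof -
  have "sqrt t * sqrt t \<le> sqrt t * (1/2)" using sqrt_le_half t by (intro mult_left_mono) auto
  then have "t\<^sup>2 * t \<le> t\<^sup>2 * (sqrt t / 2)" using t by (intro mult_left_mono) auto
  then show ?thesis by simp
qed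

text \<open>\<open>supp\<close> is compared with 1 instead of \<open>mrad\<close>; both lie above 1,
  so the mixed term of the square helps. The corner contributes 32, and the shift of the mean at
  most \<open>32 * pi * t^3\<close>, which is within the remaining 64.\<close>

lemma angular_teardrop: "angular \<le> 96 * (t\<^sup>2 * sqrt t)"
proof -
  let ?f = "\<lambda>s. (supp s - mrad)\<^sup>2 * (supp s + 2 * mrad)"
  have c: "continuous_on S ?f" "continuous_on S (\<lambda>s. (supp s - 1)\<^sup>2)" for S by (intro continuous_intros continuous_supp)+
  have "angular = integral {-pi..pi} ?f" unfolding angular_def using integral_supp_sym[OF c(1)] by simp
  also have "\<dots> \<le> integral {-pi..pi} (\<lambda>s. 4 * (supp s - 1)\<^sup>2 + 4 * (mrad - 1)\<^sup>2)"
  proof (intro integral_le integrable_continuous_real c continuous_intros continuous_supp)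
    fix s
    define x y where "x = supp s - 1" and "y = mrad - 1"
    have xy: "0 \<le> x" "0 \<le> y" using supp_bounds[of s] mrad_bounds by (auto simp: x_def y_def)
    have "(x - y)\<^sup>2 = x\<^sup>2 + y\<^sup>2 - 2 * (x * y)" by (simp add: power2_eq_square algebra_simps)
    then have "(supp s - mrad)\<^sup>2 \<le> x\<^sup>2 + y\<^sup>2" using xy by (simp add: x_def y_def)
    moreover have "0 \<le> supp s + 2 * mrad" "supp s + 2 * mrad \<le> 4"
      using supp_bounds[of s] mrad_bounds(1) mrad_le t by linarith+
    ultimately have "?f s \<le> (x\<^sup>2 + y\<^sup>2) * 4" by (intro mult_mono) auto
    then show "?f s \<le> 4 * (supp s - 1)\<^sup>2 + 4 * (mrad - 1)\<^sup>2" by (simp add: x_def y_def)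
  qed
  also have "\<dots> = 4 * integral {-pi..pi} (\<lambda>s. (supp s - 1)\<^sup>2) + 2 * pi * (4 * (mrad - 1)\<^sup>2)"
    using c(2) by (subst integral_add) (auto intro!: integrable_continuous_real continuous_intros continuous_supp)
  also have "\<dots> \<le> 4 * (8 * sqrt t * t\<^sup>2) + 2 * pi * (4 * (4 * (t\<^sup>2 * t)))"
  proof (intro add_mono mult_left_mono mrad_sq integral_near_bound c)
    show "(supp s - 1)\<^sup>2 = 0" if "\<bar>s\<bar> \<le> pi" "4 * sqrt t \<le> \<bar>s\<bar>" for s using supp_eq_1_of_far[OF that(2,1)] by simp
    show "(supp s - 1)\<^sup>2 \<le> t\<^sup>2" for s using supp_bounds[of s] by (intro power_mono) auto
  qed auto
  also have "\<dots> = 32 * (t\<^sup>2 * sqrt t) + 32 * (pi * (t\<^sup>2 * t))" by simp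
  also have "pi * (t\<^sup>2 * t) \<le> 4 * (t\<^sup>2 * sqrt t / 2)" using cube_le pi_less_4 t by (intro mult_mono) auto
  finally show ?thesis by linarith
qed

text \<open>Away from angle 0 a boundary point has positive weight on the disc in its convex
  combination. The corner is no higher than \<open>supp\<close>, so the disc point must reach the
  full height, which is then at most 1.\<close>

lemma corner_free:
  assumes "0 < \<phi>" "\<phi> < 2*pi" shows "supp (nu \<phi>) = 1"
proof -
  define \<theta> where "\<theta> = nu \<phi>"
  have h: "supp \<theta> = bdry \<phi> \<bullet> dir \<theta>" using normal_nu[of \<phi>] bdry_inner[of \<phi> \<theta>] by (simp add: normal_def \<theta>_def)
  obtain u v b where y: "0 \<le> u" "0 \<le> v" "u + v = 1" "norm b \<le> 1" "bdry \<phi> = u *\<^sub>R ((1 + t) *\<^sub>R dir 0) + v *\<^sub>R b"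
    using bdry_closure[of \<phi>] unfolding closure_teardrop by (rule teardrop_hull_cases)
  have "v \<noteq> 0"
  proof
    assume "v = 0"
    then have "radial \<phi> *\<^sub>R dir \<phi> = (1 + t) *\<^sub>R dir 0" using y by (simp add: bdry_def)
    then have "dir \<phi> = dir 0" using scaleR_dir_eq radial_frontier(1) t by simp
    then have "\<phi> = 0" using assms by (intro dir_inj) auto
    then show False using assms by simp
  qed
  then have vp: "0 < v" using y by simp
  have bs: "b \<bullet> dir \<theta> \<le> 1" using inner_dir_le_norm[of b \<theta>] y(4) by linarith
  have "supp \<theta> = u * ((1 + t) * cos \<theta>) + v * (b \<bullet> dir \<theta>)" unfolding h y(5) by (simp add: inner_add_left inner_dir_dir)
  also have "\<dots> \<le> u * supp \<theta> + v * (b \<bullet> dir \<theta>)" using y(1) by (intro add_right_mono mult_left_mono) (auto simp: supp_teardrop)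
  finally have "(1 - u) * supp \<theta> \<le> v * (b \<bullet> dir \<theta>)" by (simp add: left_diff_distrib)
  moreover have "1 - u = v" using y(3) by linarith
  ultimately have "v * supp \<theta> \<le> v * (b \<bullet> dir \<theta>)" by simp
  then have "supp \<theta> \<le> b \<bullet> dir \<theta>" using vp by simp
  then show ?thesis using bs supp_bounds(1)[of \<theta>] by (simp add: \<theta>_def)
qed

text \<open>Only the last cell is sampled at the corner, and its length is at most \<omega>; at
  every other sample \<open>supp\<close> is 1.\<close>

lemma excess_teardrop: "excess - angular \<le> (mrad - 1)\<^sup>2 * perim"
proof (rule field_le_epsilon)
  fix \<omega> :: real assume w: "0 < \<omega>"
  have "(\<lambda>M. (mrad - 1)\<^sup>2 * (\<Sum>j<M. len 0 M j) + \<omega>) \<longlonglongrightarrow> (mrad - 1)\<^sup>2 * perim + \<omega>"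
    by (intro tendsto_intros sum_len_limit)
  moreover have "(\<lambda>M. \<Sum>j<M. (supp (nu (ang 0 M (Suc j))) - mrad)\<^sup>2 * len 0 M j) \<longlonglongrightarrow> excess - angular"
    using momentum_identity[of 0] by (simp only: excess_def angular_def)
  moreover have "\<forall>\<^sub>F M in sequentially. (\<Sum>j<M. (supp (nu (ang 0 M (Suc j))) - mrad)\<^sup>2 * len 0 M j)
      \<le> (mrad - 1)\<^sup>2 * (\<Sum>j<M. len 0 M j) + \<omega>"
    using eventually_mesh[OF w, of 0]
  proof eventually_elim
    fix M assume M: "mesh 0 M \<omega>"
    note M0 = M3[OF M]
    have "(supp (nu (ang 0 M (Suc j))) - mrad)\<^sup>2 * len 0 M j \<le> (mrad - 1)\<^sup>2 * len 0 M j + (if j = M - 1 then \<omega> else 0)"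
      if j: "j < M" for j
    proof (cases "j = M - 1")
      case True
      have "\<bar>supp (nu (ang 0 M (Suc j))) - mrad\<bar> \<le> 1" using supp_mrad[of "nu (ang 0 M (Suc j))"] t by linarith
      then have "(supp (nu (ang 0 M (Suc j))) - mrad)\<^sup>2 \<le> 1" by (simp add: abs_square_le_1)
      then have "(supp (nu (ang 0 M (Suc j))) - mrad)\<^sup>2 * len 0 M j \<le> 1 * \<omega>"
        using len_le[OF M j] len_nonneg[OF M] by (intro mult_mono) auto
      moreover have "0 \<le> (mrad - 1)\<^sup>2 * len 0 M j" using len_nonneg[OF M] by simp
      ultimately show ?thesis using True by simp
    next
      case False
      then have "Suc j < M" using j by simp
      then have "ang 0 M (Suc j) < 2*pi" using ang_lt(1)[OF M, of "Suc j"] ang_mono[of "Suc (Suc j)" M 0 M] ang_M[OF M0(2), of 0] by simp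
      moreover have "0 < ang 0 M (Suc j)" using ang_lt(1)[OF M, of j] ang_mono[of 0 j 0 M] by simp
      ultimately have "supp (nu (ang 0 M (Suc j))) = 1" by (intro corner_free)
      then show ?thesis using False by (simp add: power2_commute)
    qed
    then have "(\<Sum>j<M. (supp (nu (ang 0 M (Suc j))) - mrad)\<^sup>2 * len 0 M j)
        \<le> (\<Sum>j<M. (mrad - 1)\<^sup>2 * len 0 M j + (if j = M - 1 then \<omega> else 0))" by (intro sum_mono) auto
    also have "\<dots> = (mrad - 1)\<^sup>2 * (\<Sum>j<M. len 0 M j) + \<omega>"
      using M0 by (simp add: sum.distrib flip: sum_distrib_left)
    finally show "(\<Sum>j<M. (supp (nu (ang 0 M (Suc j))) - mrad)\<^sup>2 * len 0 M j)
      \<le> (mrad - 1)\<^sup>2 * (\<Sum>j<M. len 0 M j) + \<omega>" .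
  qed
  ultimately show "excess - angular \<le> (mrad - 1)\<^sup>2 * perim + \<omega>"
    by (intro tendsto_le[OF trivial_limit_sequentially])
qed

lemma deficit_teardrop: "deficit (teardrop t) \<le> 4 * t powr (5/2)"
proof -
  have pr: "6 \<le> perim" "perim \<le> 10"
  proof -
    have "6 * 1 \<le> 2 * pi * mrad" using pi_gt3 mrad_bounds(1) by (intro mult_mono) auto
    then show "6 \<le> perim" by (simp add: perim_mrad)
    have "2 * pi * mrad \<le> 8 * (5/4)" using pi_less_4 mrad_bounds(1) mrad_le t by (intro mult_mono) auto
    then show "perim \<le> 10" by (simp add: perim_mrad)
  qed
  have "1 * perim \<le> 2 * area (teardrop t)" by (rule area_ge) (rule supp_bounds)
  then have "3 * 6 \<le> area (teardrop t) * perim" using pr by (intro mult_mono) auto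
  then have AP: "18 \<le> area (teardrop t) * perim" by simp
  have "(mrad - 1)\<^sup>2 * perim \<le> (4 * (t\<^sup>2 * sqrt t / 2)) * 10"
    using order_trans[OF mrad_sq mult_left_mono[OF cube_le, of 4]] pr t by (intro mult_mono) auto
  from order_trans[OF excess_teardrop this] have "excess - angular \<le> 20 * (t\<^sup>2 * sqrt t)" by linarith
  moreover have "0 \<le> t\<^sup>2 * sqrt t" using t by simp
  \<comment> \<open>\<open>96 + 20\<close> is rounded up to 144, the multiple of
    \<open>2 * 18\<close> that yields the constant 4.\<close>
  ultimately have ex: "excess \<le> 144 * (t\<^sup>2 * sqrt t)" using angular_teardrop by linarith
  have "deficit (teardrop t) = momentum / (area (teardrop t) * perim) - 1 / pi"
    unfolding deficit_def weinstock_ratio_ball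
    by (simp add: weinstock_ratio_def boundary_momentum_origin perimeter_eq)
  also have "\<dots> = excess / (2 * (area (teardrop t) * perim))"
    using area_pos perim_pos by (simp add: excess_def field_simps)
  also have "\<dots> \<le> (144 * (t\<^sup>2 * sqrt t)) / (2 * 18)"
    using ex AP t by (intro frac_le) auto
  also have "\<dots> = 4 * (t\<^sup>2 * sqrt t)" by simp
  also have "t\<^sup>2 * sqrt t = t powr (5/2)"
  proof -
    have "t powr (2 + 1/2) = t powr 2 * t powr (1/2)" by (rule powr_add)
    then show ?thesis using t by (simp add: powr_half_sqrt powr_numeral)
  qed
  finally show ?thesis .
qed

lemma asymmetry_teardrop_le: "hausdorff_asymmetry (teardrop t) \<le> 1"
proof -
  have "hausdorff_asymmetry (teardrop t) \<le> t / mrad" using t supp_mrad by (intro asymmetry_le) auto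
  also have "\<dots> \<le> 1" using t mrad_bounds(1) by simp
  finally show ?thesis .
qed

text \<open>Opposite directions eliminate the unknown centre: along the axis the width gives
  \<open>2 + t \<le> 2 * mrad + 2 * \<epsilon>\<close>, across it
  \<open>2 * mrad \<le> 2 + 2 * \<epsilon>\<close>. Together they give
  \<open>t \<le> 4 * \<epsilon>\<close>.\<close>

lemma asymmetry_teardrop_ge: "t / 8 \<le> hausdorff_asymmetry (teardrop t)"
proof -
  have "t / 8 \<le> (t / 4) / mrad" using t mrad_bounds(1) mrad_le by (simp add: field_simps)
  also have "\<dots> \<le> hausdorff_asymmetry (teardrop t)"
  proof (rule asymmetry_ge)
    fix x \<epsilon> assume e: "\<epsilon> > 0" and sub: "teardrop t \<subseteq> ball x mrad + ball 0 \<epsilon>" and sup: "ball x mrad \<subseteq> teardrop t + ball 0 \<epsilon>"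
    have d: "dir pi = - dir 0" "dir (pi/2) = - dir (-(pi/2))" using dir_add_pi[of 0] dir_add_pi[of "-(pi/2)"] by simp_all
    have "1 + t \<le> x \<bullet> dir 0 + mrad + \<epsilon>" using supp_le_of_subset[OF sub, of 0] t by (simp add: supp_teardrop)
    moreover have "1 \<le> - (x \<bullet> dir 0) + mrad + \<epsilon>" using supp_le_of_subset[OF sub, of pi] t by (simp add: supp_teardrop d)
    moreover have "x \<bullet> dir (-(pi/2)) + mrad \<le> 1 + \<epsilon>" using supp_ge_of_superset[OF sup mrad_pos, of "-(pi/2)"] by (simp add: supp_teardrop)
    moreover have "- (x \<bullet> dir (-(pi/2))) + mrad \<le> 1 + \<epsilon>" using supp_ge_of_superset[OF sup mrad_pos, of "pi/2"] by (simp add: supp_teardrop d)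
    ultimately show "t / 4 \<le> \<epsilon>" by linarith
  qed
  finally show ?thesis .
qed

lemma teardrop_props: "teardrop t \<noteq> {}" "bounded (teardrop t)" "open (teardrop t)" "convex (teardrop t)"
  using cE openE boundedE convexE by auto

end

text \<open>On teardrops the inequality would reduce to
  \<open>\<kappa> \<le> 4 * t powr \<gamma>\<close> with positive \<gamma>, which fails for small
  \<open>t\<close>.\<close>

lemma exponent_sharp:
  assumes "\<beta> < 5/2" "\<delta> > 0" "C > 0"
    and H: "\<And>E :: (real^2) set. E \<noteq> {} \<Longrightarrow> bounded E \<Longrightarrow> open E \<Longrightarrow> convex E \<Longrightarrow> deficit E \<le> \<delta> \<Longrightarrow>
            C * hausdorff_asymmetry E powr \<beta> \<le> deficit E"
  shows False
proof -
  \<comment> \<open>With a nonnegative exponent the asymmetry may be replaced by its lower bound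
    \<open>t / 8\<close>; since the asymmetry is at most 1, the power \<beta> dominates the power
    \<open>b\<close>.\<close>
  define b where "b = max \<beta> 0"
  define \<gamma> where "\<gamma> = 5/2 - b"
  have b: "\<beta> \<le> b" "0 \<le> b" "0 < \<gamma>" using assms(1) by (auto simp: b_def \<gamma>_def)
  define \<kappa> where "\<kappa> = C * (1/8) powr b"
  have \<kappa>: "0 < \<kappa>" using assms(3) by (simp add: \<kappa>_def)
  \<comment> \<open>\<open>t1\<close> keeps \<open>4 * t powr (5/2)\<close> below \<delta>, so that
    the hypothesis applies to the teardrop; \<open>t2\<close> keeps
    \<open>4 * t powr \<gamma>\<close> below half of \<kappa>.\<close>
  define t1 t2 where "t1 = (\<delta> / 4) powr (2/5)" and "t2 = (\<kappa> / 8) powr (1 / \<gamma>)"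
  define t where "t = min (1/4) (min t1 t2)"
  have tt: "0 < t" "t \<le> 1/4" "t \<le> t1" "t \<le> t2" using assms(2) \<kappa> by (auto simp: t_def t1_def t2_def)
  interpret teardrop_domain t using tt by unfold_locales
  have "t powr (5/2) \<le> t1 powr (5/2)" using tt by (intro powr_mono2) auto
  also have "\<dots> = \<delta> / 4" using assms(2) by (simp add: t1_def powr_powr)
  finally have small: "deficit (teardrop t) \<le> \<delta>" using deficit_teardrop by simp
  have "t powr \<gamma> \<le> t2 powr \<gamma>" using tt b by (intro powr_mono2) auto
  also have "\<dots> = \<kappa> / 8" using b \<kappa> by (simp add: t2_def powr_powr)
  finally have tg: "t powr \<gamma> \<le> \<kappa> / 8" .
  have "C * (t / 8) powr b \<le> C * hausdorff_asymmetry (teardrop t) powr b"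
    using asymmetry_teardrop_ge t b assms(3) by (intro mult_left_mono powr_mono2) auto
  also have "\<dots> \<le> C * hausdorff_asymmetry (teardrop t) powr \<beta>"
    using asymmetry_teardrop_ge asymmetry_teardrop_le t b assms(3) by (intro mult_left_mono powr_mono') auto
  also have "\<dots> \<le> deficit (teardrop t)" by (rule H[OF teardrop_props small])
  also have "\<dots> \<le> 4 * t powr (5/2)" by (rule deficit_teardrop)
  also have "\<dots> = (4 * t powr \<gamma>) * t powr b" by (simp add: \<gamma>_def flip: powr_add)
  also have "C * (t / 8) powr b = \<kappa> * t powr b"
    using tt powr_mult[of t "1/8" b] by (simp add: \<kappa>_def)
  finally have "\<kappa> \<le> 4 * t powr \<gamma>" using tt by simp
  then show False using tg \<kappa> by simp
qed

theorem theorem4p2: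
  shows "(\<exists>\<delta>>0. \<exists>C>0. \<forall>E :: (real^2) set.
            E \<noteq> {} \<and> bounded E \<and> open E \<and> convex E \<and> deficit E \<le> \<delta> \<longrightarrow>
            C * hausdorff_asymmetry E powr (5/2) \<le> deficit E)
       \<and> (\<forall>\<beta><5/2. \<not> (\<exists>\<delta>'>0. \<exists>C'>0. \<forall>E :: (real^2) set.
            E \<noteq> {} \<and> bounded E \<and> open E \<and> convex E \<and> deficit E \<le> \<delta>' \<longrightarrow>
            C' * hausdorff_asymmetry E powr \<beta> \<le> deficit E))"
proof (intro conjI allI impI notI)
  show "\<exists>\<delta>>0. \<exists>C>0. \<forall>E :: (real^2) set. E \<noteq> {} \<and> bounded E \<and> open E \<and> convex E \<and> deficit E \<le> \<delta> \<longrightarrow>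
            C * hausdorff_asymmetry E powr (5/2) \<le> deficit E"
    using deficit_lower_bound by (intro exI[of _ 1] conjI exI[of _ "1 / (200 * pi\<^sup>2)"]) auto
next
  fix \<beta> :: real assume "\<beta> < 5/2" "\<exists>\<delta>'>0. \<exists>C'>0. \<forall>E :: (real^2) set.
            E \<noteq> {} \<and> bounded E \<and> open E \<and> convex E \<and> deficit E \<le> \<delta>' \<longrightarrow>
            C' * hausdorff_asymmetry E powr \<beta> \<le> deficit E"
  then show False using exponent_sharp by blast
qed

end
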